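(* Let $K$ be a compact metrizable median algebra of finite rank and let $T:K\to K$ be a homeomorphic median automorphism of $K$. Then the cascade $(K,T)$ satisfies Sarnak's M\"obius Disjointness Conjecture, i.e. for every continuous function $\varphi\in C(K)$ and every $x\in K$, $$\lim_{N\to\infty}\frac1N\sum_{n=1}^{N}\mu(n)\,\varphi(T^n x)=0.$$
   Context: A median algebra is a set $K$ with a ternary operation $m:K^3\to K$ such that $m$ is invariant under permutations of its arguments, $m(a,b,b)=b$, and $m(m(a,x,b),x,c)=m(a,x,m(b,x,c))$ for all $a,b,c,x\in K$. A compact metrizable median algebra is a compact metrizable space with a continuous median operation. The rank of $K$ is the supremum of the $n\in\mathbb N$ such that $\{0,1\}^n$ (with coordinatewise median) embeds in $K$ as a median subalgebra. A homeomorphic median automorphism is a homeomorphism $T:K\to K$ with $T(m(x,y,z))=m(Tx,Ty,Tz)$ for all $x,y,z\in K$. A cascade is the $\mathbb Z$-system generated by a homeomorphism. $\mu:\mathbb N\to\{-1,0,1\}$ is the M\"obius function: $\mu(1)=1$, $\mu(n)=(-1)^t$ if $n$ is a product of $t$ distinct primes, and $\mu(n)=0$ otherwise. *)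

theory Defs
  imports
    "HOL-Analysis.Analysis"
    "HOL-Computational_Algebra.Squarefree"
    "HOL-Library.Extended_Nat"
    "HOL-Library.FuncSet"
begin

(* The two adjacent transpositions generate all permutations of the three arguments. *)
locale median_algebra =
  fixes K :: "'a set" and m :: "'a \<Rightarrow> 'a \<Rightarrow> 'a \<Rightarrow> 'a"
  assumes closed: "\<lbrakk>a \<in> K; b \<in> K; c \<in> K\<rbrakk> \<Longrightarrow> m a b c \<in> K"
    and swap12: "\<lbrakk>a \<in> K; b \<in> K; c \<in> K\<rbrakk> \<Longrightarrow> m a b c = m b a c"
    and swap23: "\<lbrakk>a \<in> K; b \<in> K; c \<in> K\<rbrakk> \<Longrightarrow> m a b c = m a c b"
    and majority: "\<lbrakk>a \<in> K; b \<in> K\<rbrakk> \<Longrightarrow> m a b b = b"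
    and assoc: "\<lbrakk>a \<in> K; b \<in> K; c \<in> K; x \<in> K\<rbrakk> \<Longrightarrow> m (m a x b) x c = m a x (m b x c)"

locale compact_metrizable_median_algebra = median_algebra "topspace X" m
  for X :: "'a topology" and m :: "'a \<Rightarrow> 'a \<Rightarrow> 'a \<Rightarrow> 'a" +
  assumes compact: "compact_space X"
    and metrizable: "metrizable_space X"
    and continuous_median:
      "continuous_map (prod_topology X (prod_topology X X)) X (\<lambda>(x, y, z). m x y z)"

definition binary_cube :: "nat \<Rightarrow> (nat \<Rightarrow> nat) set" where
  "binary_cube n = {..<n} \<rightarrow>\<^sub>E {0, 1}"

(* The middle one of three numbers; on {0, 1} it is the majority vote. *)
definition median3 :: "nat \<Rightarrow> nat \<Rightarrow> nat \<Rightarrow> nat" where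
  "median3 a b c = max (min a b) (max (min b c) (min a c))"

definition cube_median ::
    "nat \<Rightarrow> (nat \<Rightarrow> nat) \<Rightarrow> (nat \<Rightarrow> nat) \<Rightarrow> (nat \<Rightarrow> nat) \<Rightarrow> nat \<Rightarrow> nat" where
  "cube_median n u v w = (\<lambda>i\<in>{..<n}. median3 (u i) (v i) (w i))"

definition cube_embeds :: "'a set \<Rightarrow> ('a \<Rightarrow> 'a \<Rightarrow> 'a \<Rightarrow> 'a) \<Rightarrow> nat \<Rightarrow> bool" where
  "cube_embeds K m n \<longleftrightarrow>
     (\<exists>f. f ` binary_cube n \<subseteq> K \<and> inj_on f (binary_cube n) \<and>
          (\<forall>u\<in>binary_cube n. \<forall>v\<in>binary_cube n. \<forall>w\<in>binary_cube n.
             f (cube_median n u v w) = m (f u) (f v) (f w)))"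

definition median_rank :: "'a set \<Rightarrow> ('a \<Rightarrow> 'a \<Rightarrow> 'a \<Rightarrow> 'a) \<Rightarrow> enat" where
  "median_rank K m = (SUP n\<in>{n. cube_embeds K m n}. enat n)"

lemma median_algebra_cube: "median_algebra (binary_cube n) (cube_median n)"
proof
  have in01: "u i = 0 \<or> u i = 1" if "u \<in> binary_cube n" "i < n" for u i
    using that by (auto simp: binary_cube_def PiE_iff)
  have med01: "median3 p q r = 0 \<or> median3 p q r = 1"
    if "p = 0 \<or> p = 1" "q = 0 \<or> q = 1" "r = 0 \<or> r = 1" for p q r
    using that by (elim disjE) (simp_all add: median3_def)
  have med_assoc: "median3 (median3 p y q) y r = median3 p y (median3 q y r)"
    if "p = 0 \<or> p = 1" "y = 0 \<or> y = 1" "q = 0 \<or> q = 1" "r = 0 \<or> r = 1" for p y q r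
    using that by (elim disjE) (simp_all add: median3_def)
  {
    fix a b c x
    assume K: "a \<in> binary_cube n" "b \<in> binary_cube n" "c \<in> binary_cube n"
    have "median3 (a i) (b i) (c i) \<in> {0, 1}" if "i < n" for i
      using med01[OF in01[OF K(1) that] in01[OF K(2) that] in01[OF K(3) that]] by blast
    then show "cube_median n a b c \<in> binary_cube n"
      by (simp add: binary_cube_def cube_median_def PiE_iff)
    have "median3 p q r = median3 q p r" "median3 p q r = median3 p r q" for p q r
      by (simp_all add: median3_def min.commute max.commute max.left_commute)
    then show "cube_median n a b c = cube_median n b a c"
      "cube_median n a b c = cube_median n a c b"
      unfolding cube_median_def by metis+
    assume x: "x \<in> binary_cube n"
    show "cube_median n (cube_median n a x b) x c = cube_median n a x (cube_median n b x c)"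
      unfolding cube_median_def
    proof (rule restrict_ext)
      fix i assume "i \<in> {..<n}"
      then have i: "i < n" by simp
      show "median3 ((\<lambda>i\<in>{..<n}. median3 (a i) (x i) (b i)) i) (x i) (c i) =
          median3 (a i) (x i) ((\<lambda>i\<in>{..<n}. median3 (b i) (x i) (c i)) i)"
        using med_assoc[OF in01[OF K(1) i] in01[OF x i] in01[OF K(2) i] in01[OF K(3) i]] i
        by simp
    qed
  }
  fix a b
  assume K: "a \<in> binary_cube n" "b \<in> binary_cube n"
  show "cube_median n a b b = b"
  proof
    fix i
    show "cube_median n a b b i = b i"
    proof (cases "i < n")
      case True
      then show ?thesis by (simp add: cube_median_def median3_def)
    next
      case False
      then show ?thesis
        using K(2) by (simp add: cube_median_def binary_cube_def PiE_iff extensional_def)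
    qed
  qed
qed

definition homeomorphic_median_automorphism ::
    "'a topology \<Rightarrow> ('a \<Rightarrow> 'a \<Rightarrow> 'a \<Rightarrow> 'a) \<Rightarrow> ('a \<Rightarrow> 'a) \<Rightarrow> bool" where
  "homeomorphic_median_automorphism X m T \<longleftrightarrow>
     homeomorphic_map X X T \<and>
     (\<forall>x\<in>topspace X. \<forall>y\<in>topspace X. \<forall>z\<in>topspace X. T (m x y z) = m (T x) (T y) (T z))"

definition moebius_mu :: "nat \<Rightarrow> int" where
  "moebius_mu n = (if squarefree n then (-1) ^ card (prime_factors n) else 0)"

lemma moebius_mu_1: "moebius_mu 1 = 1"
  by (simp add: moebius_mu_def)

lemma moebius_mu_prod_primes:
  assumes "finite P" "\<And>p. p \<in> P \<Longrightarrow> prime p"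
  shows "moebius_mu (\<Prod>P) = (-1) ^ card P"
proof -
  have "squarefree (\<Prod>p\<in>P. p)"
    using assms by (intro squarefree_prod_coprime) (auto intro: primes_coprime squarefree_prime)
  moreover have "prime_factors (\<Prod>p\<in>P. p) = P"
    using assms by (subst prime_factors_prod) (auto simp: prime_prime_factors dest!: assms(2))
  ultimately show ?thesis by (simp add: moebius_mu_def)
qed

lemma moebius_mu_eq_0:
  assumes "\<nexists>P. finite P \<and> (\<forall>p\<in>P. prime p) \<and> n = \<Prod>P"
  shows "moebius_mu n = 0"
proof (rule ccontr)
  assume "moebius_mu n \<noteq> 0"
  then have sq: "squarefree n" by (auto simp: moebius_mu_def split: if_splits)
  then have nz: "n \<noteq> 0" by (metis not_squarefree_0)
  have "n = (\<Prod>p\<in>prime_factors n. p ^ multiplicity p n)"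
    using nz by (simp add: prime_factorization_nat)
  also have "\<dots> = \<Prod>(prime_factors n)"
    using sq nz by (intro prod.cong) (auto simp: squarefree_factorial_semiring')
  finally show False using assms by blast
qed

end

theory Submission
  imports
    Defs
    "HOL-Complex_Analysis.Complex_Analysis"
    "HOL-Number_Theory.Residues"
begin

text \<open>In a median algebra of rank at most \<open>r\<close>, pairwise crossing halfspaces number at most \<open>r\<close>. Among the
  translates of a halfspace \<open>H\<close> under \<open>T\<close>, either two are nested, and then the visits of an orbit to \<open>H\<close> are
  monotone along residue classes; or no two are disjoint or no two cover the whole space, and then the
  translates missing \<open>x\<close>, respectively those containing \<open>x\<close>, cross pairwise, so they
  number at most \<open>r\<close>. Hence \<open>n \<mapsto> T\<^sup>n x \<in> H\<close> is eventually periodic. By finite rank, iterating joins \<open>r\<close>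
  times gives the convex hull, so \<open>X\<close> is locally convex and, by compactness, \<open>\<phi>\<close> is up to \<open>\<epsilon>\<close> a function of
  finitely many halfspaces; so \<open>n \<mapsto> \<phi> (T\<^sup>n x)\<close> is a uniform limit of eventually periodic sequences.

  It remains to see that \<open>\<mu>\<close> is orthogonal to periodic sequences, which is the prime number theorem in
  arithmetic progressions. Periodic sequences reduce to Dirichlet characters; \<open>L(s, \<chi>)\<close> continues to
  \<open>Re s > 0\<close> by partial summation; it does not vanish on \<open>Re s = 1\<close>, since otherwise
  \<open>L(s, \<chi>\<^sub>0)\<^sup>2 L(s + it, \<chi>) L(s - it, \<chi>')\<close>, \<open>\<chi>'\<close> the conjugate of \<open>\<chi>\<close>, would be holomorphic for \<open>Re s > 0\<close>,
  contradicting Landau's theorem because its coefficients are nonnegative and at least \<open>1\<close> at squares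
  prime to the modulus; and Newman's contour integral applied to \<open>1 / L(s, \<chi>)\<close> shows that
  \<open>\<Sum> \<mu>(n) \<chi>(n) / n\<close> converges.\<close>

section \<open>Convexity and halfspaces in median algebras\<close>

text \<open>A halfspace obtained by separation need not be open or closed, so visits to it cannot be
  controlled by continuity. Topology therefore enters only when \<phi> is replaced by finitely many
  halfspaces; from then on an orbit is treated combinatorially, with the rank as the only
  quantitative bound. The two non-nested alternatives exclude each other because a disjoint pair and
  a covering pair of translates, suitably shifted, would share a translate and thereby produce a
  nested pair after all.

  On the arithmetic side the series with terms \<mu>(n) \<chi>(n) / n is used instead of the means,
  since Newman's method controls exactly such partial sums, and Kronecker's lemma recovers the
  means. The product in the nonvanishing proof has a double pole at s = 1, and a zero of L at 1 + it
  creates exactly two zeros there, one for \<chi> and one for its conjugate. Real characters and t =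
  0 are covered by the same count. For the principal character there are further poles at 1 + it and
  1 - it, and the two principal factors supply the zeros against them.\<close>

context median_algebra
begin

section \<open>Betweenness, medians and gates\<close>

lemma majority_left: "\<lbrakk>a \<in> K; b \<in> K\<rbrakk> \<Longrightarrow> m a a b = a"
  using majority[of b a] swap12[of b a a] swap23[of a b a] by simp

text \<open>With \<open>p\<close> fixed, \<open>betw p x y\<close> is the order x \<le> y of a meet
  semilattice with least element \<open>p\<close> and meet \<open>m p x y\<close>. The next lemmas
  are its order laws; most arguments below consist in changing the base point.\<close>

abbreviation betw :: "'a \<Rightarrow> 'a \<Rightarrow> 'a \<Rightarrow> bool"
  where "betw a x b \<equiv> m a x b = x"

lemma betw_sym: "\<lbrakk>a \<in> K; x \<in> K; b \<in> K; betw a x b\<rbrakk> \<Longrightarrow> betw b x a"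
  using swap12 swap23 by metis

lemma betw_med:
  assumes "a \<in> K" "b \<in> K" "c \<in> K"
  shows "betw a (m a b c) b" "betw a (m a b c) c" "betw b (m a b c) c"
proof -
  have *: "betw p (m p x y) y" if "p \<in> K" "x \<in> K" "y \<in> K" for p x y
    using assoc[of x y y p] that closed majority swap12 swap23 by metis
  show "betw a (m a b c) b" "betw a (m a b c) c" "betw b (m a b c) c"
    using * assms swap12 swap23 closed by metis+
qed

text \<open>The second conclusion changes the base point: a chain x \<le> y \<le> z over
  \<open>p\<close> leaves y \<le> z over \<open>x\<close>.\<close>

lemma betw_trans:
  assumes "p \<in> K" "x \<in> K" "y \<in> K" "z \<in> K" "betw p x y" "betw p y z"
  shows "betw p x z" "betw x y z"
proof -
  have "m x p z = m (m x p y) p z" using assms swap12 by metis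
  also have "\<dots> = m x p (m y p z)" using assms assoc by metis
  also have "\<dots> = x" using assms swap12 by metis
  finally show "betw p x z" using assms swap12 by metis
  show "betw x y z"
    using assms assoc[of x p z y] majority swap12 swap23 closed by metis
qed

lemma betw_antisym: "\<lbrakk>p \<in> K; x \<in> K; y \<in> K; betw p x y; betw p y x\<rbrakk> \<Longrightarrow> x = y"
  using swap23 by metis

lemma betw_glb:
  assumes "p \<in> K" "w \<in> K" "x \<in> K" "y \<in> K" "betw p w x" "betw p w y"
  shows "betw p w (m p x y)"
  using assms assoc[of w x y p] swap12 closed by metis

text \<open>A point of all three intervals lies below the median u over \<open>x\<close> and over
  \<open>y\<close>. Since u lies between \<open>x\<close> and \<open>y\<close>, the first relation
  yields the reverse of the second, and antisymmetry over \<open>y\<close> applies.\<close>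

lemma med_unique:
  assumes K: "x \<in> K" "y \<in> K" "z \<in> K" "w \<in> K" and b: "betw x w y" "betw y w z" "betw x w z"
  shows "w = m x y z"
proof -
  define u where "u = m x y z"
  have u: "u \<in> K" "betw x u y" using K betw_med closed by (auto simp: u_def)
  have "betw x w u" "betw y w u"
    using betw_glb[of x w y z] betw_glb[of y w x z] K b betw_sym swap12 u_def by metis+
  moreover have "betw w u y" using betw_trans(2)[of x w u y] calculation K u by blast
  ultimately show ?thesis using betw_antisym[of y w u] betw_sym K u u_def by metis
qed

text \<open>The gates d of \<open>x\<close> in [a, c] and e of \<open>x\<close> in [b, c] complete
  the line a, c, b to a line a, d, c, e, b.\<close>

lemma betw_meets:
  assumes K: "a \<in> K" "b \<in> K" "c \<in> K" "x \<in> K" and c: "betw a c b"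
  shows "betw (m x a c) c (m x b c)" "betw a (m x a c) b" "betw a (m x a c) (m x b c)"
    "betw a (m x b c) b"
proof -
  define d where "d = m x a c"
  define e where "e = m x b c"
  have de: "d \<in> K" "e \<in> K" "betw a d c" "betw b e c"
    using K closed betw_med by (auto simp: d_def e_def)
  have 1: "betw a d b" "betw d c b" using betw_trans[of a d c b] K de c by auto
  have 2: "betw b e a" "betw e c a" using betw_trans[of b e c a] K de c betw_sym by metis+
  have 3: "betw b e d" "betw e c d" using betw_trans[of b e c d] K de 1 betw_sym by metis+
  show "betw (m x a c) c (m x b c)" "betw a (m x a c) b" "betw a (m x b c) b"
    using 1 2 3 betw_sym K de unfolding d_def e_def by metis+
  show "betw a (m x a c) (m x b c)"
    using betw_trans(1)[of a d c e] 2 betw_sym K de unfolding d_def e_def by metis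
qed

text \<open>The median \<open>m a b x\<close> is the gate of \<open>x\<close> in the interval
  [a, b]. The meet t over \<open>x\<close> of the gates in [a, c] and [b, c] lies below d, hence
  below \<open>c\<close>; it also lies in the three intervals spanned by \<open>a\<close>,
  \<open>b\<close>, \<open>x\<close>, so \<open>med_unique\<close> identifies it with the
  median.\<close>

lemma betw_gate:
  assumes K: "a \<in> K" "b \<in> K" "c \<in> K" "x \<in> K" and c: "betw a c b"
  shows "betw c (m a b x) x"
proof -
  define d where "d = m x a c"
  define e where "e = m x b c"
  define t where "t = m x d e"
  have de: "d \<in> K" "e \<in> K" "t \<in> K" "betw x d a" "betw x e b" "betw x d c" "betw x t d" "betw x t e" "betw d t e"
    using K closed betw_med by (auto simp: d_def e_def t_def)
  have *: "betw d c e" "betw a d b" "betw a d e" "betw a e b"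
    using betw_meets[OF K c] by (auto simp: d_def e_def)
  have "betw e t a" using betw_trans(1)[of e t d a] * de K betw_sym by metis
  then have "betw a t b" using betw_trans(1)[of a t e b] * de K betw_sym by metis
  moreover have "betw x t a" "betw x t b" "betw x t c"
    using betw_trans(1)[of x t d a] betw_trans(1)[of x t e b] betw_trans(1)[of x t d c] de K by auto
  ultimately have "t = m a b x" "betw x t c"
    using med_unique[of a b x t] de K betw_sym by metis+
  then show ?thesis using betw_sym K de by metis
qed

section \<open>Convex sets, joins and Pasch configurations\<close>

definition convex_in :: "'a set \<Rightarrow> bool"
  where "convex_in C \<longleftrightarrow> C \<subseteq> K \<and> (\<forall>x\<in>C. \<forall>y\<in>C. \<forall>z\<in>K. m x y z \<in> C)"

lemma convex_in_betw: "\<lbrakk>convex_in C; x \<in> C; y \<in> C; w \<in> K; betw x w y\<rbrakk> \<Longrightarrow> w \<in> C"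
  unfolding convex_in_def using swap23 by (metis subsetD)

text \<open>For fixed \<open>x\<close> and \<open>y\<close> the values \<open>m x y z\<close> are
  exactly the points between them, so closure under \<open>m\<close> and closure under intervals
  agree.\<close>

lemma convex_inI:
  assumes "C \<subseteq> K" "\<And>x y w. \<lbrakk>x \<in> C; y \<in> C; w \<in> K; betw x w y\<rbrakk> \<Longrightarrow> w \<in> C"
  shows "convex_in C"
  unfolding convex_in_def using assms betw_med(1) closed by (metis subsetD)

text \<open>Peano's axiom with an explicit witness: w lies between \<open>p\<close> and the point
  \<open>m c v w\<close> of [c, v]. If s is the gate of w in [c, p], then u, s, w, v are in line,
  and associativity rewrites the required median as \<open>m s w v\<close>.\<close>

lemma betw_peano:
  assumes K: "c \<in> K" "p \<in> K" "u \<in> K" "v \<in> K" "w \<in> K" and "betw c u p" "betw u w v"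
  shows "betw (m c v w) w p"
proof -
  define s where "s = m c p w"
  have s: "s \<in> K" using K closed by (simp add: s_def)
  have "betw u s w" using betw_gate[of c p u w] assms by (simp add: s_def)
  then have "betw s w v" using betw_trans(2)[of u s w v] K s assms by blast
  moreover have "m (m c v w) w p = m s w v"
  proof -
    have "m (m c v w) w p = m (m v w c) w p" using K swap12 swap23 closed by metis
    also have "\<dots> = m v w (m c w p)" using K assoc by metis
    also have "\<dots> = m s w v" unfolding s_def using K swap12 swap23 closed by metis
    finally show ?thesis .
  qed
  ultimately show ?thesis by simp
qed

text \<open>Peano's property is used twice: it places w between \<open>p\<close> and a point e of
  [c, y], then e between \<open>p\<close> and a point f of the chord [d, c], which lies in
  C.\<close>

lemma convex_in_join:
  assumes C: "convex_in C" and p: "p \<in> K"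
  shows "convex_in {w \<in> K. \<exists>c\<in>C. betw c w p}"
proof (rule convex_inI)
  fix x y w
  assume x: "x \<in> {w \<in> K. \<exists>c\<in>C. betw c w p}" and y: "y \<in> {w \<in> K. \<exists>c\<in>C. betw c w p}"
    and w: "w \<in> K" "betw x w y"
  obtain c d where cd: "c \<in> C" "d \<in> C" "betw c x p" "betw d y p" using x y by auto
  have K: "c \<in> K" "d \<in> K" "x \<in> K" "y \<in> K" using C cd x y by (auto simp: convex_in_def)
  define e where "e = m c y w"
  have e: "e \<in> K" "betw e w p" "betw c e y"
    using betw_peano[of c p x y w] K p w cd closed betw_med unfolding e_def by auto
  define f where "f = m d c e"
  have f: "f \<in> K" "betw f e p" "betw d f c"
    using betw_peano[of d p y c e] K p e cd closed betw_med betw_sym unfolding f_def by metis+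
  have "f \<in> C" using convex_in_betw[OF C] cd f by blast
  moreover have "betw f w p"
    using betw_trans(1)[of p w e f] betw_sym K p w e f by metis
  ultimately show "w \<in> {w \<in> K. \<exists>c\<in>C. betw c w p}" using w by auto
qed auto

text \<open>Let w = \<open>m b1 b2 z\<close>. The gates e1, e2 of w in [h1, z] and [h2, z] belong to
  C by convexity, so it suffices that w lies between them, that is, that their meet k over w is w
  itself. This configuration is what makes the complement of a maximal convex set convex.\<close>

lemma betw_pasch:
  assumes C: "convex_in C" and h: "h1 \<in> C" "h2 \<in> C" "z \<in> C"
    and K: "x \<in> K" "y \<in> K" "b1 \<in> K" "b2 \<in> K"
    and b: "betw h1 b1 x" "betw h2 b2 y" "betw x z y"
  shows "m b1 b2 z \<in> C"
proof -
  have hK: "h1 \<in> K" "h2 \<in> K" "z \<in> K" using C h by (auto simp: convex_in_def)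
  define w where "w = m b1 b2 z"
  have w: "w \<in> K" "betw b1 w b2" "betw b1 w z" "betw b2 w z"
    using K hK closed betw_med unfolding w_def by auto
  define x' where "x' = m w x z"
  define y' where "y' = m w y z"
  have xy: "x' \<in> K" "y' \<in> K" "betw x' z y'" "betw w x' x" "betw w x' z" "betw w y' y" "betw w y' z"
    using K hK w betw_meets(1)[of x y z w] b closed betw_med unfolding x'_def y'_def by auto
  define e1 where "e1 = m h1 z w"
  define e2 where "e2 = m h2 z w"
  have e: "e1 \<in> C" "e2 \<in> C" "e1 \<in> K" "e2 \<in> K" using C h hK w unfolding e1_def e2_def convex_in_def by auto
  have ew: "betw w e1 h1" "betw w e1 z" "betw w e2 h2" "betw w e2 z"
    using betw_med[of _ z w] K hK w betw_sym closed unfolding e1_def e2_def by metis+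
  define k where "k = m w e1 e2"
  have k: "k \<in> K" "betw w k e1" "betw w k e2" using betw_med w e closed unfolding k_def by auto
  have k2: "betw w k h1" "betw w k h2" "betw w k z"
    using betw_trans(1)[of w k] k e w hK ew by metis+
  \<comment> \<open>In the semilattice with least element \<open>w\<close>, the element \<open>k\<close> is disjoint from \<open>x'\<close> and \<open>y'\<close>.\<close>
  have disj: "betw k w a'"
    if a: "h \<in> K" "a \<in> K" "a' \<in> K" "c \<in> K" "betw h c a" "betw w a' a" "betw w a' z" "betw w k h" "betw c w z"
    for h a a' c
  proof -
    define l where "l = m w k a'"
    have l: "l \<in> K" "betw w l k" "betw w l a'" using betw_med closed w k a unfolding l_def by auto
    have "betw w l h" "betw w l a" "betw w l z"
      using betw_trans(1)[of w l] l a w k hK by metis+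
    then have "betw w l (m w h a)" using betw_glb l a w by blast
    moreover have "betw w (m w h a) c"
      using betw_gate[of h a c w] a w betw_sym closed swap12 swap23 by metis
    ultimately have "betw w l c" using betw_trans(1)[of w l "m w h a" c] l a w closed by blast
    then have "betw w l (m w c z)" using betw_glb[of w l c z] l a w hK \<open>betw w l z\<close> by blast
    moreover have "m w c z = w" using a w hK swap12 by metis
    ultimately have "l = w" using l w majority swap12 swap23 by metis
    then show ?thesis unfolding l_def using swap12 w k a by metis
  qed
  have "betw k w x'" "betw k w y'"
    using disj[of h1 x x' b1] disj[of h2 y y' b2] K hK xy k2 b w by auto
  then have "betw k w (m k x' y')" using betw_glb k w xy by blast
  \<comment> \<open>\<open>m k x' y'\<close> is the gate of k in [x', y'], an interval containing
    \<open>z\<close>. Hence w lies between k and \<open>z\<close>, while k lies between w and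
    \<open>z\<close>, which forces k = w.\<close>
  moreover have "betw k (m k x' y') z"
    using betw_gate[of x' y' z k] xy hK k closed betw_sym swap12 swap23 by metis
  ultimately have "betw k w z" using betw_trans(1)[of k w "m k x' y'" z] k w hK xy closed by blast
  then have "k = w" using k2(3) betw_antisym[of z k w] betw_sym k w hK by metis
  then have "betw e1 w e2" using k_def swap12 w e by metis
  then show ?thesis using convex_in_betw[OF C e(1,2) w(1)] w_def by simp
qed

section \<open>Halfspaces and Kakutani separation\<close>

definition halfspace :: "'a set \<Rightarrow> bool"
  where "halfspace H \<longleftrightarrow> convex_in H \<and> convex_in (K - H)"

lemma halfspace_compl: "halfspace H \<Longrightarrow> halfspace (K - H)"
  unfolding halfspace_def convex_in_def by (auto simp: double_diff)

lemma halfspace_sub: "halfspace H \<Longrightarrow> H \<subseteq> K"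
  unfolding halfspace_def convex_in_def by auto

text \<open>Membership in a halfspace is a median homomorphism to the majority vote on two values.
  As halfspaces separate points, identities between medians can be checked one halfspace at a
  time.\<close>

lemma halfspace_med:
  assumes "halfspace H" "x \<in> K" "y \<in> K" "z \<in> K"
  shows "m x y z \<in> H \<longleftrightarrow> (x \<in> H \<and> y \<in> H) \<or> (y \<in> H \<and> z \<in> H) \<or> (x \<in> H \<and> z \<in> H)"
proof -
  have *: "m x y z \<in> G" if G: "convex_in G" "(x \<in> G \<and> y \<in> G) \<or> (y \<in> G \<and> z \<in> G) \<or> (x \<in> G \<and> z \<in> G)" for G
    using G assms betw_med[of x y z] convex_in_betw[OF G(1)] closed by metis
  show ?thesis using *[of H] *[of "K - H"] assms unfolding halfspace_def by blast
qed

lemma convex_in_Union_chain: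
  assumes "\<And>C. C \<in> \<C> \<Longrightarrow> convex_in C" "\<And>C D. \<lbrakk>C \<in> \<C>; D \<in> \<C>\<rbrakk> \<Longrightarrow> C \<subseteq> D \<or> D \<subseteq> C"
  shows "convex_in (\<Union>\<C>)"
  unfolding convex_in_def
proof (intro conjI ballI)
  show "\<Union>\<C> \<subseteq> K" using assms by (auto simp: convex_in_def)
  fix x y z assume "x \<in> \<Union>\<C>" "y \<in> \<Union>\<C>" "z \<in> K"
  then obtain C where "C \<in> \<C>" "x \<in> C" "y \<in> C" using assms(2) by (metis UnionE subsetD)
  then show "m x y z \<in> \<Union>\<C>" using assms(1) \<open>z \<in> K\<close> unfolding convex_in_def by blast
qed

text \<open>A maximal convex set M that contains A and misses B has convex complement. Joining M to
  an outside point would enlarge it, so the join meets B; if a point of M lay between two outside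
  points, the Pasch configuration would give a common point of M and B.\<close>

lemma kakutani_separation:
  assumes A: "convex_in A" and B: "convex_in B" and disj: "A \<inter> B = {}"
  obtains H where "halfspace H" "A \<subseteq> H" "B \<subseteq> K - H"
\<comment> \<open>The join of M with a point x contains x only when M is nonempty.\<close>
proof (cases "A = {}")
  case True
  moreover have "halfspace {}" using closed unfolding halfspace_def convex_in_def by simp
  moreover have "B \<subseteq> K - {}" using B unfolding convex_in_def by simp
  ultimately show ?thesis using that by blast
next
  case False
  define \<A> where "\<A> = {C. convex_in C \<and> A \<subseteq> C \<and> C \<inter> B = {}}"
  have "\<exists>M\<in>\<A>. \<forall>X\<in>\<A>. M \<subseteq> X \<longrightarrow> X = M"
  proof (rule subset_Zorn_nonempty)
    show "\<A> \<noteq> {}" using A disj by (auto simp: \<A>_def)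
    fix \<C> assume ch: "\<C> \<noteq> {}" "subset.chain \<A> \<C>"
    then have sub: "\<C> \<subseteq> \<A>" and lin: "\<And>C D. \<lbrakk>C \<in> \<C>; D \<in> \<C>\<rbrakk> \<Longrightarrow> C \<subseteq> D \<or> D \<subseteq> C"
      by (simp_all add: subset_chain_def)
    have "convex_in (\<Union>\<C>)"
      by (rule convex_in_Union_chain[OF _ lin]) (use sub in \<open>auto simp: \<A>_def\<close>)
    moreover have "A \<subseteq> \<Union>\<C>" using sub ch(1) by (auto simp: \<A>_def)
    moreover have "\<Union>\<C> \<inter> B = {}" using sub by (auto simp: \<A>_def)
    ultimately show "\<Union>\<C> \<in> \<A>" by (simp add: \<A>_def)
  qed
  then obtain M where "M \<in> \<A>" and mx: "\<forall>X\<in>\<A>. M \<subseteq> X \<longrightarrow> X = M" by blast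
  then have M: "convex_in M" "A \<subseteq> M" "M \<inter> B = {}" by (simp_all add: \<A>_def)
  have max: "X = M" if "convex_in X" "M \<subseteq> X" "X \<inter> B = {}" for X
    using mx that M(2) by (simp add: \<A>_def)
  have MK: "M \<subseteq> K" "M \<noteq> {}" using M False by (auto simp: convex_in_def)
  then obtain c0 where c0: "c0 \<in> M" "c0 \<in> K" by blast
  have ext: "\<exists>h\<in>M. \<exists>b\<in>B. betw h b x" if x: "x \<in> K" "x \<notin> M" for x
  proof (rule ccontr)
    assume no: "\<not> ?thesis"
    define X where "X = {w \<in> K. \<exists>c\<in>M. betw c w x}"
    have "convex_in X" unfolding X_def by (rule convex_in_join[OF M(1) x(1)])
    moreover have "M \<subseteq> X"
    proof
      fix c assume "c \<in> M"
      then have "c \<in> K" "betw c c x" using MK x majority_left by auto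
      then show "c \<in> X" using \<open>c \<in> M\<close> unfolding X_def by blast
    qed
    moreover have "X \<inter> B = {}" using no unfolding X_def by blast
    ultimately have "X = M" by (rule max)
    moreover have "x \<in> X" using c0 x(1) majority[of c0 x] unfolding X_def by blast
    ultimately show False using x(2) by simp
  qed
  have "convex_in (K - M)"
  proof (rule convex_inI)
    fix x y w assume xy: "x \<in> K - M" "y \<in> K - M" "w \<in> K" "betw x w y"
    obtain h1 b1 where 1: "h1 \<in> M" "b1 \<in> B" "betw h1 b1 x" using ext xy by blast
    obtain h2 b2 where 2: "h2 \<in> M" "b2 \<in> B" "betw h2 b2 y" using ext xy by blast
    have bK: "b1 \<in> K" "b2 \<in> K" using 1 2 B unfolding convex_in_def by blast+
    have "w \<notin> M"
    proof
      assume "w \<in> M"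
      then have "m b1 b2 w \<in> M"
        using betw_pasch[OF M(1) 1(1) 2(1) _ _ _ bK 1(3) 2(3) xy(4)] xy(1,2) by blast
      moreover have "m b1 b2 w \<in> B" using B 1(2) 2(2) xy(3) unfolding convex_in_def by blast
      ultimately show False using M(3) by blast
    qed
    then show "w \<in> K - M" using xy(3) by blast
  qed blast
  then have "halfspace M" using M(1) unfolding halfspace_def by blast
  moreover have "B \<subseteq> K - M" using B M(3) unfolding convex_in_def by blast
  ultimately show ?thesis using that M(2) by blast
qed

lemma convex_in_singleton: "x \<in> K \<Longrightarrow> convex_in {x}"
  by (simp add: convex_in_def majority_left)

lemma halfspace_separates:
  assumes "x \<in> K" "y \<in> K" "x \<noteq> y"
  obtains H where "halfspace H" "x \<in> H" "y \<notin> H"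
  using kakutani_separation[of "{x}" "{y}"] convex_in_singleton assms by auto

end

section \<open>Crossing halfspaces and cubes\<close>

lemma cube_embedsI:
  assumes "\<And>u. u \<in> binary_cube n \<Longrightarrow> f u \<in> K" "inj_on f (binary_cube n)"
    "\<And>u v w. \<lbrakk>u \<in> binary_cube n; v \<in> binary_cube n; w \<in> binary_cube n\<rbrakk> \<Longrightarrow>
       f (cube_median n u v w) = m (f u) (f v) (f w)"
  shows "cube_embeds K m n"
  unfolding cube_embeds_def using assms by blast

lemma binary_cube_01: "u \<in> binary_cube n \<Longrightarrow> i < n \<Longrightarrow> u i = 0 \<or> u i = 1"
  unfolding binary_cube_def by (auto simp: PiE_iff)

lemma cube_median_eq_1:
  assumes "u \<in> binary_cube n" "v \<in> binary_cube n" "w \<in> binary_cube n" "i < n"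
  shows "cube_median n u v w i = 1 \<longleftrightarrow> (u i = 1 \<and> v i = 1) \<or> (v i = 1 \<and> w i = 1) \<or> (u i = 1 \<and> w i = 1)"
  using binary_cube_01[OF assms(1,4)] binary_cube_01[OF assms(2,4)] binary_cube_01[OF assms(3,4)] assms(4)
  by (auto simp: cube_median_def median3_def)

context median_algebra
begin

section \<open>Helly's theorem\<close>

lemma convex_in_Int: "\<lbrakk>convex_in A; convex_in B\<rbrakk> \<Longrightarrow> convex_in (A \<inter> B)"
  unfolding convex_in_def by blast

text \<open>The median of one point from each pairwise intersection lies in all three sets.\<close>

lemma convex_in_triple:
  assumes "convex_in A" "convex_in B" "convex_in C" "A \<inter> B \<noteq> {}" "B \<inter> C \<noteq> {}" "A \<inter> C \<noteq> {}"
  shows "A \<inter> B \<inter> C \<noteq> {}"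
proof -
  obtain x y z where x: "x \<in> A" "x \<in> B" and y: "y \<in> B" "y \<in> C" and z: "z \<in> A" "z \<in> C"
    using assms by blast
  have K: "x \<in> K" "y \<in> K" "z \<in> K" using x y z assms unfolding convex_in_def by blast+
  have "m x y z \<in> K" using closed K by blast
  then have "m x y z \<in> B" "m x y z \<in> A" "m x y z \<in> C"
    using convex_in_betw[OF assms(2) x(2) y(1) _ betw_med(1)[OF K]]
      convex_in_betw[OF assms(1) x(1) z(1) _ betw_med(2)[OF K]]
      convex_in_betw[OF assms(3) y(2) z(2) _ betw_med(3)[OF K]] by blast+
  then show ?thesis by blast
qed

text \<open>Intersecting the family with one of its members keeps the pairwise intersections
  nonempty, by the case of three sets.\<close>

lemma convex_in_helly:
  assumes "finite I" "I \<noteq> {}" "\<And>i. i \<in> I \<Longrightarrow> convex_in (C i)"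
    "\<And>i j. \<lbrakk>i \<in> I; j \<in> I\<rbrakk> \<Longrightarrow> C i \<inter> C j \<noteq> {}"
  shows "(\<Inter>i\<in>I. C i) \<noteq> {}"
  using assms
proof (induction I arbitrary: C rule: finite_ne_induct)
  case (singleton i)
  then show ?case by auto
next
  case (insert i I)
  have "(\<Inter>j\<in>I. C i \<inter> C j) \<noteq> {}"
  proof (rule insert.IH)
    fix j k assume jk: "j \<in> I" "k \<in> I"
    have "C i \<inter> C j \<inter> C k \<noteq> {}" using jk by (intro convex_in_triple insert.prems) auto
    then show "C i \<inter> C j \<inter> (C i \<inter> C k) \<noteq> {}" by blast
  qed (use insert.prems in \<open>auto intro!: convex_in_Int\<close>)
  moreover have "(\<Inter>j\<in>insert i I. C j) = (\<Inter>j\<in>I. C i \<inter> C j)" using insert.hyps(2) by blast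
  ultimately show ?case by metis
qed

section \<open>Crossing families and embedded cubes\<close>

definition crossing :: "'a set \<Rightarrow> 'a set \<Rightarrow> bool"
  where "crossing G H \<longleftrightarrow>
    G \<inter> H \<noteq> {} \<and> G - H \<noteq> {} \<and> H - G \<noteq> {} \<and> K - (G \<union> H) \<noteq> {}"

lemma halfspace_eqI:
  assumes "x \<in> K" "y \<in> K" "\<And>H. halfspace H \<Longrightarrow> x \<in> H \<longleftrightarrow> y \<in> H"
  shows "x = y"
  using halfspace_separates[of x y] assms by blast

text \<open>The interval from \<open>a\<close> to \<open>b\<close> is a distributive lattice with
  join \<open>m b u v\<close>, and z is the join of the projections \<open>m a b e\<close>. Seen
  from a halfspace containing \<open>b\<close>, this join is a disjunction of memberships;
  \<open>good\<close> states the induction hypothesis in that form.\<close>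

lemma finite_join:
  assumes K: "a \<in> K" "b \<in> K" and E: "finite E" "E \<subseteq> K"
  obtains z where "z \<in> K"
    "\<And>H. \<lbrakk>halfspace H; a \<notin> H; b \<in> H\<rbrakk> \<Longrightarrow> z \<in> H \<longleftrightarrow> (\<exists>e\<in>E. e \<in> H)"
    "\<And>H. \<lbrakk>halfspace H; a \<in> H; b \<in> H\<rbrakk> \<Longrightarrow> z \<in> H"
proof -
  define good where "good E z \<longleftrightarrow> (\<forall>H. halfspace H \<longrightarrow> b \<in> H \<longrightarrow> (z \<in> H \<longleftrightarrow> a \<in> H \<or> (\<exists>e\<in>E. e \<in> H)))"
    for E z
  have "\<exists>z\<in>K. good E z"
    using E
  proof (induction E rule: finite_induct)
    case empty
    have "good {} a" by (simp add: good_def)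
    then show ?case using K(1) by blast
  next
    case (insert e E)
    then obtain z where z: "z \<in> K" "good E z" by blast
    have e: "e \<in> K" "m a b e \<in> K" using insert.prems closed K by blast+
    have "good (insert e E) (m b z (m a b e))"
      unfolding good_def
    proof (intro allI impI)
      fix H assume H: "halfspace H" "b \<in> H"
      have "m b z (m a b e) \<in> H \<longleftrightarrow> z \<in> H \<or> m a b e \<in> H"
        using halfspace_med[OF H(1) K(2) z(1) e(2)] H(2) by blast
      also have "m a b e \<in> H \<longleftrightarrow> a \<in> H \<or> e \<in> H"
        using halfspace_med[OF H(1) K e(1)] H(2) by blast
      finally show "m b z (m a b e) \<in> H \<longleftrightarrow> a \<in> H \<or> (\<exists>e\<in>insert e E. e \<in> H)"
        using z(2) H unfolding good_def by blast
    qed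
    then show ?case using closed K(2) z(1) e(2) by blast
  qed
  then show ?thesis using that unfolding good_def by blast
qed

lemma crossing_sym: "crossing G H \<Longrightarrow> crossing H G"
  unfolding crossing_def by (simp add: Int_commute Un_commute)

lemma crossing_sector:
  fixes n :: nat
  assumes H: "\<And>i. i < n \<Longrightarrow> halfspace (H i)"
    and cr: "\<And>i j. \<lbrakk>i < j; j < n\<rbrakk> \<Longrightarrow> crossing (H i) (H j)"
    and n: "2 \<le> n"
  obtains x where "x \<in> K" "\<And>i. i < n \<Longrightarrow> x \<in> H i \<longleftrightarrow> P i"
proof -
  define C where "C i = (if P i then H i else K - H i)" for i
  have cr': "crossing (H i) (H j)" if "i \<noteq> j" "i < n" "j < n" for i j
    using that cr[of i j] crossing_sym[OF cr[of j i]] by (cases "i < j") auto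
  \<comment> \<open>A single halfspace is known to be proper only through its crossing with another
    one, which exists because n is at least 2.\<close>
  have ne: "H i \<noteq> {} \<and> K - H i \<noteq> {}" if "i < n" for i
  proof -
    define j where "j = (if i = 0 then 1 else 0 :: nat)"
    have "j < n" "j \<noteq> i" using n by (auto simp: j_def)
    then show ?thesis using cr'[of i j] that unfolding crossing_def by blast
  qed
  have "(\<Inter>i\<in>{..<n}. C i) \<noteq> {}"
  proof (rule convex_in_helly)
    show "{..<n} \<noteq> {}" using n by (simp add: lessThan_empty_iff)
    show "convex_in (C i)" if "i \<in> {..<n}" for i
      using H that unfolding C_def halfspace_def by auto
    show "C i \<inter> C j \<noteq> {}" if ij: "i \<in> {..<n}" "j \<in> {..<n}" for i j
    proof (cases "i = j")
      case True
      then show ?thesis using ne ij unfolding C_def by auto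
    next
      case False
      then have "H i \<subseteq> K" "H j \<subseteq> K" "crossing (H i) (H j)" using cr' ij H halfspace_sub by auto
      then show ?thesis unfolding C_def crossing_def by (auto split: if_splits)
    qed
  qed auto
  then obtain x where x: "\<And>i. i < n \<Longrightarrow> x \<in> C i" by auto
  have "x \<in> K" using x[of 0] n H[of 0] halfspace_sub unfolding C_def by (auto split: if_splits)
  moreover have "x \<in> H i \<longleftrightarrow> P i" if "i < n" for i
    using x[OF that] unfolding C_def by (auto split: if_splits)
  ultimately show ?thesis using that by blast
qed

text \<open>Arbitrary points of the sectors need not form a subalgebra, so the vertices are built as
  joins. For a halfspace G with \<open>a\<close> outside and \<open>b\<close> inside there are three
  cases: G contains two of the points \<open>e i\<close>, and then every vertex; or exactly one, and
  then \<open>f u\<close> lies in G iff \<open>u i = 1\<close>; or none, and then no vertex. In each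
  case membership in G commutes with the majority vote. Every other halfspace is the complement of
  such a G or has all vertices on one side.\<close>

lemma crossing_cube_embeds:
  assumes H: "\<And>i. i < n \<Longrightarrow> halfspace (H i)"
    and cr: "\<And>i j. \<lbrakk>i < j; j < n\<rbrakk> \<Longrightarrow> crossing (H i) (H j)"
    and n: "2 \<le> n"
  shows "cube_embeds K m n"
proof -
  obtain a where a: "a \<in> K" "\<And>i. i < n \<Longrightarrow> a \<notin> H i" using crossing_sector[of n H "\<lambda>_. False"] assms by metis
  obtain b where b: "b \<in> K" "\<And>i. i < n \<Longrightarrow> b \<in> H i" using crossing_sector[of n H "\<lambda>_. True"] assms by metis
  have "\<exists>x\<in>K. \<forall>i<n. x \<in> H i \<longleftrightarrow> i = j" for j
    using crossing_sector[of n H "\<lambda>i. i = j"] assms by metis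
  then obtain e where e: "\<And>j. e j \<in> K" "\<And>i j. i < n \<Longrightarrow> e j \<in> H i \<longleftrightarrow> i = j" by metis
  \<comment> \<open>Joining the pairwise meets makes the generators \<open>e i\<close> disjoint, so that they span a cube.\<close>
  define E where "E u = e ` {i. i < n \<and> u i = 1} \<union> {m a (e i) (e j) | i j. i < j \<and> j < n}" for u :: "nat \<Rightarrow> nat"
  have E: "finite (E u)" "E u \<subseteq> K" for u
  proof -
    have "{m a (e i) (e j) | i j. i < j \<and> j < n} \<subseteq> (\<lambda>(i, j). m a (e i) (e j)) ` ({..<n} \<times> {..<n})"
      by force
    then have "finite {m a (e i) (e j) | i j. i < j \<and> j < n}" by (rule finite_subset) simp
    then show "finite (E u)" unfolding E_def by simp
    show "E u \<subseteq> K" unfolding E_def using e closed a by auto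
  qed
  have "\<exists>z. z \<in> K \<and> (\<forall>G. halfspace G \<longrightarrow> a \<notin> G \<longrightarrow> b \<in> G \<longrightarrow> (z \<in> G \<longleftrightarrow> (\<exists>e\<in>E u. e \<in> G))) \<and>
    (\<forall>G. halfspace G \<longrightarrow> a \<in> G \<longrightarrow> b \<in> G \<longrightarrow> z \<in> G)" for u
    using finite_join[OF a(1) b(1) E[of u]] by metis
  then obtain f where f: "\<And>u. f u \<in> K"
    "\<And>u G. \<lbrakk>halfspace G; a \<notin> G; b \<in> G\<rbrakk> \<Longrightarrow> f u \<in> G \<longleftrightarrow> (\<exists>e\<in>E u. e \<in> G)"
    "\<And>u G. \<lbrakk>halfspace G; a \<in> G; b \<in> G\<rbrakk> \<Longrightarrow> f u \<in> G" by metis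
  have fE: "f u \<in> G \<longleftrightarrow> (\<exists>i<n. u i = 1 \<and> e i \<in> G) \<or> (\<exists>i j. i < j \<and> j < n \<and> e i \<in> G \<and> e j \<in> G)"
    if "halfspace G" "a \<notin> G" "b \<in> G" for u G
  proof -
    have "(\<exists>x\<in>E u. x \<in> G) \<longleftrightarrow>
        (\<exists>i<n. u i = 1 \<and> e i \<in> G) \<or> (\<exists>i j. i < j \<and> j < n \<and> m a (e i) (e j) \<in> G)"
      unfolding E_def by blast
    moreover have "m a (e i) (e j) \<in> G \<longleftrightarrow> e i \<in> G \<and> e j \<in> G" for i j
      using halfspace_med[OF that(1) a(1) e(1) e(1)] that(2) by blast
    ultimately show ?thesis using f(2)[OF that] by simp
  qed
  define M where "M u v w = (\<lambda>G. (f u \<in> G \<and> f v \<in> G) \<or> (f v \<in> G \<and> f w \<in> G) \<or> (f u \<in> G \<and> f w \<in> G))"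
    for u v w
  have main: "f (cube_median n u v w) \<in> G \<longleftrightarrow> M u v w G"
    if uvw: "u \<in> binary_cube n" "v \<in> binary_cube n" "w \<in> binary_cube n" and G: "halfspace G" "a \<notin> G" "b \<in> G"
    for u v w G
  proof (cases "\<exists>i j. i < j \<and> j < n \<and> e i \<in> G \<and> e j \<in> G")
    case True
    then show ?thesis unfolding M_def fE[OF G] by blast
  next
    case False
    have un: "i = j" if "i < n" "j < n" "e i \<in> G" "e j \<in> G" for i j
      using False that by (metis nat_neq_iff)
    have *: "f u \<in> G \<longleftrightarrow> (\<exists>i<n. u i = 1 \<and> e i \<in> G)" for u using fE[OF G] False by blast
    show ?thesis
    proof (cases "\<exists>i<n. e i \<in> G")
      case True
      then obtain i where i: "i < n" "e i \<in> G" by blast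
      then have "f u \<in> G \<longleftrightarrow> u i = 1" for u using * un by metis
      then show ?thesis unfolding M_def using cube_median_eq_1[OF uvw i(1)] by simp
    next
      case False
      then show ?thesis unfolding M_def * by blast
    qed
  qed
  show ?thesis
  proof (rule cube_embedsI)
    show "inj_on f (binary_cube n)"
    proof (rule inj_onI)
      fix u v assume uv: "u \<in> binary_cube n" "v \<in> binary_cube n" "f u = f v"
      have *: "f x \<in> H i \<longleftrightarrow> x i = 1" if "i < n" for x i
        using fE[OF H[OF that] a(2)[OF that] b(2)[OF that], of x] e(2)[OF that] that by auto
      have "u i = v i" if "i < n" for i
        using *[OF that, of u] *[OF that, of v] uv binary_cube_01 that by metis
      moreover have "u i = v i" if "\<not> i < n" for i
        using uv that by (simp add: binary_cube_def PiE_iff extensional_def)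
      ultimately show "u = v" by blast
    qed
    fix u v w assume uvw: "u \<in> binary_cube n" "v \<in> binary_cube n" "w \<in> binary_cube n"
    show "f (cube_median n u v w) = m (f u) (f v) (f w)"
    proof (rule halfspace_eqI)
      fix G assume G: "halfspace G"
      have Gc: "halfspace (K - G)" using halfspace_compl G by blast
      have "f (cube_median n u v w) \<in> G \<longleftrightarrow> M u v w G"
      proof (cases "a \<in> G"; cases "b \<in> G")
        assume "a \<in> G" "b \<in> G"
        then show ?thesis using f(3) G unfolding M_def by blast
      next
        assume "a \<notin> G" "b \<in> G"
        then show ?thesis using main uvw G by blast
      next
        assume "a \<in> G" "b \<notin> G"
        then have "f (cube_median n u v w) \<in> K - G \<longleftrightarrow> M u v w (K - G)"
          using main uvw Gc a(1) b(1) by blast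
        then show ?thesis using f(1) unfolding M_def by blast
      next
        assume "a \<notin> G" "b \<notin> G"
        then have "f u \<in> K - G" for u using f(3)[OF Gc] a(1) b(1) by blast
        then show ?thesis unfolding M_def by blast
      qed
      then show "f (cube_median n u v w) \<in> G \<longleftrightarrow> m (f u) (f v) (f w) \<in> G"
        unfolding M_def halfspace_med[OF G f(1) f(1) f(1)] .
    qed (use f(1) closed in auto)
  qed (use f(1) in auto)
qed

end

section \<open>Convex hulls and local convexity\<close>

context median_algebra
begin

text \<open>\<open>Suc r\<close> crossing halfspaces would embed a cube of dimension
  \<open>Suc r\<close>; by 1 \<le> r this number is at least 2, as the construction of the cube
  requires.\<close>

lemma crossing_card_le:
  assumes r: "\<And>n. cube_embeds K m n \<Longrightarrow> n \<le> r" "1 \<le> r"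
    and F: "\<And>H. H \<in> F \<Longrightarrow> halfspace H"
    and cr: "\<And>G H. \<lbrakk>G \<in> F; H \<in> F; G \<noteq> H\<rbrakk> \<Longrightarrow> crossing G H"
  shows "finite F \<and> card F \<le> r"
proof (rule ccontr)
  assume "\<not> ?thesis"
  then obtain F' where F': "F' \<subseteq> F" "card F' = Suc r" "finite F'"
    by (metis Suc_leI infinite_arbitrarily_large not_le obtain_subset_with_card_n)
  obtain h where h: "bij_betw h {0..<Suc r} F'"
    using ex_bij_betw_nat_finite[OF F'(3)] F'(2) by auto
  have hF: "h i \<in> F" if "i < Suc r" for i using h F'(1) that unfolding bij_betw_def by auto
  have "cube_embeds K m (Suc r)"
  proof (rule crossing_cube_embeds)
    show "halfspace (h i)" if "i < Suc r" for i using F hF that by blast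
    show "crossing (h i) (h j)" if "i < j" "j < Suc r" for i j
    proof (rule cr)
      show "h i \<noteq> h j" using that inj_onD[OF bij_betw_imp_inj_on[OF h], of i j] by auto
    qed (use that hF in auto)
  qed (use r(2) in simp)
  then show False using r(1) by fastforce
qed

text \<open>Zorn's lemma is applied to complements, so that unions of chains occur in place of
  intersections: a maximal halfspace that contains \<open>K - G\<close> and misses \<open>y\<close>
  has the required minimal complement.\<close>

lemma minimal_halfspace:
  assumes G: "halfspace G" "y \<in> G" "a \<in> K" "a \<notin> G"
  obtains M where "M \<subseteq> G" "halfspace M" "y \<in> M" "a \<notin> M"
    "\<And>H. \<lbrakk>halfspace H; y \<in> H; a \<notin> H; H \<subseteq> M\<rbrakk> \<Longrightarrow> H = M"
proof -
  define \<A> where "\<A> = {H. halfspace H \<and> K - G \<subseteq> H \<and> y \<notin> H}"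
  have "\<exists>M\<in>\<A>. \<forall>X\<in>\<A>. M \<subseteq> X \<longrightarrow> X = M"
  proof (rule subset_Zorn_nonempty)
    show "\<A> \<noteq> {}" using halfspace_compl G unfolding \<A>_def by blast
    fix \<C> assume ch: "\<C> \<noteq> {}" "subset.chain \<A> \<C>"
    then have sub: "\<C> \<subseteq> \<A>" and lin: "\<And>C D. \<lbrakk>C \<in> \<C>; D \<in> \<C>\<rbrakk> \<Longrightarrow> C \<subseteq> D \<or> D \<subseteq> C"
      by (simp_all add: subset_chain_def)
    have "convex_in (\<Union>\<C>)"
      by (rule convex_in_Union_chain[OF _ lin]) (use sub in \<open>auto simp: \<A>_def halfspace_def\<close>)
    moreover have "convex_in (K - \<Union>\<C>)"
      unfolding convex_in_def
    proof (intro conjI ballI)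
      fix u v w assume uvw: "u \<in> K - \<Union>\<C>" "v \<in> K - \<Union>\<C>" "w \<in> K"
      have "m u v w \<in> K - C" if "C \<in> \<C>" for C
      proof -
        have "convex_in (K - C)" using sub that unfolding \<A>_def halfspace_def by blast
        then show ?thesis using uvw that unfolding convex_in_def by blast
      qed
      then show "m u v w \<in> K - \<Union>\<C>" using ch(1) by blast
    qed blast
    moreover have "K - G \<subseteq> \<Union>\<C>" "y \<notin> \<Union>\<C>" using sub ch(1) unfolding \<A>_def by blast+
    ultimately show "\<Union>\<C> \<in> \<A>" unfolding \<A>_def halfspace_def by blast
  qed
  then obtain M where M: "M \<in> \<A>" "\<forall>X\<in>\<A>. M \<subseteq> X \<longrightarrow> X = M" by blast
  have yK: "y \<in> K" "M \<subseteq> K" "G \<subseteq> K" using G halfspace_sub M(1) unfolding \<A>_def by blast+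
  show ?thesis
  proof (rule that[of "K - M"])
    show "K - M \<subseteq> G" "halfspace (K - M)" "y \<in> K - M" "a \<notin> K - M"
      using M(1) yK G halfspace_compl unfolding \<A>_def by blast+
    fix H assume H: "halfspace H" "y \<in> H" "a \<notin> H" "H \<subseteq> K - M"
    have "K - H \<in> \<A>" using halfspace_compl[OF H(1)] H M(1) unfolding \<A>_def by blast
    moreover have "M \<subseteq> K - H" using H yK by blast
    ultimately have "K - H = M" using M(2) by blast
    then show "H = K - M" using halfspace_sub[OF H(1)] by blast
  qed
qed

definition join_step :: "'a set \<Rightarrow> 'a set"
  where "join_step A = {m u v z | u v z. u \<in> A \<and> v \<in> A \<and> z \<in> K}"

lemma join_step_mono: "A \<subseteq> B \<Longrightarrow> join_step A \<subseteq> join_step B"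
  unfolding join_step_def by blast

lemma join_step_iter:
  assumes "A \<subseteq> K"
  shows "(join_step ^^ n) A \<subseteq> K" "i \<le> n \<Longrightarrow> (join_step ^^ i) A \<subseteq> (join_step ^^ n) A"
proof -
  have step: "join_step B \<subseteq> K" if "B \<subseteq> K" for B
    using closed that unfolding join_step_def by blast
  have *: "(join_step ^^ n) A \<subseteq> K" for n
    by (induction n) (simp_all add: assms step)
  then show "(join_step ^^ n) A \<subseteq> K" .
  have "(join_step ^^ n) A \<subseteq> (join_step ^^ Suc n) A" for n
  proof
    fix u assume u: "u \<in> (join_step ^^ n) A"
    then have "u \<in> K" using * by blast
    then have "u \<in> K" "u = m u u u" using majority[of u u] by simp_all
    then have "u \<in> join_step ((join_step ^^ n) A)" using u unfolding join_step_def by blast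
    then show "u \<in> (join_step ^^ Suc n) A" by simp
  qed
  then show "i \<le> n \<Longrightarrow> (join_step ^^ i) A \<subseteq> (join_step ^^ n) A"
    by (rule lift_Suc_mono_le)
qed

text \<open>A minimal halfspace around \<open>y\<close> missing \<open>a\<close> is entered by one join towards \<open>y\<close>; there are at
  most \<open>r\<close> of them because they cross pairwise.\<close>

lemma hull_subset_join_iter:
  assumes r: "\<And>n. cube_embeds K m n \<Longrightarrow> n \<le> r" "1 \<le> r"
    and A: "A \<subseteq> K" and y: "y \<in> K"
    and meets: "\<And>H. \<lbrakk>halfspace H; y \<in> H\<rbrakk> \<Longrightarrow> \<exists>a\<in>A. a \<in> H"
  shows "y \<in> (join_step ^^ r) A"
proof -
  have "halfspace K" unfolding halfspace_def convex_in_def using closed by simp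
  then obtain a where a: "a \<in> A" "a \<in> K" using meets y by blast
  define F where "F = {M. halfspace M \<and> y \<in> M \<and> a \<notin> M \<and>
    (\<forall>H. halfspace H \<longrightarrow> y \<in> H \<longrightarrow> a \<notin> H \<longrightarrow> H \<subseteq> M \<longrightarrow> H = M)}"
  have F: "finite F \<and> card F \<le> r"
  proof (rule crossing_card_le[OF r])
    show "halfspace H" if "H \<in> F" for H using that unfolding F_def by blast
    show "crossing G H" if GH: "G \<in> F" "H \<in> F" "G \<noteq> H" for G H
    proof -
      have "\<not> G \<subseteq> H" "\<not> H \<subseteq> G" using GH unfolding F_def by blast+
      then show ?thesis using GH a unfolding crossing_def F_def by blast
    qed
  qed
  obtain c where c: "\<And>H. H \<in> F \<Longrightarrow> c H \<in> A \<and> c H \<in> H"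
    using meets unfolding F_def by (metis (mono_tags, lifting) mem_Collect_eq)
  \<comment> \<open>Absorbing one minimal halfspace M costs one join, with the point
    \<open>c M\<close> of A in M. For F' = F the point z lies in every halfspace around
    \<open>y\<close>, since each of these contains \<open>a\<close> or a member of F; hence z =
    \<open>y\<close>.\<close>
  have ex: "\<exists>z \<in> (join_step ^^ card F') A. \<forall>H. halfspace H \<longrightarrow> y \<in> H \<longrightarrow> a \<in> H \<or> (\<exists>M\<in>F'. M \<subseteq> H) \<longrightarrow> z \<in> H"
    if "finite F'" "F' \<subseteq> F" for F'
    using that
  proof (induction F' rule: finite_induct)
    case empty
    show ?case by (rule bexI[of _ a]) (use a in auto)
  next
    case (insert M F')
    then obtain z where z: "z \<in> (join_step ^^ card F') A"
      "\<And>H. \<lbrakk>halfspace H; y \<in> H; a \<in> H \<or> (\<exists>M\<in>F'. M \<subseteq> H)\<rbrakk> \<Longrightarrow> z \<in> H" by blast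
    have M: "M \<in> F" "c M \<in> A" "c M \<in> M" using c insert.prems by auto
    then have cM: "c M \<in> (join_step ^^ card F') A" "c M \<in> K"
      using join_step_iter(2)[OF A, of 0 "card F'"] A by auto
    have zK: "z \<in> K" using join_step_iter(1)[OF A] z(1) by blast
    have "m z (c M) y \<in> join_step ((join_step ^^ card F') A)"
      using z(1) cM y unfolding join_step_def by blast
    then have "m z (c M) y \<in> (join_step ^^ card (insert M F')) A" using insert.hyps by simp
    moreover have "m z (c M) y \<in> H" if H: "halfspace H" "y \<in> H" "a \<in> H \<or> (\<exists>M\<in>insert M F'. M \<subseteq> H)" for H
      using halfspace_med[OF H(1) zK cM(2) y] z(2)[OF H(1,2)] H M(3) by blast
    ultimately show ?case by blast
  qed
  from ex[OF conjunct1[OF F] subset_refl] obtain z where z: "z \<in> (join_step ^^ card F) A"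
    and zH: "\<forall>H. halfspace H \<longrightarrow> y \<in> H \<longrightarrow> a \<in> H \<or> (\<exists>M\<in>F. M \<subseteq> H) \<longrightarrow> z \<in> H" by (elim bexE)
  have zK: "z \<in> K" using join_step_iter(1)[OF A] z by blast
  have "z = y"
  proof (rule ccontr)
    assume "z \<noteq> y"
    then obtain H where H: "halfspace H" "y \<in> H" "z \<notin> H" using halfspace_separates y zK by metis
    then have "a \<notin> H" using zH by blast
    then obtain M where M: "M \<subseteq> H" "halfspace M" "y \<in> M" "a \<notin> M"
      "\<And>G. \<lbrakk>halfspace G; y \<in> G; a \<notin> G; G \<subseteq> M\<rbrakk> \<Longrightarrow> G = M"
      using minimal_halfspace[OF H(1,2) a(2)] by blast
    then have "M \<in> F" unfolding F_def by blast
    then show False using zH H M(1) by blast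
  qed
  then show ?thesis using z join_step_iter(2)[OF A] F by blast
qed

text \<open>Equivalently, the intersection of all halfspaces containing A: pass to complements. The
  form chosen is the hypothesis of \<open>hull_subset_join_iter\<close>.\<close>

definition hull_in :: "'a set \<Rightarrow> 'a set"
  where "hull_in A = {y \<in> K. \<forall>H. halfspace H \<longrightarrow> y \<in> H \<longrightarrow> (\<exists>a\<in>A. a \<in> H)}"

lemma convex_in_hull_in: "A \<subseteq> K \<Longrightarrow> convex_in (hull_in A)"
  unfolding convex_in_def
proof (intro conjI ballI)
  fix x y z assume A: "A \<subseteq> K" and xyz: "x \<in> hull_in A" "y \<in> hull_in A" "z \<in> K"
  then have K: "x \<in> K" "y \<in> K" by (auto simp: hull_in_def)
  have "\<exists>a\<in>A. a \<in> H" if H: "halfspace H" "m x y z \<in> H" for H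
    using halfspace_med[OF H(1) K xyz(3)] H xyz(1,2) unfolding hull_in_def by blast
  then show "m x y z \<in> hull_in A" using closed[OF K xyz(3)] by (simp add: hull_in_def)
qed (auto simp: hull_in_def)

end

text \<open>A median with two arguments equal to \<open>a\<close> is \<open>a\<close>, whatever the
  third. Since the third argument ranges over a compact space, two uses of the tube lemma give one
  neighbourhood that works for all of its values.\<close>

lemma (in compact_metrizable_median_algebra) join_step_nbhd:
  assumes W: "openin X W" "a \<in> W"
  obtains U where "openin X U" "a \<in> U" "join_step U \<subseteq> W"
proof -
  have a: "a \<in> topspace X" using W openin_subset by blast
  define Om where "Om = {p \<in> topspace (prod_topology X (prod_topology X X)). (\<lambda>(x, y, z). m x y z) p \<in> W}"
  have O: "openin (prod_topology X (prod_topology X X)) Om"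
    unfolding Om_def by (rule openin_continuous_map_preimage[OF continuous_median W(1)])
  have C: "compactin (prod_topology X X) ({a} \<times> topspace X)"
    using compact a by (simp add: compactin_Times compact_space_def)
  have "{a} \<times> ({a} \<times> topspace X) \<subseteq> Om"
    using a W(2) majority_left unfolding Om_def by auto
  then obtain U1 V where 1: "openin X U1" "openin (prod_topology X X) V" "a \<in> U1"
    "{a} \<times> topspace X \<subseteq> V" "U1 \<times> V \<subseteq> Om"
    using tube_lemma_right[OF O C a] by blast
  obtain U2 V2 where 2: "openin X U2" "openin X V2" "a \<in> U2" "topspace X \<subseteq> V2" "U2 \<times> V2 \<subseteq> V"
    using tube_lemma_right[OF 1(2) _ a 1(4)] compact unfolding compact_space_def by blast
  show ?thesis
  proof (rule that[of "U1 \<inter> U2"])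
    show "join_step (U1 \<inter> U2) \<subseteq> W"
    proof
      fix p assume "p \<in> join_step (U1 \<inter> U2)"
      then obtain u v z where p: "p = m u v z" "u \<in> U1" "v \<in> U2" "z \<in> topspace X" unfolding join_step_def by blast
      then have "(u, v, z) \<in> Om" using 1 2 by blast
      then show "p \<in> W" unfolding Om_def p(1) by simp
    qed
  qed (use 1 2 in auto)
qed

lemma (in compact_metrizable_median_algebra) join_step_iter_nbhd:
  assumes W: "openin X W" "a \<in> W"
  shows "\<exists>U. openin X U \<and> a \<in> U \<and> (join_step ^^ n) U \<subseteq> W"
proof (induction n)
  case 0
  then show ?case using W by auto
next
  case (Suc n)
  then obtain U where U: "openin X U" "a \<in> U" "(join_step ^^ n) U \<subseteq> W" by blast
  obtain V where V: "openin X V" "a \<in> V" "join_step V \<subseteq> U" using join_step_nbhd U by metis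
  have "(join_step ^^ n) A \<subseteq> (join_step ^^ n) B" if "A \<subseteq> B" for A B
    by (induction n) (use that join_step_mono in auto)
  then have "(join_step ^^ Suc n) V \<subseteq> W" using V(3) U(3) by (simp add: funpow_swap1) blast
  then show ?case using V by blast
qed

text \<open>The hull of a set is contained in its r-fold join, so small neighbourhoods of distinct
  points have disjoint hulls, and Kakutani separation applies to the hulls. That H contains U and
  misses V is the substitute for H being open or closed.\<close>

lemma (in compact_metrizable_median_algebra) halfspace_separates_nbhds:
  assumes r: "\<And>n. cube_embeds (topspace X) m n \<Longrightarrow> n \<le> r" "1 \<le> r"
    and ab: "a \<in> topspace X" "b \<in> topspace X" "a \<noteq> b"
  obtains U V H where "openin X U" "openin X V" "a \<in> U" "b \<in> V" "halfspace H" "U \<subseteq> H" "V \<subseteq> topspace X - H"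
proof -
  obtain P Q where PQ: "openin X P" "openin X Q" "a \<in> P" "b \<in> Q" "disjnt P Q"
    using metrizable_imp_Hausdorff_space[OF metrizable] ab unfolding Hausdorff_space_def by blast
  obtain U where U: "openin X U" "a \<in> U" "(join_step ^^ r) U \<subseteq> P" using join_step_iter_nbhd PQ by metis
  obtain V where V: "openin X V" "b \<in> V" "(join_step ^^ r) V \<subseteq> Q" using join_step_iter_nbhd PQ by metis
  have UV: "U \<subseteq> topspace X" "V \<subseteq> topspace X" using U V openin_subset by blast+
  have hull: "hull_in A \<subseteq> (join_step ^^ r) A" if A: "A \<subseteq> topspace X" for A
  proof
    fix y assume "y \<in> hull_in A"
    then have y: "y \<in> topspace X" "\<And>H. \<lbrakk>halfspace H; y \<in> H\<rbrakk> \<Longrightarrow> \<exists>a\<in>A. a \<in> H"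
      by (auto simp: hull_in_def)
    show "y \<in> (join_step ^^ r) A" by (rule hull_subset_join_iter[OF r A y])
  qed
  have "hull_in U \<subseteq> P" "hull_in V \<subseteq> Q"
    using order_trans[OF hull[OF UV(1)] U(3)] order_trans[OF hull[OF UV(2)] V(3)] by blast+
  then have "hull_in U \<inter> hull_in V = {}" using PQ(5) unfolding disjnt_def by blast
  then obtain H where H: "halfspace H" "hull_in U \<subseteq> H" "hull_in V \<subseteq> topspace X - H"
    using kakutani_separation[OF convex_in_hull_in[OF UV(1)] convex_in_hull_in[OF UV(2)]] by blast
  have "U \<subseteq> hull_in U" "V \<subseteq> hull_in V" using UV unfolding hull_in_def by blast+
  then have "U \<subseteq> H" "V \<subseteq> topspace X - H" using H(2,3) by blast+
  then show ?thesis by (rule that[OF U(1) V(1) U(2) V(2) H(1)])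
qed

text \<open>The pairs on which \<phi> differs by at least \<open>e\<close> form a compact set off
  the diagonal. It is covered by boxes U \<times> V whose factors lie on opposite sides of a
  halfspace, and the halfspaces of a finite subcover distinguish all these pairs.\<close>

lemma (in compact_metrizable_median_algebra) finite_halfspaces_approx:
  fixes \<phi> :: "'a \<Rightarrow> 'b::real_normed_vector"
  assumes r: "\<And>n. cube_embeds (topspace X) m n \<Longrightarrow> n \<le> r" "1 \<le> r"
    and \<phi>: "continuous_map X euclidean \<phi>" and e: "0 < e"
  obtains F where "finite F" "\<And>H. H \<in> F \<Longrightarrow> halfspace H"
    "\<And>y z. \<lbrakk>y \<in> topspace X; z \<in> topspace X; \<forall>H\<in>F. y \<in> H \<longleftrightarrow> z \<in> H\<rbrakk> \<Longrightarrow> norm (\<phi> y - \<phi> z) < e"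
proof -
  let ?P = "prod_topology X X"
  define D where "D = {p \<in> topspace ?P. norm (\<phi> (fst p) - \<phi> (snd p)) \<in> {e..}}"
  have "continuous_map ?P euclidean (\<phi> \<circ> fst)" "continuous_map ?P euclidean (\<phi> \<circ> snd)"
    using \<phi> continuous_map_compose continuous_map_fst continuous_map_snd by blast+
  then have "continuous_map ?P euclidean (\<lambda>p. norm (\<phi> (fst p) - \<phi> (snd p)))"
    by (intro continuous_map_norm continuous_map_diff) (simp_all add: o_def)
  then have "closedin ?P D" unfolding D_def
    by (rule closedin_continuous_map_preimage) simp
  then have D: "compactin ?P D"
    using compact by (intro closedin_compact_space) (simp_all add: compact_space_prod_topology)
  define \<U> where "\<U> = {U \<times> V | U V. openin X U \<and> openin X V \<and>
    (\<exists>H. halfspace H \<and> U \<subseteq> H \<and> V \<subseteq> topspace X - H)}"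
  have cover: "D \<subseteq> \<Union>\<U>"
  proof
    fix p assume p: "p \<in> D"
    obtain a b where ab: "p = (a, b)" by (cases p)
    have abX: "a \<in> topspace X" "b \<in> topspace X" "a \<noteq> b" using p e unfolding D_def ab by auto
    obtain U V H where "openin X U" "openin X V" "a \<in> U" "b \<in> V" "halfspace H" "U \<subseteq> H" "V \<subseteq> topspace X - H"
      by (rule halfspace_separates_nbhds[OF r abX])
    then show "p \<in> \<Union>\<U>" unfolding \<U>_def ab by blast
  qed
  have opens: "openin ?P W" if "W \<in> \<U>" for W using that openin_prod_Times_iff unfolding \<U>_def by blast
  have "\<exists>\<F>. finite \<F> \<and> \<F> \<subseteq> \<U> \<and> D \<subseteq> \<Union>\<F>"
    by (rule compactinD[OF D opens cover])
  then obtain \<V> where V: "finite \<V>" "\<V> \<subseteq> \<U>" "D \<subseteq> \<Union>\<V>"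
    by (elim exE conjE)
  have "\<exists>H. halfspace H \<and> W \<subseteq> H \<times> (topspace X - H)" if "W \<in> \<V>" for W
  proof -
    have "W \<in> \<U>" using V(2) that by (rule subsetD)
    then obtain U V H where "W = U \<times> V" "halfspace H" "U \<subseteq> H" "V \<subseteq> topspace X - H"
      unfolding \<U>_def by blast
    then show ?thesis by (metis Sigma_mono)
  qed
  then obtain h where h: "\<And>W. W \<in> \<V> \<Longrightarrow> halfspace (h W) \<and> W \<subseteq> h W \<times> (topspace X - h W)" by metis
  show ?thesis
  proof (rule that[of "h ` \<V>"])
    fix y z assume yz: "y \<in> topspace X" "z \<in> topspace X" "\<forall>H\<in>h ` \<V>. y \<in> H \<longleftrightarrow> z \<in> H"
    have "(y, z) \<notin> W" if "W \<in> \<V>" for W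
      using h[OF that] yz(3) that by blast
    then have "(y, z) \<notin> \<Union>\<V>" by blast
    then have "(y, z) \<notin> D" using V(3) by blast
    then show "norm (\<phi> y - \<phi> z) < e" using yz unfolding D_def by auto
  qed (use V h in auto)
qed

section \<open>Orbits and halfspaces\<close>

definition eventually_periodic :: "(nat \<Rightarrow> 'b) \<Rightarrow> bool"
  where "eventually_periodic f \<longleftrightarrow> (\<exists>q>0. \<exists>N. \<forall>n\<ge>N. f (n + q) = f n)"

text \<open>Within a residue class modulo \<open>k\<close> the truth value can change only once,
  from false to true; the sum of the thresholds serves all classes.\<close>

lemma eventually_periodic_step_imp:
  assumes k: "k > 0" and P: "\<And>n. P n \<Longrightarrow> P (n + k)"
  shows "eventually_periodic P"
proof -
  have "\<exists>N. \<forall>n\<ge>N. n mod k = i \<longrightarrow> P (n + k) = P n" for i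
  proof (cases "\<exists>n. n mod k = i \<and> P n")
    case True
    then obtain n0 where n0: "n0 mod k = i" "P n0" by blast
    have *: "P (n0 + j * k)" for j
      by (induction j) (use n0(2) P[of "n0 + _ * k"] in \<open>auto simp: algebra_simps\<close>)
    have "P (n + k) = P n" if n: "n0 \<le> n" "n mod k = i" for n
    proof -
      have "k dvd n - n0" using n n0(1) by (metis mod_eq_dvd_iff_nat)
      then obtain j where "n = n0 + j * k" using n(1) by (metis dvd_def le_add_diff_inverse mult.commute)
      then show ?thesis using * P by blast
    qed
    then show ?thesis by blast
  next
    case False
    then have "\<forall>n\<ge>0. n mod k = i \<longrightarrow> P (n + k) = P n" by (metis mod_add_self2)
    then show ?thesis by blast
  qed
  then obtain N where N: "\<And>i n. n \<ge> N i \<Longrightarrow> n mod k = i \<Longrightarrow> P (n + k) = P n" by metis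
  have "P (n + k) = P n" if "n \<ge> (\<Sum>i<k. N i)" for n
  proof (rule N[OF _ refl])
    have "N (n mod k) \<le> (\<Sum>i<k. N i)" using k by (intro member_le_sum) auto
    then show "N (n mod k) \<le> n" using that by simp
  qed
  then show ?thesis unfolding eventually_periodic_def using k by blast
qed

lemma eventually_periodic_finite:
  assumes "finite {n. P n}"
  shows "eventually_periodic P"
proof -
  obtain N where N: "\<And>n. P n \<Longrightarrow> n < N" using assms finite_nat_set_iff_bounded by auto
  have "P (n + 1) = P n" if "n \<ge> N" for n using that N[of n] N[of "n + 1"] by auto
  then show ?thesis unfolding eventually_periodic_def by (intro exI[of _ 1]) auto
qed

lemma eventually_periodic_Not: "eventually_periodic (\<lambda>n. \<not> P n) \<longleftrightarrow> eventually_periodic P"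
  unfolding eventually_periodic_def by simp

lemma periodic_mult:
  assumes "\<And>n. n \<ge> N \<Longrightarrow> f (n + q) = f n" "n \<ge> N"
  shows "f (n + j * q) = f (n::nat)"
proof (induction j)
  case (Suc j)
  have "f (n + Suc j * q) = f ((n + j * q) + q)" by (simp add: algebra_simps)
  also have "\<dots> = f (n + j * q)" using assms by simp
  finally show ?case using Suc by simp
qed simp

lemma eventually_periodic_finite_family:
  assumes "finite F" "\<And>i. i \<in> F \<Longrightarrow> eventually_periodic (f i)"
  obtains q N :: nat where "q > 0" "\<And>i n. \<lbrakk>i \<in> F; n \<ge> N\<rbrakk> \<Longrightarrow> f i (n + q) = f i n"
proof -
  have "\<exists>q>0. \<exists>N. \<forall>i\<in>F. \<forall>n\<ge>N. f i (n + q) = f i n"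
    using assms
  proof (induction F rule: finite_induct)
    case empty
    then show ?case by auto
  next
    case (insert i F)
    obtain q N where q: "q > 0" "\<And>j n. j \<in> F \<Longrightarrow> n \<ge> N \<Longrightarrow> f j (n + q) = f j n"
      using insert.IH insert.prems by (metis insertI2)
    obtain q' N' where q': "q' > 0" "\<And>n. n \<ge> N' \<Longrightarrow> f i (n + q') = f i n"
      using insert.prems unfolding eventually_periodic_def by blast
    have "f j (n + q * q') = f j n" if j: "j \<in> insert i F" and n: "n \<ge> max N N'" for j n
    proof (cases "j = i")
      case True
      then show ?thesis using periodic_mult[of N' "f i" q' n q] q'(2) n by auto
    next
      case False
      then show ?thesis using periodic_mult[of N "f j" q n q'] q(2)[of j] j n by (auto simp: mult.commute)
    qed
    then show ?case using q(1) q'(1) by (intro exI[of _ "q * q'"] conjI exI[of _ "max N N'"]) auto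
  qed
  then show ?thesis using that by blast
qed

section \<open>The itinerary of an orbit through a halfspace\<close>

context median_algebra
begin

lemma halfspace_orbit_eventually_periodic:
  assumes r: "\<And>n. cube_embeds K m n \<Longrightarrow> n \<le> r" "1 \<le> r"
    and T: "T ` K = K" "\<And>x y z. \<lbrakk>x \<in> K; y \<in> K; z \<in> K\<rbrakk> \<Longrightarrow> T (m x y z) = m (T x) (T y) (T z)"
    and H: "halfspace H" and x: "x \<in> K"
  shows "eventually_periodic (\<lambda>n. (T ^^ n) x \<in> H)"
proof -
  have TK: "(T ^^ n) ` K = K" for n
  proof (induction n)
    case (Suc n)
    have "(T ^^ Suc n) ` K = T ` (T ^^ n) ` K" by auto
    then show ?case using Suc T(1) by simp
  qed simp
  then have TnK: "(T ^^ n) y \<in> K" if "y \<in> K" for n y using that by blast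
  have Tm: "(T ^^ n) (m x y z) = m ((T ^^ n) x) ((T ^^ n) y) ((T ^^ n) z)" if "x \<in> K" "y \<in> K" "z \<in> K" for n x y z
    by (induction n) (use that T(2) TnK in auto)
  \<comment> \<open>Preimages turn a visit at time n into \<open>x \<in> P n\<close> with
    \<open>x\<close> fixed, and each of them is again a halfspace.\<close>
  define P where "P n = {z \<in> K. (T ^^ n) z \<in> H}" for n
  have conv: "convex_in {z \<in> K. (T ^^ n) z \<in> C}" if "convex_in C" for C n
    using that Tm TnK closed unfolding convex_in_def by auto
  have P: "halfspace (P n)" for n
  proof -
    have eq: "K - P n = {z \<in> K. (T ^^ n) z \<in> K - H}" using TnK unfolding P_def by blast
    show ?thesis
      unfolding halfspace_def eq unfolding P_def using conv H unfolding halfspace_def by blast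
  qed
  have PK: "P n \<subseteq> K" for n unfolding P_def by blast
  have shift: "z \<in> P (n + k) \<longleftrightarrow> (T ^^ n) z \<in> P k" if "z \<in> K" for z n k
    using that TnK unfolding P_def by (simp add: add.commute[of n] funpow_add)
  \<comment> \<open>Inclusions can be shifted both ways; cancelling the shift uses that each power
    of T maps K onto itself.\<close>
  have sub: "P n \<subseteq> P k \<longleftrightarrow> P (n + j) \<subseteq> P (k + j)" for n k j
  proof
    assume "P n \<subseteq> P k"
    then show "P (n + j) \<subseteq> P (k + j)"
      using shift[of _ j n] shift[of _ j k] PK[of "n + j"] by (auto simp: add.commute)
  next
    assume *: "P (n + j) \<subseteq> P (k + j)"
    show "P n \<subseteq> P k"
    proof
      fix z assume z: "z \<in> P n"
      then obtain y where y: "y \<in> K" "z = (T ^^ j) y" using TK[of j] PK by blast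
      then have "y \<in> P (n + j)" using z shift[of y j n] by (simp add: add.commute)
      then show "z \<in> P k" using * shift[of y j k] y by (auto simp: add.commute)
    qed
  qed
  have orbit: "(T ^^ n) x \<in> H \<longleftrightarrow> x \<in> P n" for n using x unfolding P_def by blast
  show ?thesis
  proof (cases "\<exists>k>0. P 0 \<subseteq> P k \<or> P k \<subseteq> P 0")
    case True
    then obtain k where k: "k > 0" "P 0 \<subseteq> P k \<or> P k \<subseteq> P 0" by blast
    then consider "P 0 \<subseteq> P k" | "P k \<subseteq> P 0" by blast
    then show ?thesis
    proof cases
      case 1
      then have "P n \<subseteq> P (n + k)" for n using sub[of 0 k n] by (simp add: add.commute)
      then show ?thesis unfolding orbit by (intro eventually_periodic_step_imp[OF k(1)]) blast
    next
      case 2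
      then have "P (n + k) \<subseteq> P n" for n using sub[of k 0 n] by (simp add: add.commute)
      then have "eventually_periodic (\<lambda>n. \<not> x \<in> P n)"
        by (intro eventually_periodic_step_imp[OF k(1)]) blast
      then show ?thesis unfolding orbit eventually_periodic_Not .
    qed
  next
    case False
    then have nn: "\<not> P i \<subseteq> P j" if "i \<noteq> j" for i j
    proof (cases "i < j")
      case True
      then have "\<not> P 0 \<subseteq> P (j - i)" using False zero_less_diff by blast
      then show ?thesis using sub[of 0 "j - i" i] True by simp
    next
      case ge: False
      then have "0 < i - j" using that by simp
      then have "\<not> P (i - j) \<subseteq> P 0" using False by blast
      then show ?thesis using sub[of "i - j" 0 j] ge by simp
    qed
    \<comment> \<open>No set crosses itself, so \<open>cr\<close> also makes Q injective on these
      indices, and a bound on the number of sets bounds the number of times.\<close>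
    have fin: "finite {n. x \<in> Q n}"
      if Q: "\<And>n. halfspace (Q n)" and cr: "\<And>i j. \<lbrakk>i \<noteq> j; x \<in> Q i; x \<in> Q j\<rbrakk> \<Longrightarrow> crossing (Q i) (Q j)"
      for Q :: "nat \<Rightarrow> 'a set"
    proof -
      have "finite (Q ` {n. x \<in> Q n}) \<and> card (Q ` {n. x \<in> Q n}) \<le> r"
      proof (rule crossing_card_le[OF r])
        show "crossing G H" if GH: "G \<in> Q ` {n. x \<in> Q n}" "H \<in> Q ` {n. x \<in> Q n}" "G \<noteq> H" for G H
        proof -
          obtain i j where "G = Q i" "H = Q j" "x \<in> Q i" "x \<in> Q j" using GH(1,2) by blast
          then show ?thesis using GH(3) cr[of i j] by blast
        qed
        show "halfspace G" if "G \<in> Q ` {n. x \<in> Q n}" for G using Q that by blast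
      qed
      moreover have "inj_on Q {n. x \<in> Q n}"
        using cr unfolding inj_on_def crossing_def by blast
      ultimately show ?thesis by (simp add: finite_image_iff)
    qed
    \<comment> \<open>A disjoint and a covering pair of translates together would give a nested pair.\<close>
    have excl: False if dis: "P i \<inter> P j = {}" "i < j" and cov: "P k \<union> P l = K" "k < l" for i j k l
    proof -
      have dis': "P (i + s) \<inter> P (j + s) = {}" for s
        using dis(1) shift[of _ s i] shift[of _ s j] PK[of "i + s"] by (auto simp: add.commute)
      have cov': "P (k + s) \<union> P (l + s) = K" for s
      proof -
        have "z \<in> P (s + k) \<union> P (s + l)" if "z \<in> K" for z
          using cov(1) TnK[OF that, of s] shift[OF that, of s k] shift[OF that, of s l] by blast
        then show ?thesis using PK[of "k + s"] PK[of "l + s"] by (auto simp: add.commute)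
      qed
      \<comment> \<open>Shifted by k and by i, the two pairs share the translate
        \<open>P (i + k)\<close>, which forces this inclusion. As translates with distinct indices
        are never nested, the gaps \<open>j - i\<close> and \<open>l - k\<close> agree.\<close>
      have "P (j + k) \<subseteq> P (l + i)"
        using dis'[of k] cov'[of i] PK[of "j + k"] by (auto simp: add.commute)
      then have eq: "l + i = j + k" using nn by metis
      have "P (i + k) \<inter> P (j + k) = {}" "P (i + k) \<union> P (j + k) = K"
        using dis'[of k] cov'[of i] eq by (simp_all add: add.commute)
      \<comment> \<open>Now \<open>P (i + k)\<close> and \<open>P (j + k)\<close> are complementary.
        The same disjointness one gap later places \<open>P (j + (k + (j - i)))\<close> outside
        \<open>P (j + k)\<close>, hence inside \<open>P (i + k)\<close>.\<close>
      moreover have "P (i + (k + (j - i))) \<inter> P (j + (k + (j - i))) = {}" by (rule dis')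
      ultimately have "P (j + (k + (j - i))) \<subseteq> P (i + k)"
        using dis(2) PK[of "j + (k + (j - i))"] by (auto simp: add.commute add.left_commute)
      moreover have "j + (k + (j - i)) \<noteq> i + k" using dis(2) by linarith
      ultimately show False using nn by blast
    qed
    show ?thesis
    proof (cases "\<exists>k l. k < l \<and> P k \<union> P l = K")
      case False
      have "finite {n. x \<in> P n}"
      proof (rule fin[OF P])
        fix i j assume ij: "i \<noteq> j" "x \<in> P i" "x \<in> P j"
        have "P i \<union> P j \<noteq> K" using False ij(1) by (metis Un_commute nat_neq_iff)
        then show "crossing (P i) (P j)"
          using nn[OF ij(1)] nn[OF ij(1)[symmetric]] ij PK[of i] PK[of j] unfolding crossing_def by blast
      qed
      then show ?thesis unfolding orbit by (rule eventually_periodic_finite)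
    next
      case True
      have dis: "P i \<inter> P j \<noteq> {}" if "i \<noteq> j" for i j
        using excl True that by (metis Int_commute nat_neq_iff)
      have "finite {n. x \<in> K - P n}"
      proof (rule fin)
        show "halfspace (K - P n)" for n using P halfspace_compl by blast
        fix i j assume ij: "i \<noteq> j" "x \<in> K - P i" "x \<in> K - P j"
        then show "crossing (K - P i) (K - P j)"
          using nn[OF ij(1)] nn[OF ij(1)[symmetric]] dis[OF ij(1)] PK[of i] PK[of j] unfolding crossing_def by blast
      qed
      then have "finite {n. \<not> x \<in> P n}" using x by simp
      then have "eventually_periodic (\<lambda>n. \<not> x \<in> P n)" by (rule eventually_periodic_finite)
      then show ?thesis unfolding orbit eventually_periodic_Not .
    qed
  qed
qed

end

lemma (in compact_metrizable_median_algebra) orbit_approx_periodic: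
  fixes \<phi> :: "'a \<Rightarrow> 'b::real_normed_vector"
  assumes rank: "median_rank (topspace X) m < \<infinity>"
    and T: "homeomorphic_median_automorphism X m T"
    and \<phi>: "continuous_map X euclidean \<phi>" and x: "x \<in> topspace X" and e: "0 < e"
  obtains q N :: nat and \<psi> :: "nat \<Rightarrow> 'b"
  where "q > 0" "\<And>n. \<psi> (n + q) = \<psi> n" "\<And>n. n \<ge> N \<Longrightarrow> norm (\<phi> ((T ^^ n) x) - \<psi> n) < e"
proof -
  obtain r0 where r0: "median_rank (topspace X) m = enat r0" using rank by auto
  define r where "r = max r0 1"
  have r: "n \<le> r" if "cube_embeds (topspace X) m n" for n
  proof -
    have "enat n \<le> median_rank (topspace X) m" unfolding median_rank_def
      by (rule SUP_upper) (use that in simp)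
    then show ?thesis using r0 by (simp add: r_def)
  qed
  have r1: "1 \<le> r" by (simp add: r_def)
  have TK: "T ` topspace X = topspace X"
    using T homeomorphic_imp_surjective_map unfolding homeomorphic_median_automorphism_def by blast
  have Tm: "T (m x y z) = m (T x) (T y) (T z)" if "x \<in> topspace X" "y \<in> topspace X" "z \<in> topspace X" for x y z
    using T that unfolding homeomorphic_median_automorphism_def by blast
  have TnK: "(T ^^ n) x \<in> topspace X" for n
    by (induction n) (use x TK in auto)
  obtain F where F: "finite F" "\<And>H. H \<in> F \<Longrightarrow> halfspace H"
    "\<And>y z. \<lbrakk>y \<in> topspace X; z \<in> topspace X; \<forall>H\<in>F. y \<in> H \<longleftrightarrow> z \<in> H\<rbrakk> \<Longrightarrow> norm (\<phi> y - \<phi> z) < e"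
    using finite_halfspaces_approx[OF r r1 \<phi> e] by blast
  obtain q N where q: "q > 0" "\<And>H n. \<lbrakk>H \<in> F; n \<ge> N\<rbrakk> \<Longrightarrow> ((T ^^ (n + q)) x \<in> H) = ((T ^^ n) x \<in> H)"
    using eventually_periodic_finite_family[OF F(1), of "\<lambda>H n. (T ^^ n) x \<in> H"]
      halfspace_orbit_eventually_periodic[OF r r1 TK Tm F(2) x] by metis
  \<comment> \<open>The representative of n modulo q in the block of length q starting at
    \<open>N * q\<close>, which lies past the preperiod N because q is positive.\<close>
  define g where "g n = (n mod q) + N * q" for n
  have gN: "g n \<ge> N" for n using q(1) unfolding g_def by (simp add: trans_le_add2)
  show ?thesis
  proof (rule that[of q "\<lambda>n. \<phi> ((T ^^ g n) x)" "N * q"])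
    fix n assume n: "n \<ge> N * q"
    have "n = g n + (n div q - N) * q"
    proof -
      have "N \<le> n div q" using n q(1) by (simp add: less_eq_div_iff_mult_less_eq)
      then show ?thesis unfolding g_def
        by (metis add.commute add.left_commute add_mult_distrib le_add_diff_inverse mod_mult_div_eq mult.commute)
    qed
    then have "(T ^^ n) x \<in> H \<longleftrightarrow> (T ^^ g n) x \<in> H" if "H \<in> F" for H
      using periodic_mult[of N "\<lambda>n. (T ^^ n) x \<in> H" q "g n" "n div q - N"] q(2)[OF that] gN by metis
    then show "norm (\<phi> ((T ^^ n) x) - \<phi> ((T ^^ g n) x)) < e" using F(3) TnK by blast
  qed (use q in \<open>auto simp: g_def\<close>)
qed

section \<open>Dirichlet series\<close>

text \<open>Since \<open>0 powr s = 0\<close>, the index 0 contributes nothing, whatever the value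
  \<open>f 0\<close> is.\<close>

definition dirichlet_sums :: "(nat \<Rightarrow> complex) \<Rightarrow> complex \<Rightarrow> complex \<Rightarrow> bool"
  where "dirichlet_sums f s A \<longleftrightarrow> summable (\<lambda>n. norm (f n * of_nat n powr (-s))) \<and>
    (\<lambda>n. f n * of_nat n powr (-s)) sums A"

definition dirichlet_conv :: "(nat \<Rightarrow> complex) \<Rightarrow> (nat \<Rightarrow> complex) \<Rightarrow> nat \<Rightarrow> complex"
  where "dirichlet_conv f g n = (\<Sum>d | d dvd n. f d * g (n div d))"

section \<open>Absolute convergence and convolution\<close>

lemma norm_nat_powr: "norm (of_nat n powr s :: complex) = real n powr Re s"
  by (cases "n = 0") (simp_all add: norm_powr_real_powr)

lemma nat_powr_mult: "of_nat (a * b) powr s = of_nat a powr s * (of_nat b powr s :: complex)"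
  by (simp add: powr_times_real)

lemma dirichlet_sums_bounded:
  assumes "\<And>n. norm (f n) \<le> C" "Re s > 1"
  obtains A where "dirichlet_sums f s A"
proof -
  have s1: "summable (\<lambda>n. C * real n powr (- Re s))"
    using assms(2) by (intro summable_mult) (simp add: summable_real_powr_iff)
  have b: "norm (norm (f n * of_nat n powr (-s))) \<le> C * real n powr (- Re s)" for n
    using mult_right_mono[OF assms(1)[of n], of "real n powr (- Re s)"]
    by (simp add: norm_mult norm_nat_powr)
  have sm: "summable (\<lambda>n. norm (f n * of_nat n powr (-s)))"
    by (rule summable_comparison_test'[OF s1, of 0]) (rule b)
  then have "(\<lambda>n. f n * of_nat n powr (-s)) sums (\<Sum>n. f n * of_nat n powr (-s))"
    by (rule summable_sums[OF summable_norm_cancel])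
  then show ?thesis using sm by (intro that) (simp add: dirichlet_sums_def)
qed

text \<open>Absolute summability over all pairs (a, b) allows the double sum to be regrouped along
  the value n = a b.\<close>

lemma dirichlet_sums_conv:
  assumes "dirichlet_sums f s A" "dirichlet_sums g s B"
  shows "dirichlet_sums (dirichlet_conv f g) s (A * B)"
proof -
  define F where "F n = f n * of_nat n powr (-s)" for n
  define G where "G n = g n * of_nat n powr (-s)" for n
  have FG0: "F 0 = 0" "G 0 = 0" by (simp_all add: F_def G_def)
  have sF: "summable (\<lambda>n. norm (F n))" "(F has_sum A) UNIV"
    using assms(1) norm_summable_imp_has_sum[of F A] unfolding dirichlet_sums_def F_def by auto
  have sG: "summable (\<lambda>n. norm (G n))" "(G has_sum B) UNIV"
    using assms(2) norm_summable_imp_has_sum[of G B] unfolding dirichlet_sums_def G_def by auto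
  have aF: "(\<lambda>n. norm (F n)) summable_on UNIV" and aG: "(\<lambda>n. norm (G n)) summable_on UNIV"
    using norm_summable_imp_summable_on[of "\<lambda>n. norm (F n)"] norm_summable_imp_summable_on[of "\<lambda>n. norm (G n)"]
      sF sG by simp_all
  define P where "P = (\<lambda>(a, b). F a * G b)"
  have aP: "(\<lambda>x. norm (P x)) summable_on UNIV \<times> UNIV"
    unfolding Infinite_Sum.abs_summable_on_Sigma_iff P_def
  proof (intro conjI ballI)
    show "(\<lambda>y. norm (case (x, y) of (a, b) \<Rightarrow> F a * G b)) summable_on UNIV" for x
      using summable_on_cmult_right[OF aG, of "norm (F x)"] by (simp add: norm_mult)
    have "(\<Sum>\<^sub>\<infinity>y. norm (case (x, y) of (a, b) \<Rightarrow> F a * G b)) = norm (F x) * (\<Sum>\<^sub>\<infinity>y. norm (G y))" for x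
      using infsum_cmult_right[of "norm (F x)" "\<lambda>y. norm (G y)" UNIV] aG by (simp add: norm_mult)
    then show "(\<lambda>x. norm (\<Sum>\<^sub>\<infinity>y. norm (case (x, y) of (a, b) \<Rightarrow> F a * G b))) summable_on UNIV"
      using summable_on_cmult_left[OF aF, of "(\<Sum>\<^sub>\<infinity>y. norm (G y))"]
      by (simp add: abs_mult infsum_nonneg)
  qed
  have hP: "(P has_sum (A * B)) (UNIV \<times> UNIV)"
  proof (rule has_sum_SigmaI)
    show "((\<lambda>y. P (x, y)) has_sum (F x * B)) UNIV" for x
      unfolding P_def using has_sum_cmult_right[OF sG(2), of "F x"] by simp
    show "((\<lambda>x. F x * B) has_sum A * B) UNIV" using has_sum_cmult_left[OF sF(2), of B] by simp
    show "P summable_on UNIV \<times> UNIV" using aP by (rule Infinite_Sum.abs_summable_summable)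
  qed
  define Q where "Q = (\<lambda>(n, d). F d * G (n div d))"
  let ?D = "Sigma {0<..} (\<lambda>n. {d. d dvd n})"
  \<comment> \<open>The parameter h lets one reindexing serve both the terms and their absolute
    values.\<close>
  have PQ: "(h P has_sum S) (UNIV \<times> UNIV) \<longleftrightarrow> (h Q has_sum S) ?D"
    if h: "h = (\<lambda>f. f) \<or> h = (\<lambda>f x. of_real (norm (f x)))" for h :: "(nat \<times> nat \<Rightarrow> complex) \<Rightarrow> nat \<times> nat \<Rightarrow> complex" and S
  proof -
    have "(h P has_sum S) (UNIV \<times> UNIV) \<longleftrightarrow> (h P has_sum S) ({0<..} \<times> {0<..})"
    proof (rule has_sum_cong_neutral)
      fix x :: "nat \<times> nat" assume "x \<in> UNIV \<times> UNIV - {0<..} \<times> {0<..}"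
      then have "\<not> (0 < fst x \<and> 0 < snd x)" by (simp add: mem_Times_iff)
      then have "fst x = 0 \<or> snd x = 0" by linarith
      then show "h P x = 0" using h FG0 by (auto simp: P_def split: prod.splits)
    qed auto
    also have "\<dots> \<longleftrightarrow> (h Q has_sum S) ?D"
      by (rule has_sum_reindex_bij_witness[of _ "\<lambda>(n, d). (d, n div d)" "\<lambda>(a, b). (a * b, a)"])
        (use h in \<open>auto simp: P_def Q_def elim!: dvdE\<close>)
    finally show ?thesis .
  qed
  have hQ: "(Q has_sum (A * B)) ?D" using PQ[of "\<lambda>f. f"] hP by simp
  have aQ: "(\<lambda>x. norm (Q x)) summable_on ?D"
  proof -
    obtain S where "((\<lambda>x. norm (P x)) has_sum S) (UNIV \<times> UNIV)" using aP unfolding summable_on_def by blast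
    then have "((\<lambda>x. complex_of_real (norm (P x))) has_sum of_real S) (UNIV \<times> UNIV)"
      by (simp add: has_sum_of_real_iff)
    then have "((\<lambda>x. complex_of_real (norm (Q x))) has_sum of_real S) ?D"
      using PQ[of "\<lambda>f x. of_real (norm (f x))"] by simp
    then show ?thesis unfolding summable_on_def by (auto simp: has_sum_of_real_iff)
  qed
  define C where "C n = dirichlet_conv f g n * of_nat n powr (-s)" for n
  have C: "C n = (\<Sum>d | d dvd n. Q (n, d))" if "n > 0" for n
  proof -
    have "f d * g (n div d) * of_nat n powr (-s) = Q (n, d)" if dn: "d dvd n" for d
    proof -
      obtain e where "n = d * e" using dn by blast
      then show ?thesis using \<open>n > 0\<close> unfolding Q_def F_def G_def by (simp add: nat_powr_mult powr_times_real)
    qed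
    then show ?thesis unfolding C_def dirichlet_conv_def sum_distrib_right by (intro sum.cong) auto
  qed
  have fin: "finite {d. d dvd n}" if "n > 0" for n :: nat using that by simp
  have inner: "((\<lambda>d. Q (n, d)) has_sum C n) {d. d dvd n}" if "n \<in> {0<..}" for n
    unfolding C[OF that[unfolded greaterThan_iff]]
    by (rule has_sum_finite) (use that fin in auto)
  have "(C has_sum (A * B)) {0<..}" using has_sum_SigmaD[OF hQ inner] by simp
  moreover have "(C has_sum (A * B)) {0<..} \<longleftrightarrow> (C has_sum (A * B)) UNIV"
    by (rule has_sum_cong_neutral) (auto simp: C_def)
  ultimately have 1: "C sums (A * B)" using has_sum_imp_sums by blast
  have "(\<lambda>n. norm (infsum (\<lambda>d. norm (Q (n, d))) {d. d dvd n})) summable_on {0<..}"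
    using aQ unfolding Infinite_Sum.abs_summable_on_Sigma_iff by blast
  then have s2: "(\<lambda>n. infsum (\<lambda>d. norm (Q (n, d))) {d. d dvd n}) summable_on {0<..}"
    by (rule Infinite_Sum.abs_summable_summable)
  have "(\<lambda>n. norm (C n)) summable_on {0<..}"
  proof (rule Infinite_Sum.abs_summable_on_comparison_test'[OF s2])
    fix n :: nat assume n: "n \<in> {0<..}"
    then show "norm (C n) \<le> infsum (\<lambda>d. norm (Q (n, d))) {d. d dvd n}"
      using C[of n] fin[of n] norm_sum[of "\<lambda>d. Q (n, d)" "{d. d dvd n}"] by simp
  qed
  moreover have "(\<lambda>n. norm (C n)) summable_on {0<..} \<longleftrightarrow> (\<lambda>n. norm (C n)) summable_on UNIV"
    by (rule summable_on_cong_neutral) (auto simp: C_def)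
  ultimately have "summable (\<lambda>n. norm (C n))" using summable_on_UNIV_nonneg_real_iff[of "\<lambda>n. norm (C n)"] by simp
  then show ?thesis using 1 unfolding dirichlet_sums_def C_def by blast
qed

section \<open>Continuation to the right half plane\<close>

lemma has_field_derivative_of_real_powr:
  assumes "0 < x"
  shows "((\<lambda>w. w powr s) has_field_derivative (s * of_real x powr (s - 1))) (at (of_real x :: complex) within S)"
proof -
  have "(of_real x :: complex) \<notin> \<real>\<^sub>\<le>\<^sub>0" using assms by (simp add: complex_nonpos_Reals_iff)
  then show ?thesis by (rule has_field_derivative_at_within[OF has_field_derivative_powr])
qed

lemma of_real_segment_bound:
  assumes f: "\<And>x. a \<le> x \<Longrightarrow> x \<le> b \<Longrightarrow> (f has_field_derivative f' x) (at (of_real x :: complex) within of_real ` {a..b})"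
    and B: "\<And>x. a \<le> x \<Longrightarrow> x \<le> b \<Longrightarrow> norm (f' x) \<le> B" and ab: "a \<le> b"
  shows "norm (f (of_real b) - f (of_real a)) \<le> B * (b - a)"
proof -
  have "norm (f (of_real b) - f (of_real a)) \<le> B * norm (of_real b - of_real a :: complex)"
  proof (rule field_differentiable_bound)
    show "convex (of_real ` {a..b} :: complex set)"
      by (intro convex_linear_image bounded_linear.linear[OF bounded_linear_of_real]) simp
    show "(f has_field_derivative f' (Re z)) (at z within of_real ` {a..b})" if "z \<in> of_real ` {a..b}" for z
      using that f by auto
    show "norm (f' (Re z)) \<le> B" if "z \<in> of_real ` {a..b}" for z using that B by auto
  qed (use ab in auto)
  also have "norm (of_real b - of_real a :: complex) = b - a"
    using ab by (simp flip: of_real_diff)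
  finally show ?thesis .
qed

lemma nat_powr_diff_bound:
  assumes a: "0 < a" "a \<le> b" "b \<le> a + 1" and s: "Re s > 0"
  shows "norm (of_real b powr (-s) - of_real a powr (-s) :: complex) \<le> norm s * a powr (- Re s - 1)"
proof -
  have "norm (of_real b powr (-s) - of_real a powr (-s) :: complex) \<le> (norm s * a powr (- Re s - 1)) * (b - a)"
  proof (rule of_real_segment_bound[where f' = "\<lambda>x. (-s) * of_real x powr (-s - 1)"])
    show "norm (- s * of_real x powr (- s - 1)) \<le> norm s * a powr (- Re s - 1)" if "a \<le> x" "x \<le> b" for x
      using that a s by (auto simp: norm_mult norm_powr_real_powr intro!: mult_left_mono powr_mono2')
  qed (use a in \<open>auto intro!: has_field_derivative_of_real_powr[of _ "-s", simplified]\<close>)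
  also have "\<dots> \<le> (norm s * a powr (- Re s - 1)) * 1" using a by (intro mult_left_mono) auto
  finally show ?thesis by simp
qed

abbreviation right_half_plane :: "complex set" where "right_half_plane \<equiv> {s. Re s > 0}"

text \<open>The bound has the size of a difference of consecutive values of
  \<open>n powr (-s)\<close>: differencing gains one power of n, enough for locally uniform
  convergence on Re s > 0.\<close>

lemma holomorphic_series:
  fixes u :: "nat \<Rightarrow> complex \<Rightarrow> complex"
  assumes hol: "\<And>n. u n holomorphic_on right_half_plane"
    and C: "continuous_on UNIV C"
    and bd: "\<And>n s. Re s > 0 \<Longrightarrow> norm (u n s) \<le> C s * real (Suc n) powr (- Re s - 1)"
  shows "(\<lambda>s. \<Sum>n. u n s) holomorphic_on right_half_plane"
    and "\<And>s. Re s > 0 \<Longrightarrow> summable (\<lambda>n. u n s)"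
proof -
  have sm: "summable (\<lambda>n. B * real (Suc n) powr (- x - 1))" if "x > 0" for B x
  proof -
    have "summable (\<lambda>n. real n powr (- x - 1))" using that by (simp add: summable_real_powr_iff)
    then show ?thesis
      using summable_Suc_iff[of "\<lambda>n. real n powr (- x - 1)"] by (intro summable_mult) blast
  qed
  show "summable (\<lambda>n. u n s)" if "Re s > 0" for s
    by (rule summable_comparison_test'[OF sm[OF that]]) (use bd that in auto)
  show "(\<lambda>s. \<Sum>n. u n s) holomorphic_on right_half_plane"
  proof (rule holomorphic_uniform_sequence)
    show "open right_half_plane" by (rule open_halfspace_Re_gt)
    show "(\<lambda>s. \<Sum>i<n. u i s) holomorphic_on right_half_plane" for n
      using hol by (intro holomorphic_on_sum)
    fix x assume x: "x \<in> right_half_plane"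
    define d where "d = Re x / 2"
    have d: "d > 0" using x by (simp add: d_def)
    have Re: "Re s \<ge> d" if "s \<in> cball x d" for s
      using that complex_Re_le_cmod[of "x - s"] unfolding d_def by (simp add: dist_norm)
    have "compact (C ` cball x d)" using C by (intro compact_continuous_image) (auto intro: continuous_on_subset)
    then obtain B where B: "\<And>s. s \<in> cball x d \<Longrightarrow> norm (C s) \<le> B"
      using compact_imp_bounded bounded_iff by (metis imageI)
    have "uniform_limit (cball x d) (\<lambda>n s. \<Sum>i<n. u i s) (\<lambda>s. \<Sum>i. u i s) sequentially"
    proof (rule Weierstrass_m_test[OF _ sm[OF d]])
      fix n s assume s: "s \<in> cball x d"
      have "norm (u n s) \<le> C s * real (Suc n) powr (- Re s - 1)" using bd Re[OF s] d by simp
      also have "\<dots> \<le> B * real (Suc n) powr (- d - 1)"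
        using B[OF s] Re[OF s] by (intro mult_mono powr_mono) auto
      finally show "norm (u n s) \<le> B * real (Suc n) powr (- d - 1)" .
    qed
    moreover have "cball x d \<subseteq> right_half_plane" using Re d by force
    ultimately show "\<exists>d>0. cball x d \<subseteq> right_half_plane \<and>
        uniform_limit (cball x d) (\<lambda>n s. \<Sum>i<n. u i s) (\<lambda>s. \<Sum>i. u i s) sequentially"
      using d by blast
  qed
qed

lemma dirichlet_sums_iff_Suc:
  "dirichlet_sums f s A \<longleftrightarrow> summable (\<lambda>n. norm (f n * of_nat n powr (-s))) \<and>
    (\<lambda>n. f (Suc n) * of_nat (Suc n) powr (-s)) sums A"
  unfolding dirichlet_sums_def using sums_Suc_iff[of "\<lambda>n. f n * of_nat n powr (-s)" A] by simp

lemma tendsto_nat_powr_neg: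
  assumes "Re s < 0"
  shows "(\<lambda>n. of_nat (Suc n) powr s :: complex) \<longlonglongrightarrow> 0"
proof (rule tendsto_norm_zero_cancel)
  have "(\<lambda>n. real n powr Re s) \<longlonglongrightarrow> 0"
    using assms by (intro tendsto_neg_powr filterlim_real_sequentially)
  then show "(\<lambda>n. norm (of_nat (Suc n) powr s :: complex)) \<longlonglongrightarrow> 0"
    unfolding norm_nat_powr by (rule LIMSEQ_Suc)
qed

text \<open>\<open>u n s\<close> is s - 1 times the difference between
  \<open>of_nat (Suc n) powr (-s)\<close> and the integral of the same power over the next unit
  interval. The powers with exponent 1 - s telescope, so A is s - 1 times the zeta function; since
  \<open>A 1 = 1\<close>, dividing A - 1 by s - 1 leaves the regular part.\<close>

lemma zeta_continuation:
  obtains Z where "Z holomorphic_on right_half_plane"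
    "\<And>s. Re s > 1 \<Longrightarrow> dirichlet_sums (\<lambda>_. 1) s (1 / (s - 1) + Z s)"
proof -
  define u where "u n s = (s - 1) * of_nat (Suc n) powr (-s) - of_nat (Suc n) powr (1 - s)
    + of_nat (Suc (Suc n)) powr (1 - s)" for n and s :: complex
  have hol: "u n holomorphic_on right_half_plane" for n
    unfolding u_def by (intro holomorphic_intros)
  have bd: "norm (u n s) \<le> (norm s * norm (s - 1)) * real (Suc n) powr (- Re s - 1)" if s: "Re s > 0" for n s
  proof -
    define a where "a = real (Suc n)"
    have a: "a > 0" by (simp add: a_def)
    define f where "f w = (s - 1) * of_real a powr (-s) * w + w powr (1 - s)" for w
    have "norm (f (of_real (a + 1)) - f (of_real a)) \<le> (norm s * norm (s - 1) * a powr (- Re s - 1)) * (a + 1 - a)"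
    proof (rule of_real_segment_bound)
      fix x assume x: "a \<le> x" "x \<le> a + 1"
      have "(f has_field_derivative ((s - 1) * of_real a powr (-s) + (1 - s) * of_real x powr (1 - s - 1)))
          (at (of_real x) within of_real ` {a..a + 1})"
        unfolding f_def using x a
        by (intro DERIV_add has_field_derivative_of_real_powr DERIV_cmult_Id) auto
      then show "(f has_field_derivative (1 - s) * (of_real x powr (-s) - of_real a powr (-s)))
          (at (of_real x) within of_real ` {a..a + 1})"
        by (simp add: algebra_simps)
      have "norm ((1 - s) * (of_real x powr (-s) - of_real a powr (-s))) \<le> norm (1 - s) * (norm s * a powr (- Re s - 1))"
        unfolding norm_mult using x a s by (intro mult_left_mono nat_powr_diff_bound) auto
      then show "norm ((1 - s) * (of_real x powr (-s) - of_real a powr (-s))) \<le> norm s * norm (s - 1) * a powr (- Re s - 1)"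
        by (simp add: norm_minus_commute mult_ac)
    qed simp
    moreover have "f (of_real (a + 1)) - f (of_real a) = u n s"
      unfolding f_def u_def a_def by (simp add: algebra_simps)
    ultimately show ?thesis unfolding a_def by simp
  qed
  have "continuous_on UNIV (\<lambda>s::complex. norm s * norm (s - 1))" by (intro continuous_intros)
  note ser = holomorphic_series[OF hol this bd]
  define A where "A s = 1 + (\<Sum>n. u n s)" for s
  have A: "A holomorphic_on right_half_plane" unfolding A_def using ser(1) by (intro holomorphic_intros)
  have val: "dirichlet_sums (\<lambda>_. 1) s (A s / (s - 1))" if s: "Re s > 1" for s
  proof -
    obtain B where B: "dirichlet_sums (\<lambda>_. 1) s B" using dirichlet_sums_bounded[of "\<lambda>_. 1" 1 s] s by auto
    then have lim: "(\<lambda>N. \<Sum>n<N. of_nat (Suc n) powr (-s)) \<longlonglongrightarrow> B"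
      unfolding dirichlet_sums_iff_Suc sums_def by simp
    have "(\<Sum>n<N. u n s) = (s - 1) * (\<Sum>n<N. of_nat (Suc n) powr (-s)) - 1 + of_nat (Suc N) powr (1 - s)" for N
      by (induction N) (simp_all add: u_def algebra_simps)
    moreover have "(\<lambda>N. (s - 1) * (\<Sum>n<N. of_nat (Suc n) powr (-s)) - 1 + of_nat (Suc N) powr (1 - s)) \<longlonglongrightarrow> (s - 1) * B - 1 + 0"
      using s by (intro tendsto_intros lim tendsto_nat_powr_neg) auto
    ultimately have "(\<lambda>n. u n s) sums ((s - 1) * B - 1)" by (simp add: sums_def)
    then have "A s = (s - 1) * B" unfolding A_def by (simp add: sums_iff)
    moreover have "s \<noteq> 1" using s by auto
    ultimately show ?thesis using B by simp
  qed
  have A1: "A 1 = 1"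
  proof -
    have "u n 1 = 0" for n by (simp add: u_def del: of_nat_Suc)
    then show ?thesis by (simp add: A_def)
  qed
  define Z where "Z z = (if z = 1 then deriv A 1 else (A z - A 1) / (z - 1))" for z
  have "Z holomorphic_on right_half_plane"
    unfolding Z_def using pole_lemma_open[OF A, of 1] by (simp add: open_halfspace_Re_gt)
  moreover have "dirichlet_sums (\<lambda>_. 1) s (1 / (s - 1) + Z s)" if s: "Re s > 1" for s
  proof -
    have "s \<noteq> 1" using s by auto
    then have "1 / (s - 1) + Z s = A s / (s - 1)" unfolding Z_def A1 by (simp add: diff_divide_distrib)
    then show ?thesis using val[OF s] by simp
  qed
  ultimately show ?thesis using that by blast
qed

lemma periodic_mod:
  assumes "\<And>n. f (n + q) = f (n::nat)"
  shows "f (n mod q) = f n"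
proof -
  have "f (n mod q + j * q) = f (n mod q)" for j
    by (induction j) (use assms[of "n mod q + _ * q"] in \<open>simp_all add: algebra_simps\<close>)
  from this[of "n div q"] show ?thesis by simp
qed

text \<open>A full period sums to 0, so the partial sums are themselves periodic.\<close>

lemma periodic_partial_sums_bounded:
  fixes f :: "nat \<Rightarrow> complex"
  assumes q: "q > 0" and per: "\<And>n. f (n + q) = f n" and mean: "(\<Sum>n<q. f n) = 0"
  obtains C where "\<And>N. norm (\<Sum>n<N. f (Suc n)) \<le> C"
proof -
  define S where "S N = (\<Sum>n<N. f (Suc n))" for N
  have S: "S (N + q) = S N" for N
  proof (induction N)
    case 0
    have "(\<Sum>n<q. f (Suc n)) + f 0 = (\<Sum>n<Suc q. f n)"
      unfolding sum.lessThan_Suc_shift by (simp add: add.commute)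
    then show ?case using per[of 0] mean by (simp add: S_def)
  next
    case (Suc N)
    then show ?case using per[of "Suc N"] by (simp add: S_def)
  qed
  have "norm (S N) \<le> (\<Sum>k<q. norm (S k))" for N
  proof -
    have "norm (S (N mod q)) \<le> (\<Sum>k<q. norm (S k))" using q by (intro member_le_sum) auto
    then show ?thesis using periodic_mod[of S q N] S by simp
  qed
  then show ?thesis using that unfolding S_def by blast
qed

text \<open>Summation by parts moves the difference onto the powers, where it gains one power of n,
  while the partial sums of f stay bounded.\<close>

lemma dirichlet_mean_zero_continuation:
  fixes f :: "nat \<Rightarrow> complex"
  assumes C: "\<And>N. norm (\<Sum>n<N. f (Suc n)) \<le> C"
  obtains H where "H holomorphic_on right_half_plane"
    "\<And>s A. \<lbrakk>Re s > 1; dirichlet_sums f s A\<rbrakk> \<Longrightarrow> A = H s"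
proof -
  define S where "S N = (\<Sum>n<N. f (Suc n))" for N
  have S: "norm (S N) \<le> C" for N using C by (simp add: S_def)
  define u where "u n s = S (Suc n) * (of_nat (Suc n) powr (-s) - of_nat (Suc (Suc n)) powr (-s))" for n and s :: complex
  have hol: "u n holomorphic_on right_half_plane" for n
    unfolding u_def by (intro holomorphic_intros)
  have bd: "norm (u n s) \<le> (C * norm s) * real (Suc n) powr (- Re s - 1)" if s: "Re s > 0" for n s
  proof -
    have "norm (of_real (real (Suc n) + 1) powr (-s) - of_real (real (Suc n)) powr (-s) :: complex) \<le> norm s * real (Suc n) powr (- Re s - 1)"
      using s by (intro nat_powr_diff_bound) auto
    then have "norm (of_nat (Suc n) powr (-s) - of_nat (Suc (Suc n)) powr (-s)) \<le> norm s * real (Suc n) powr (- Re s - 1)"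
      by (simp add: norm_minus_commute add_ac)
    then have "norm (u n s) \<le> C * (norm s * real (Suc n) powr (- Re s - 1))"
      unfolding u_def norm_mult using S[of "Suc n"] order_trans[OF norm_ge_zero S] by (intro mult_mono) auto
    then show ?thesis by (simp add: mult_ac)
  qed
  have "continuous_on UNIV (\<lambda>s::complex. C * norm s)" by (intro continuous_intros)
  note ser = holomorphic_series[OF hol this bd]
  have "A = (\<Sum>n. u n s)" if s: "Re s > 1" and A: "dirichlet_sums f s A" for s A
  proof -
    have lim: "(\<lambda>N. \<Sum>n<N. f (Suc n) * of_nat (Suc n) powr (-s)) \<longlonglongrightarrow> A"
      using A unfolding dirichlet_sums_iff_Suc sums_def by simp
    have eq: "(\<Sum>n<N. u n s) = (\<Sum>n<N. f (Suc n) * of_nat (Suc n) powr (-s)) - S N * of_nat (Suc N) powr (-s)" for N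
      by (induction N) (simp_all add: u_def S_def algebra_simps)
    have "(\<lambda>N. S N * of_nat (Suc N) powr (-s)) \<longlonglongrightarrow> 0"
    proof (rule Lim_null_comparison)
      show "\<forall>\<^sub>F N in sequentially. norm (S N * of_nat (Suc N) powr (-s)) \<le> C * norm (of_nat (Suc N) powr (-s) :: complex)"
        using S by (intro always_eventually allI) (simp only: norm_mult mult_right_mono norm_ge_zero)
      have "(\<lambda>N. C * norm (of_nat (Suc N) powr (-s) :: complex)) \<longlonglongrightarrow> C * norm (0::complex)"
        using s by (intro tendsto_intros tendsto_nat_powr_neg) auto
      then show "(\<lambda>N. C * norm (of_nat (Suc N) powr (-s) :: complex)) \<longlonglongrightarrow> 0" by simp
    qed
    from tendsto_diff[OF lim this] have "(\<lambda>n. u n s) sums A" unfolding sums_def eq by simp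
    then show ?thesis by (simp add: sums_iff)
  qed
  then show ?thesis using that[OF ser(1)] by blast
qed

lemma dirichlet_sums_add_const:
  assumes "dirichlet_sums f s A" "dirichlet_sums g s B"
  shows "dirichlet_sums (\<lambda>n. f n + c * g n) s (A + c * B)"
proof -
  have sm: "summable (\<lambda>n. norm (f n * of_nat n powr (-s)) + norm c * norm (g n * of_nat n powr (-s)))"
    using assms unfolding dirichlet_sums_def by (intro summable_add summable_mult) auto
  have bd: "norm (norm ((f n + c * g n) * of_nat n powr (-s))) \<le> norm (f n * of_nat n powr (-s)) + norm c * norm (g n * of_nat n powr (-s))" for n
    using norm_triangle_ineq[of "f n * of_nat n powr (-s)" "c * g n * of_nat n powr (-s)"]
    by (simp add: norm_mult algebra_simps)
  have "summable (\<lambda>n. norm ((f n + c * g n) * of_nat n powr (-s)))"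
    by (rule summable_comparison_test'[OF sm, of 0]) (rule bd)
  moreover have "(\<lambda>n. f n * of_nat n powr (-s) + c * (g n * of_nat n powr (-s))) sums (A + c * B)"
    using assms unfolding dirichlet_sums_def by (intro sums_add sums_mult) auto
  ultimately show ?thesis unfolding dirichlet_sums_def by (simp add: algebra_simps)
qed

text \<open>Subtracting the mean leaves a sequence with bounded partial sums; the mean contributes a
  multiple of the zeta function and thus becomes the residue at 1.\<close>

lemma dirichlet_periodic_continuation:
  fixes f :: "nat \<Rightarrow> complex"
  assumes q: "q > 0" and per: "\<And>n. f (n + q) = f n"
  obtains H where "H holomorphic_on right_half_plane"
    "\<And>s. Re s > 1 \<Longrightarrow> dirichlet_sums f s ((\<Sum>n<q. f n) / of_nat q / (s - 1) + H s)"
proof -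
  define c where "c = (\<Sum>n<q. f n) / of_nat q"
  define g where "g n = f n - c" for n
  have g: "g (n + q) = g n" for n using per by (simp add: g_def)
  have "(\<Sum>n<q. g n) = 0" using q by (simp add: g_def c_def sum_subtractf)
  then obtain C where "\<And>N. norm (\<Sum>n<N. g (Suc n)) \<le> C"
    using periodic_partial_sums_bounded[OF q, of g] g by blast
  then obtain G where G: "G holomorphic_on right_half_plane"
    "\<And>s A. \<lbrakk>Re s > 1; dirichlet_sums g s A\<rbrakk> \<Longrightarrow> A = G s"
    using dirichlet_mean_zero_continuation[of g C] by metis
  obtain Z where Z: "Z holomorphic_on right_half_plane"
    "\<And>s. Re s > 1 \<Longrightarrow> dirichlet_sums (\<lambda>_. 1) s (1 / (s - 1) + Z s)" using zeta_continuation by blast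
  have gb: "norm (g n) \<le> (\<Sum>k<q. norm (g k))" for n
  proof -
    have "norm (g (n mod q)) \<le> (\<Sum>k<q. norm (g k))" using q by (intro member_le_sum) auto
    then show ?thesis using periodic_mod[of g q n] g by simp
  qed
  show ?thesis
  proof (rule that[of "\<lambda>s. G s + c * Z s"])
    show "(\<lambda>s. G s + c * Z s) holomorphic_on right_half_plane" using G(1) Z(1) by (intro holomorphic_intros)
    fix s :: complex assume s: "Re s > 1"
    obtain A where A: "dirichlet_sums g s A" using dirichlet_sums_bounded[of g, OF gb s] by blast
    then have "dirichlet_sums (\<lambda>n. g n + c * 1) s (G s + c * (1 / (s - 1) + Z s))"
      using dirichlet_sums_add_const[OF A Z(2)[OF s]] G(2)[OF s A] by simp
    then show "dirichlet_sums f s ((\<Sum>n<q. f n) / of_nat q / (s - 1) + (G s + c * Z s))"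
      by (simp add: g_def flip: c_def) (simp add: algebra_simps)
  qed
qed

section \<open>Newman's Tauberian theorem\<close>

lemma powr_MVT:
  fixes a b p :: real
  assumes "0 < a" "a < b"
  shows "\<exists>\<xi>. a < \<xi> \<and> \<xi> < b \<and> b powr p - a powr p = (b - a) * (p * \<xi> powr (p - 1))"
proof (rule MVT2[OF assms(2)])
    fix x assume "a \<le> x" "x \<le> b"
    then show "((\<lambda>x. x powr p) has_real_derivative p * x powr (p - 1)) (at x)"
      using assms by (intro has_real_derivative_powr) auto
qed

lemma sum_powr_tail_le:
  fixes x :: real
  assumes x: "x > 0" and N: "N \<ge> 1"
  shows "(\<Sum>n=Suc N..N + M. real n powr (-1 - x)) \<le> real N powr (-x) / x"
proof -
  have step: "real (Suc n) powr (-1 - x) \<le> (real n powr (-x) - real (Suc n) powr (-x)) / x" if n1: "n \<ge> 1" for n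
  proof -
    obtain \<xi> where \<xi>: "real n < \<xi>" "\<xi> < real (Suc n)"
      "real (Suc n) powr (-x) - real n powr (-x) = (real (Suc n) - real n) * ((-x) * \<xi> powr (-x - 1))"
      using powr_MVT[of "real n" "real (Suc n)" "-x"] n1 by (metis gr0I not_one_le_zero of_nat_0_less_iff lessI of_nat_less_iff)
    have "real (Suc n) powr (-1 - x) \<le> \<xi> powr (-1 - x)"
      using \<xi> x that by (intro powr_mono2') auto
    also have "\<dots> = (real n powr (-x) - real (Suc n) powr (-x)) / x"
    proof -
      have "real n powr (-x) - real (Suc n) powr (-x) = x * \<xi> powr (-x - 1)" using \<xi>(3) by simp
      moreover have "-x - 1 = -1 - x" by simp
      ultimately show ?thesis using x by simp
    qed
    finally show ?thesis .
  qed
  have "(\<Sum>n=Suc N..N + M. real n powr (-1 - x)) \<le> (real N powr (-x) - real (N + M) powr (-x)) / x"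
  proof (induction M)
    case (Suc M)
    then show ?case using step[of "N + M"] N by (simp add: diff_divide_distrib)
  qed simp
  also have "\<dots> \<le> real N powr (-x) / x" using x by (intro divide_right_mono) auto
  finally show ?thesis .
qed

text \<open>For y \<le> 1 the summands do not increase and the integral alone bounds the sum. For y
  > 1 they increase, the comparison is shifted by one, and the last summand is left over as the
  second term.\<close>

lemma sum_powr_le:
  fixes y :: real
  assumes y: "y > 0" and N: "N \<ge> 1"
  shows "(\<Sum>n=1..N. real n powr (y - 1)) \<le> real N powr y / y + real N powr (y - 1)"
proof (cases "y \<le> 1")
  case True
  have step: "real (Suc n) powr (y - 1) \<le> (real (Suc n) powr y - real n powr y) / y" for n
  proof (cases "n = 0")
    case 1: True
    then show ?thesis using y True by simp
  next
    case False
    obtain \<xi> where \<xi>: "real n < \<xi>" "\<xi> < real (Suc n)"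
      "real (Suc n) powr y - real n powr y = (real (Suc n) - real n) * (y * \<xi> powr (y - 1))"
      using powr_MVT[of "real n" "real (Suc n)" y] False by (metis gr0I not_one_le_zero of_nat_0_less_iff lessI of_nat_less_iff)
    have "real (Suc n) powr (y - 1) \<le> \<xi> powr (y - 1)"
      using \<xi> True False by (intro powr_mono2') auto
    then show ?thesis using \<xi>(3) y by simp
  qed
  have "(\<Sum>n=1..N. real n powr (y - 1)) \<le> real N powr y / y"
  proof (induction N)
    case (Suc N)
    then show ?case using step[of N] by (simp add: diff_divide_distrib)
  qed simp
  then show ?thesis by (smt (verit) powr_ge_zero)
next
  case False
  have step: "real n powr (y - 1) \<le> (real (Suc n) powr y - real n powr y) / y" if n1: "n \<ge> 1" for n
  proof -
    obtain \<xi> where \<xi>: "real n < \<xi>" "\<xi> < real (Suc n)"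
      "real (Suc n) powr y - real n powr y = (real (Suc n) - real n) * (y * \<xi> powr (y - 1))"
      using powr_MVT[of "real n" "real (Suc n)" y] n1 by (metis gr0I not_one_le_zero of_nat_0_less_iff lessI of_nat_less_iff)
    have "real n powr (y - 1) \<le> \<xi> powr (y - 1)"
      using \<xi> False that by (intro powr_mono2) auto
    then show ?thesis using \<xi>(3) y by simp
  qed
  have "(\<Sum>n=1..M. real n powr (y - 1)) \<le> real (Suc M) powr y / y" for M
  proof (induction M)
    case (Suc M)
    then show ?case using step[of "Suc M"] by (simp add: diff_divide_distrib)
  qed (use y in simp)
  from this[of "N - 1"] have "(\<Sum>n=1..N - 1. real n powr (y - 1)) \<le> real N powr y / y" using N by simp
  moreover have "{1..N} = insert N {1..N - 1}" using N by auto
  ultimately show ?thesis using N by simp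
qed

text \<open>The bound degenerates like 1 / Re z at the imaginary axis; the kernel on the circle will
  compensate for that.\<close>

lemma norm_dirichlet_tail_le:
  fixes a :: "nat \<Rightarrow> complex"
  assumes a: "\<And>n. norm (a n) \<le> 1" and sums: "(\<lambda>n. a n * of_nat n powr (-(1 + z))) sums G"
    and z: "Re z > 0" and N: "N \<ge> 1"
  shows "norm (G - (\<Sum>n=1..N. a n * of_nat n powr (-(1 + z)))) \<le> real N powr (- Re z) / Re z"
proof -
  define t where "t n = a n * of_nat n powr (-(1 + z))" for n
  have t: "norm (t n) \<le> real n powr (-1 - Re z)" for n
    unfolding t_def norm_mult norm_nat_powr using mult_right_mono[OF a[of n], of "real n powr (-1 - Re z)"]
    by simp
  have t0: "t 0 = 0" by (simp add: t_def)
  have eq: "(\<Sum>n<Suc k. t n) = (\<Sum>n=1..k. t n)" for k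
    by (induction k) (use t0 in auto)
  have "(\<lambda>k. \<Sum>n<k. t n) \<longlonglongrightarrow> G" using sums unfolding sums_def t_def .
  then have "(\<lambda>M. \<Sum>n<M + Suc N. t n) \<longlonglongrightarrow> G" by (rule LIMSEQ_ignore_initial_segment)
  then have lim: "(\<lambda>M. norm ((\<Sum>n<M + Suc N. t n) - (\<Sum>n=1..N. t n))) \<longlonglongrightarrow> norm (G - (\<Sum>n=1..N. t n))"
    by (intro tendsto_intros)
  have "norm ((\<Sum>n<M + Suc N. t n) - (\<Sum>n=1..N. t n)) \<le> real N powr (- Re z) / Re z" for M
  proof -
    have "(\<Sum>n<M + Suc N. t n) = (\<Sum>n=1..N + M. t n)" using eq[of "N + M"] by (simp add: add.commute)
    also have "\<dots> = (\<Sum>n=1..N. t n) + (\<Sum>n=Suc N..N + M. t n)"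
      by (induction M) auto
    finally have "norm ((\<Sum>n<M + Suc N. t n) - (\<Sum>n=1..N. t n)) = norm (\<Sum>n=Suc N..N + M. t n)" by simp
    also have "\<dots> \<le> (\<Sum>n=Suc N..N + M. real n powr (-1 - Re z))"
      by (rule order_trans[OF norm_sum]) (intro sum_mono t)
    also have "\<dots> \<le> real N powr (- Re z) / Re z" by (rule sum_powr_tail_le[OF z N])
    finally show ?thesis .
  qed
  then have "norm (G - (\<Sum>n=1..N. t n)) \<le> real N powr (- Re z) / Re z"
    by (intro Lim_bounded[OF lim]) auto
  then show ?thesis unfolding t_def .
qed

lemma norm_dirichlet_partial_le:
  fixes a :: "nat \<Rightarrow> complex"
  assumes a: "\<And>n. norm (a n) \<le> 1" and z: "Re z < 0" and N: "N \<ge> 1"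
  shows "norm (\<Sum>n=1..N. a n * of_nat n powr (-(1 + z))) \<le>
    real N powr (- Re z) / (- Re z) + real N powr (- Re z - 1)"
proof -
  have "norm (a n * of_nat n powr (-(1 + z))) \<le> real n powr (- Re z - 1)" for n
  proof -
    have e: "- Re z - 1 = - 1 - Re z" by simp
    show ?thesis
      unfolding norm_mult norm_nat_powr e using mult_right_mono[OF a[of n], of "real n powr (- 1 - Re z)"]
      by simp
  qed
  then have "norm (\<Sum>n=1..N. a n * of_nat n powr (-(1 + z))) \<le> (\<Sum>n=1..N. real n powr (- Re z - 1))"
    by (intro order_trans[OF norm_sum] sum_mono)
  also have "\<dots> \<le> real N powr (- Re z) / (- Re z) + real N powr (- Re z - 1)"
    using sum_powr_le[of "- Re z" N] z N by simp
  finally show ?thesis .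
qed

text \<open>The factor Re z cancels the 1 / Re z in the bounds for tails and partial sums, which is
  the reason for this kernel.\<close>

lemma newman_kernel_on_circle:
  assumes "norm z = R" "R > 0"
  shows "(1 + z\<^sup>2 / of_real (R\<^sup>2)) / z = of_real (2 * Re z / R\<^sup>2)"
proof -
  have z: "z \<noteq> 0" using assms by auto
  have "z * cnj z = of_real (R\<^sup>2)" using assms by (simp add: complex_norm_square[symmetric])
  then have "1 = z * cnj z / of_real (R\<^sup>2)" using assms by simp
  then have "1 + z\<^sup>2 / of_real (R\<^sup>2) = z * (cnj z + z) / of_real (R\<^sup>2)"
    by (simp add: power2_eq_square algebra_simps add_divide_distrib)
  then have "(1 + z\<^sup>2 / of_real (R\<^sup>2)) / z = (cnj z + z) / of_real (R\<^sup>2)" using z by simp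
  also have "\<dots> = of_real (2 * Re z / R\<^sup>2)" by (simp add: complex_add_cnj add.commute)
  finally show ?thesis .
qed

section \<open>Half circles and Cauchy's formula\<close>

definition right_arc :: "real \<Rightarrow> real \<Rightarrow> complex" where "right_arc R = part_circlepath 0 R (-(pi/2)) (pi/2)"
definition left_arc :: "real \<Rightarrow> real \<Rightarrow> complex" where "left_arc R = part_circlepath 0 R (pi/2) (3*pi/2)"

lemma arc_ends:
  "pathstart (right_arc R) = - (\<i> * of_real R)" "pathfinish (right_arc R) = \<i> * of_real R"
  "pathstart (left_arc R) = \<i> * of_real R" "pathfinish (left_arc R) = - (\<i> * of_real R)"
proof -
  have 1: "exp (\<i> * of_real (pi/2)) = \<i>" by (simp add: exp_Euler sin_of_real cos_of_real flip: of_real_divide)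
  have 2: "exp (\<i> * of_real (-(pi/2))) = - \<i>" using 1 exp_minus[of "\<i> * of_real (pi/2)"] by simp
  have 3: "exp (\<i> * of_real (3*pi/2)) = - \<i>"
  proof -
    have "\<i> * of_real (3*pi/2) = \<i> * of_real pi + \<i> * of_real (pi/2)"
      by (simp add: field_simps)
    then show ?thesis using 1 by (simp only: exp_add) simp
  qed
  show "pathstart (right_arc R) = - (\<i> * of_real R)" "pathfinish (right_arc R) = \<i> * of_real R"
    "pathstart (left_arc R) = \<i> * of_real R" "pathfinish (left_arc R) = - (\<i> * of_real R)"
    unfolding right_arc_def left_arc_def pathstart_part_circlepath pathfinish_part_circlepath 1 2 3
    by (simp_all add: mult.commute)
qed

lemma path_image_arcs:
  assumes R: "R > 0"
  shows "z \<in> path_image (right_arc R) \<Longrightarrow> norm z = R \<and> Re z \<ge> 0"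
    "z \<in> path_image (left_arc R) \<Longrightarrow> norm z = R \<and> Re z \<le> 0"
proof -
  assume "z \<in> path_image (right_arc R)"
  then obtain t where t: "t \<in> {-(pi/2)..pi/2}" "z = of_real R * exp (\<i> * of_real t)"
    unfolding right_arc_def by (auto simp: path_image_part_circlepath)
  have "Re z = R * cos t" unfolding t(2) by (simp add: Re_exp)
  then show "norm z = R \<and> Re z \<ge> 0" using t R cos_ge_zero[of t] by (auto simp: norm_mult)
next
  assume "z \<in> path_image (left_arc R)"
  then obtain t where t: "t \<in> {pi/2..3*pi/2}" "z = of_real R * exp (\<i> * of_real t)"
    unfolding left_arc_def by (auto simp: path_image_part_circlepath)
  have "cos (t - pi) \<ge> 0" using t(1) by (intro cos_ge_zero) auto
  then have "cos t \<le> 0" by (simp add: cos_diff)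
  then have "R * cos t \<le> 0" using R by (simp add: mult_le_0_iff)
  moreover have "Re z = R * cos t" unfolding t(2) by (simp add: Re_exp)
  ultimately show "norm z = R \<and> Re z \<le> 0" unfolding t(2) using R by (simp add: norm_mult)
qed

text \<open>The winding number is computed with the primitives \<open>Ln w\<close> and \<open>Ln (- w)\<close> of \<open>1 / w\<close>.\<close>

lemma cauchy_two_arcs:
  assumes R: "R > 0" and S: "open S" "convex S" and h: "h holomorphic_on S"
    and arc: "path_image (right_arc R) \<subseteq> S" "0 \<in> S"
    and \<gamma>: "valid_path \<gamma>" "path_image \<gamma> \<subseteq> S" "pathstart \<gamma> = \<i> * of_real R" "pathfinish \<gamma> = - (\<i> * of_real R)"
    and slit: "\<And>z. z \<in> path_image \<gamma> \<Longrightarrow> - z \<notin> \<real>\<^sub>\<le>\<^sub>0"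
  shows "contour_integral (right_arc R) (\<lambda>z. h z / z) + contour_integral \<gamma> (\<lambda>z. h z / z) = 2 * pi * \<i> * h 0"
    "(\<lambda>z. h z / z) contour_integrable_on right_arc R"
    "(\<lambda>z. h z / z) contour_integrable_on \<gamma>"
proof -
  let ?c = "right_arc R +++ \<gamma>"
  have va: "valid_path (right_arc R)" by (simp add: right_arc_def)
  have slit1: "z \<notin> \<real>\<^sub>\<le>\<^sub>0" if "z \<in> path_image (right_arc R)" for z
    using path_image_arcs(1)[OF R that] R by (auto simp: complex_nonpos_Reals_iff complex_eq_iff)
  have nz: "0 \<notin> path_image (right_arc R)" "0 \<notin> path_image \<gamma>" using slit1 slit by force+
  have join: "pathfinish (right_arc R) = pathstart \<gamma>" by (simp add: arc_ends \<gamma>)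
  have vc: "valid_path ?c" by (rule valid_path_join[OF va \<gamma>(1) join])
  have pc: "path_image ?c \<subseteq> S - {0}" using arc \<gamma> nz path_image_join_subset[of "right_arc R" \<gamma>] by blast
  have closed: "pathfinish ?c = pathstart ?c" by (simp add: arc_ends \<gamma>)
  have int: "(\<lambda>z. h z / z) contour_integrable_on p" if "valid_path p" "path_image p \<subseteq> S - {0}" for p
    by (rule contour_integrable_holomorphic_simple[of _ "S - {0}"])
      (use that S h in \<open>auto intro!: holomorphic_intros intro: holomorphic_on_subset\<close>)
  show i1: "(\<lambda>z. h z / z) contour_integrable_on right_arc R" using int[OF va] arc nz by blast
  show i2: "(\<lambda>z. h z / z) contour_integrable_on \<gamma>" using int[OF \<gamma>(1)] \<gamma> nz by blast
  have c1: "((\<lambda>w. 1 / w) has_contour_integral (Ln (pathfinish (right_arc R)) - Ln (pathstart (right_arc R)))) (right_arc R)"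
    by (rule contour_integral_primitive[of "- \<real>\<^sub>\<le>\<^sub>0"])
      (use va slit1 in \<open>auto intro!: derivative_eq_intros simp: field_simps\<close>)
  have c2: "((\<lambda>w. 1 / w) has_contour_integral (Ln (- pathfinish \<gamma>) - Ln (- pathstart \<gamma>))) \<gamma>"
    by (rule contour_integral_primitive[of "{z. - z \<notin> \<real>\<^sub>\<le>\<^sub>0}" "\<lambda>z. Ln (- z)"])
      (use \<gamma> slit in \<open>auto intro!: derivative_eq_intros simp: field_simps\<close>)
  have "Ln (- (\<i> * of_real R)) = Ln (\<i> * of_real R) - \<i> * pi"
    using Ln_minus[of "\<i> * of_real R"] R by simp
  then have "((\<lambda>w. 1 / w) has_contour_integral (2 * pi * \<i>)) ?c"
    using has_contour_integral_join[OF c1 c2 va \<gamma>(1)] by (simp add: arc_ends \<gamma> mult_ac)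
  then have "contour_integral ?c (\<lambda>w. 1 / (w - 0)) = 2 * pi * \<i>"
    using contour_integral_unique by simp
  moreover have "0 \<notin> path_image ?c" using pc by blast
  ultimately have "winding_number ?c 0 = 1"
    using winding_number_valid_path[OF vc, of 0] by simp
  then have "((\<lambda>w. h w / (w - 0)) has_contour_integral (2 * pi * \<i> * h 0)) ?c"
    using Cauchy_integral_formula_convex_simple[OF S(2) h _ vc pc closed] arc S(1)
    by (simp add: interior_open)
  then have "contour_integral ?c (\<lambda>w. h w / w) = 2 * pi * \<i> * h 0"
    using contour_integral_unique by fastforce
  then show "contour_integral (right_arc R) (\<lambda>z. h z / z) + contour_integral \<gamma> (\<lambda>z. h z / z) = 2 * pi * \<i> * h 0"
    using contour_integral_join[OF i1 i2 va \<gamma>(1)] by simp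
qed

text \<open>The exponential has modulus \<open>Suc N\<close> to the power Re z, at most 1 and
  tending to 0 inside the segment. The end points may lie on the imaginary axis, hence dominated
  convergence on the open parameter interval instead of a uniform estimate.\<close>

lemma linepath_decay:
  assumes k: "continuous_on (closed_segment p q) k"
    and neg: "\<And>t. 0 < t \<Longrightarrow> t < 1 \<Longrightarrow> Re (linepath p q t) < 0"
  shows "(\<lambda>N. contour_integral (linepath p q) (\<lambda>z. k z * exp (z * of_real (ln (real (Suc N)))))) \<longlonglongrightarrow> 0"
proof -
  define f where "f N t = k (linepath p q t) * exp (linepath p q t * of_real (ln (real (Suc N)))) * (q - p)" for N t
  obtain B where B: "\<And>z. z \<in> closed_segment p q \<Longrightarrow> norm (k z) \<le> B"
    using compact_imp_bounded[OF compact_continuous_image[OF k compact_segment]] unfolding bounded_iff by blast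
  have seg: "linepath p q t \<in> closed_segment p q" if "0 < t" "t < 1" for t
    using that linepath_in_path[of t p q] by auto
  have int: "(\<lambda>z. k z * exp (z * of_real (ln (real (Suc N))))) contour_integrable_on linepath p q" for N
    by (intro contour_integrable_continuous_linepath continuous_intros k)
  then have fi: "f N integrable_on {0..1}" for N
    unfolding f_def contour_integrable_on_def has_contour_integral_linepath integrable_on_def by blast
  have ci: "contour_integral (linepath p q) (\<lambda>z. k z * exp (z * of_real (ln (real (Suc N))))) = integral {0<..<1} (f N)" for N
  proof -
    have "(f N has_integral contour_integral (linepath p q) (\<lambda>z. k z * exp (z * of_real (ln (real (Suc N)))))) {0..1}"
      using has_contour_integral_integral[OF int[of N]] unfolding f_def has_contour_integral_linepath .
    then show ?thesis unfolding integral_open_interval_real[symmetric] by (rule integral_unique[symmetric])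
  qed
  have "(\<lambda>N. integral {0<..<1} (f N)) \<longlonglongrightarrow> integral {0<..<1::real} (\<lambda>_. 0 :: complex)"
  proof (rule dominated_convergence(2))
    show "f N integrable_on {0<..<1}" for N using fi integrable_on_open_interval_real by blast
    show "(\<lambda>_. B * norm (q - p)) integrable_on {0<..<1::real}"
      unfolding integrable_on_open_interval_real by (rule integrable_const_ivl)
    fix t :: real assume "t \<in> {0<..<1}"
    then have t: "0 < t" "t < 1" by auto
    have nf: "norm (f N t) \<le> B * exp (Re (linepath p q t) * ln (real (Suc N))) * norm (q - p)" for N
      unfolding f_def norm_mult using B[OF seg[OF t]] by (intro mult_right_mono) (auto intro!: mult_right_mono)
    have B0: "B \<ge> 0" using B[OF seg[OF t]] norm_ge_zero order_trans by blast
    show "norm (f N t) \<le> B * norm (q - p)" for N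
    proof (rule order_trans[OF nf])
      have "exp (Re (linepath p q t) * ln (real (Suc N))) \<le> 1"
        using neg[OF t] by (simp add: mult_nonpos_nonneg)
      then have "B * exp (Re (linepath p q t) * ln (real (Suc N))) \<le> B * 1" using B0 by (intro mult_left_mono)
      then show "B * exp (Re (linepath p q t) * ln (real (Suc N))) * norm (q - p) \<le> B * norm (q - p)"
        by (intro mult_right_mono) auto
    qed
    have "(\<lambda>N. real (Suc N) powr Re (linepath p q t)) \<longlonglongrightarrow> 0"
      using neg[OF t] LIMSEQ_Suc[OF tendsto_neg_powr[OF _ filterlim_real_sequentially]] by blast
    then have "(\<lambda>N. B * real (Suc N) powr Re (linepath p q t) * norm (q - p)) \<longlonglongrightarrow> B * 0 * norm (q - p)"
      by (intro tendsto_intros)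
    moreover have "real (Suc N) powr Re (linepath p q t) = exp (Re (linepath p q t) * ln (real (Suc N)))" for N
      by (simp add: powr_def)
    ultimately have "(\<lambda>N. B * exp (Re (linepath p q t) * ln (real (Suc N))) * norm (q - p)) \<longlonglongrightarrow> 0" by simp
    then show "(\<lambda>N. f N t) \<longlonglongrightarrow> 0"
      by (rule Lim_null_comparison[rotated]) (use nf in auto)
  qed
  then show ?thesis unfolding ci by simp
qed

text \<open>Compactness of a bounded piece of the line Re s = 1 gives a uniform width, which depends
  on the height \<open>R\<close>.\<close>

lemma holomorphic_strip:
  assumes \<Omega>: "open \<Omega>" "\<And>s. Re s \<ge> 1 \<Longrightarrow> s \<in> \<Omega>"
  obtains d where "d > 0" "\<And>z. \<lbrakk>Re z > -d; \<bar>Im z\<bar> < R\<rbrakk> \<Longrightarrow> 1 + z \<in> \<Omega>"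
proof -
  define C where "C = (\<lambda>y. 1 + \<i> * complex_of_real y) ` {-R..R}"
  have "compact C" unfolding C_def by (intro compact_continuous_image continuous_intros) auto
  moreover have "C \<subseteq> \<Omega>" unfolding C_def using \<Omega>(2) by auto
  ultimately obtain d where d: "d > 0" "(\<Union>x\<in>C. ball x d) \<subseteq> \<Omega>"
    using compact_subset_open_imp_ball_epsilon_subset[OF _ \<Omega>(1)] by metis
  show ?thesis
  proof (rule that[OF d(1)])
    fix z assume z: "Re z > -d" "\<bar>Im z\<bar> < R"
    show "1 + z \<in> \<Omega>"
    proof (cases "Re z \<ge> 0")
      case True
      then show ?thesis using \<Omega>(2) by simp
    next
      case False
      have eq: "(1 + \<i> * complex_of_real (Im z)) - (1 + z) = of_real (- Re z)" by (simp add: complex_eq_iff)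
      have "dist (1 + \<i> * complex_of_real (Im z)) (1 + z) = \<bar>Re z\<bar>"
        unfolding dist_norm eq norm_of_real by simp
      then have "1 + z \<in> ball (1 + \<i> * complex_of_real (Im z)) d" using False z by simp
      moreover have "1 + \<i> * complex_of_real (Im z) \<in> C"
        unfolding C_def by (rule imageI) (use z in auto)
      ultimately show ?thesis using d by blast
    qed
  qed
qed

text \<open>Cauchy's formula recovers the remainder at z = 0 after multiplication by
  \<open>E N z\<close>, of modulus N to the power Re z. This factor balances the tail g - P on the
  right arc and the partial sum P on the left arc. For g itself, available only slightly to the left
  of the axis, the left part is a polygon on which \<open>E N z\<close> tends to 0.\<close>

theorem newman_tauberian:
  fixes a :: "nat \<Rightarrow> complex"
  assumes a: "\<And>n. norm (a n) \<le> 1"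
    and \<Omega>: "open \<Omega>" "\<And>s. Re s \<ge> 1 \<Longrightarrow> s \<in> \<Omega>"
    and F: "F holomorphic_on \<Omega>" "\<And>s. Re s > 1 \<Longrightarrow> (\<lambda>n. a n * of_nat n powr (-s)) sums F s"
  shows "(\<lambda>N. \<Sum>n=1..N. a n / of_nat n) \<longlonglongrightarrow> F 1"
proof -
  define g where "g z = F (1 + z)" for z
  define P where "P N z = (\<Sum>n=1..N. a n * of_nat n powr (-(1 + z)))" for N z
  define E where "E N z = exp (z * of_real (ln (real N)))" for N and z :: complex
  have normE: "norm (E N z) = real N powr Re z" if "N \<ge> 1" for N z
    using that by (simp add: E_def powr_def mult.commute)
  have main: "\<forall>\<^sub>F N in sequentially. norm (g 0 - P (Suc N) 0) < e" if e: "e > 0" for e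
  proof -
    \<comment> \<open>Chosen so that 4 / R < e. The two arcs cost 2 pi / R each and two vanishing
      errors less than 1 / R each; the total is below 8 pi / R, and Cauchy's formula divides by 2
      pi.\<close>
    define R where "R = 4 / e + 1"
    have R: "R > 0" "4 / R < e"
    proof -
      show R0: "R > 0" using e by (simp add: R_def add_pos_pos)
      have "4 < e * R" using e by (simp add: R_def field_simps)
      then show "4 / R < e" using R0 by (simp add: field_simps)
    qed
    \<comment> \<open>The margin 1 keeps the ends of the arc, at heights R and -R, inside the open
      half strip S.\<close>
    obtain d where d: "d > 0" "\<And>z. \<lbrakk>Re z > -d; \<bar>Im z\<bar> < R + 1\<rbrakk> \<Longrightarrow> 1 + z \<in> \<Omega>"
      using holomorphic_strip[OF \<Omega>, of "R + 1"] by metis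
    define S where "S = {z. Re z > -d} \<inter> {z. Im z > -(R + 1)} \<inter> {z. Im z < R + 1}"
    have S: "open S" "convex S"
      unfolding S_def
      by (intro open_Int open_halfspace_Re_gt open_halfspace_Im_gt open_halfspace_Im_lt)
        (intro convex_Int convex_halfspace_Re_gt convex_halfspace_Im_gt convex_halfspace_Im_lt)
    have "(\<lambda>z. 1 + z) ` S \<subseteq> \<Omega>" using d(2) by (auto simp: S_def)
    then have "(F \<circ> (\<lambda>z. 1 + z)) holomorphic_on S"
      by (intro holomorphic_on_compose holomorphic_intros holomorphic_on_subset[OF F(1)])
    then have gS: "g holomorphic_on S" by (simp add: g_def[abs_def] o_def)
    have PU: "P N holomorphic_on UNIV" for N
    proof -
      have "P N = (\<lambda>z. \<Sum>n\<in>{1..N}. a n * exp (- (1 + z) * of_real (ln (real n))))"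
      proof
        fix z :: complex
        have "of_nat n powr (-(1 + z)) = exp (- (1 + z) * of_real (ln (real n)))" if "n \<in> {1..N}" for n
        proof -
          have "Ln (of_nat n) = of_real (ln (real n))" using that Ln_of_real[of "real n"] by simp
          then show ?thesis using that by (simp add: powr_def)
        qed
        then show "P N z = (\<Sum>n\<in>{1..N}. a n * exp (- (1 + z) * of_real (ln (real n))))"
          unfolding P_def by (intro sum.cong) auto
      qed
      then show ?thesis by (auto intro!: holomorphic_intros)
    qed
    have EU: "E N holomorphic_on A" for N A unfolding E_def[abs_def] by (intro holomorphic_intros)
    \<comment> \<open>The corner of a two-segment path, halfway into the strip; the path meets the
      imaginary axis only at its two ends.\<close>
    define D where "D = - complex_of_real (d / 2)"
    define L where "L = linepath (\<i> * of_real R) D +++ linepath D (- (\<i> * of_real R))"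
    have Lim: "z \<in> path_image L \<Longrightarrow> z \<in> S \<and> - z \<notin> \<real>\<^sub>\<le>\<^sub>0" for z
    proof -
      assume "z \<in> path_image L"
      then consider "z \<in> closed_segment (\<i> * of_real R) D" | "z \<in> closed_segment D (- (\<i> * of_real R))"
        unfolding L_def by (auto simp: path_image_join)
      then obtain u where u: "0 \<le> u" "u \<le> 1" "Re z = - u * (d / 2)" "\<bar>Im z\<bar> = (1 - u) * R"
      proof cases
        case 1
        then obtain u where u: "0 \<le> u" "u \<le> 1" "z = (1 - u) *\<^sub>R (\<i> * of_real R) + u *\<^sub>R D"
          unfolding in_segment by blast
        show ?thesis by (rule that[OF u(1,2)]) (use u R in \<open>auto simp: D_def abs_mult\<close>)
      next
        case 2
        then obtain u where u: "0 \<le> u" "u \<le> 1" "z = (1 - u) *\<^sub>R D + u *\<^sub>R (- (\<i> * of_real R))"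
          unfolding in_segment by blast
        have "Re z = - (1 - u) * (d / 2)" unfolding u(3) by (simp add: D_def algebra_simps)
        moreover have "\<bar>Im z\<bar> = u * R" unfolding u(3) using u R by (simp add: D_def abs_mult)
        ultimately show ?thesis using u by (intro that[of "1 - u"]) auto
      qed
      have "u * (d / 2) \<le> 1 * (d / 2)" using u d by (intro mult_right_mono) auto
      moreover have "\<bar>Im z\<bar> \<le> R" unfolding u(4) using u R mult_right_mono[of "1 - u" 1 R] by simp
      ultimately have "z \<in> S" using u(3) d(1) unfolding S_def by (simp add: abs_le_iff)
      moreover have "- z \<notin> \<real>\<^sub>\<le>\<^sub>0"
      proof
        assume "- z \<in> \<real>\<^sub>\<le>\<^sub>0"
        then have "Im z = 0" "Re z \<ge> 0" by (auto simp: complex_nonpos_Reals_iff)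
        then have "u = 1" "u * d \<le> 0" using u R by auto
        then show False using d by simp
      qed
      ultimately show ?thesis by blast
    qed
    have vL: "valid_path L" "pathstart L = \<i> * of_real R" "pathfinish L = - (\<i> * of_real R)"
      unfolding L_def by (auto intro: valid_path_join)
    have arcS: "path_image (right_arc R) \<subseteq> S" "0 \<in> S"
      using path_image_arcs(1)[OF R(1)] d R abs_Im_le_cmod by (auto simp: S_def) (smt (verit))+
    define K where "K z = 1 + z\<^sup>2 / of_real (R\<^sup>2)" for z :: complex
    have KU: "K holomorphic_on A" for A unfolding K_def[abs_def] by (intro holomorphic_intros) (use R in auto)
    have K0: "K 0 = 1" "E N 0 = 1" for N by (simp_all add: K_def E_def)
    define I1 where "I1 N = contour_integral (right_arc R) (\<lambda>z. (g z - P N z) * E N z * K z / z)" for N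
    define I2 where "I2 N = contour_integral (left_arc R) (\<lambda>z. P N z * E N z * K z / z)" for N
    define I3 where "I3 N = contour_integral L (\<lambda>z. g z * E N z * K z / z)" for N
    \<comment> \<open>P is entire, so its contour can be closed by the other half circle, where
      explicit bounds hold; for g it is closed by L.\<close>
    have id: "2 * pi * \<i> * (g 0 - P N 0) = I1 N + I3 N - I2 N" for N
    proof -
      have "(\<lambda>z. g z * E N z * K z) holomorphic_on S"
        by (intro holomorphic_intros gS EU KU)
      note c1 = cauchy_two_arcs[OF R(1) S this arcS vL(1) _ vL(2,3)]
      have c1': "contour_integral (right_arc R) (\<lambda>z. g z * E N z * K z / z) + I3 N = 2 * pi * \<i> * g 0"
        "(\<lambda>z. g z * E N z * K z / z) contour_integrable_on right_arc R"
        using c1 Lim K0 unfolding I3_def by (auto simp: subset_iff)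
      have "(\<lambda>z. P N z * E N z * K z) holomorphic_on UNIV"
        by (intro holomorphic_intros PU EU KU)
      note c2 = cauchy_two_arcs[OF R(1) open_UNIV convex_UNIV this _ _ _ _ arc_ends(3,4)]
      have sl: "- z \<notin> \<real>\<^sub>\<le>\<^sub>0" if "z \<in> path_image (left_arc R)" for z
        using path_image_arcs(2)[OF R(1) that] R by (auto simp: complex_nonpos_Reals_iff complex_eq_iff)
      have c2': "contour_integral (right_arc R) (\<lambda>z. P N z * E N z * K z / z) + I2 N = 2 * pi * \<i> * P N 0"
        "(\<lambda>z. P N z * E N z * K z / z) contour_integrable_on right_arc R"
        using c2 sl K0 unfolding I2_def by (auto simp: left_arc_def)
      have "I1 N = contour_integral (right_arc R) (\<lambda>z. g z * E N z * K z / z - P N z * E N z * K z / z)"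
        unfolding I1_def by (simp add: left_diff_distrib diff_divide_distrib)
      also have "\<dots> = contour_integral (right_arc R) (\<lambda>z. g z * E N z * K z / z) -
          contour_integral (right_arc R) (\<lambda>z. P N z * E N z * K z / z)"
        by (rule contour_integral_diff[OF c1'(2) c2'(2)])
      finally have I1: "I1 N = contour_integral (right_arc R) (\<lambda>z. g z * E N z * K z / z) -
          contour_integral (right_arc R) (\<lambda>z. P N z * E N z * K z / z)" .
      show ?thesis unfolding right_diff_distrib c1'(1)[symmetric] c2'(1)[symmetric] I1 by simp
    qed
    have Kz: "norm (K z / z) = 2 * \<bar>Re z\<bar> / R\<^sup>2" if "norm z = R" for z
      unfolding K_def newman_kernel_on_circle[OF that R(1)] norm_of_real by (simp add: abs_mult)
    have nm: "norm (w * E N z * K z / z) = norm w * real N powr Re z * (2 * \<bar>Re z\<bar> / R\<^sup>2)"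
      if "norm z = R" "N \<ge> 1" for w N z
    proof -
      have "w * E N z * K z / z = w * E N z * (K z / z)" by simp
      then show ?thesis by (simp only: norm_mult normE[OF that(2)] Kz[OF that(1)])
    qed
    have arcs0: "0 \<notin> path_image (right_arc R)" "0 \<notin> path_image (left_arc R)"
      using path_image_arcs[OF R(1), of 0] R(1) by auto
    have b1: "norm (I1 N) \<le> 2 * pi / R" if N: "N \<ge> 1" for N
    proof -
      have "norm (I1 N) \<le> (2 / R\<^sup>2) * R * \<bar>pi / 2 - (-(pi / 2))\<bar>"
        unfolding I1_def right_arc_def
      proof (rule contour_integral_bound_part_circlepath)
        have "(\<lambda>z. (g z - P N z) * E N z * K z / z) holomorphic_on S - {0}"
          by (intro holomorphic_intros EU KU holomorphic_on_subset[OF gS] holomorphic_on_subset[OF PU]) auto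
        then show "(\<lambda>z. (g z - P N z) * E N z * K z / z) contour_integrable_on part_circlepath 0 R (-(pi/2)) (pi/2)"
          using arcS arcs0(1) S(1) unfolding right_arc_def
          by (intro contour_integrable_holomorphic_simple[of _ "S - {0}"]) auto
        fix z assume "z \<in> path_image (part_circlepath 0 R (-(pi/2)) (pi/2))"
        then have z: "norm z = R" "Re z \<ge> 0" using path_image_arcs(1)[OF R(1)] unfolding right_arc_def by auto
        show "norm ((g z - P N z) * E N z * K z / z) \<le> 2 / R\<^sup>2"
        proof (cases "Re z = 0")
          case True
          then show ?thesis unfolding nm[OF z(1) N] by simp
        next
          case False
          then have x: "Re z > 0" using z by simp
          have "norm (g z - P N z) \<le> real N powr (- Re z) / Re z"
            unfolding g_def P_def using norm_dirichlet_tail_le[OF a F(2) x N] x by simp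
          then have "norm (g z - P N z) * real N powr Re z * (2 * Re z / R\<^sup>2)
              \<le> (real N powr (- Re z) / Re z) * real N powr Re z * (2 * Re z / R\<^sup>2)"
            using x by (intro mult_right_mono) auto
          also have "\<dots> = 2 / R\<^sup>2" using x N by (simp add: powr_minus field_simps)
          finally show ?thesis unfolding nm[OF z(1) N] using x by simp
        qed
      qed (use R in auto)
      also have "\<dots> = 2 * pi / R" using R by (simp add: power2_eq_square)
      finally show ?thesis .
    qed
    \<comment> \<open>The extra 2 pi / N stems from the leftover summand in
      \<open>sum_powr_le\<close>, with the modulus of Re z bounded by R.\<close>
    have b2: "norm (I2 N) \<le> 2 * pi / R + 2 * pi / real N" if N: "N \<ge> 1" for N
    proof -
      have "norm (I2 N) \<le> (2 / R\<^sup>2 + 2 / (R * real N)) * R * \<bar>3 * pi / 2 - pi / 2\<bar>"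
        unfolding I2_def left_arc_def
      proof (rule contour_integral_bound_part_circlepath)
        have "(\<lambda>z. P N z * E N z * K z / z) holomorphic_on UNIV - {0}"
          by (intro holomorphic_intros EU KU holomorphic_on_subset[OF PU]) auto
        then show "(\<lambda>z. P N z * E N z * K z / z) contour_integrable_on part_circlepath 0 R (pi/2) (3*pi/2)"
          using arcs0(2) unfolding left_arc_def
          by (intro contour_integrable_holomorphic_simple[of _ "UNIV - {0}"]) auto
        fix z assume "z \<in> path_image (part_circlepath 0 R (pi/2) (3*pi/2))"
        then have z: "norm z = R" "Re z \<le> 0" using path_image_arcs(2)[OF R(1)] unfolding left_arc_def by auto
        show "norm (P N z * E N z * K z / z) \<le> 2 / R\<^sup>2 + 2 / (R * real N)"
        proof (cases "Re z = 0")
          case True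
          then show ?thesis unfolding nm[OF z(1) N] using R by simp
        next
          case False
          then have x: "Re z < 0" using z by simp
          define y where "y = - Re z"
          have y: "y > 0" "y \<le> R" using x abs_Re_le_cmod[of z] z by (auto simp: y_def)
          have "norm (P N z) \<le> real N powr y / y + real N powr (y - 1)"
            unfolding P_def y_def using norm_dirichlet_partial_le[OF a x N] by simp
          then have "norm (P N z) * real N powr (-y) * (2 * y / R\<^sup>2)
              \<le> (real N powr y / y + real N powr (y - 1)) * real N powr (-y) * (2 * y / R\<^sup>2)"
            using y by (intro mult_right_mono) auto
          also have "\<dots> = 2 / R\<^sup>2 + (2 / R\<^sup>2 / real N) * y"
            using y N by (simp add: powr_minus powr_diff field_simps)
          also have "\<dots> \<le> 2 / R\<^sup>2 + (2 / R\<^sup>2 / real N) * R"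
            using y R by (intro add_left_mono mult_left_mono) auto
          also have "\<dots> = 2 / R\<^sup>2 + 2 / (R * real N)" using R by (simp add: power2_eq_square)
          finally show ?thesis unfolding nm[OF z(1) N] using x by (simp add: y_def)
        qed
      qed (use R in auto)
      also have "\<dots> = 2 * pi / R + 2 * pi / real N"
        using R N by (simp add: power2_eq_square field_simps)
      finally show ?thesis .
    qed
    have I3: "(\<lambda>N. I3 (Suc N)) \<longlonglongrightarrow> 0"
    proof -
      define k where "k z = g z * K z / z" for z
      have kh: "continuous_on (S - {0}) k"
        unfolding k_def by (intro holomorphic_on_imp_continuous_on holomorphic_intros KU holomorphic_on_subset[OF gS]) auto
      have sub: "closed_segment (\<i> * of_real R) D \<subseteq> S - {0}" "closed_segment D (- (\<i> * of_real R)) \<subseteq> S - {0}"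
        using Lim unfolding L_def by (force simp: path_image_join)+
      have k: "continuous_on (closed_segment (\<i> * of_real R) D) k" "continuous_on (closed_segment D (- (\<i> * of_real R))) k"
        using continuous_on_subset[OF kh] sub by blast+
      have "I3 (Suc N) = contour_integral (linepath (\<i> * of_real R) D) (\<lambda>z. k z * exp (z * of_real (ln (real (Suc N)))))
          + contour_integral (linepath D (- (\<i> * of_real R))) (\<lambda>z. k z * exp (z * of_real (ln (real (Suc N)))))" for N
      proof -
        have "I3 (Suc N) = contour_integral L (\<lambda>z. k z * exp (z * of_real (ln (real (Suc N)))))"
          unfolding I3_def k_def E_def by (simp add: mult_ac)
        then show ?thesis unfolding L_def
          by (subst (asm) contour_integral_join)
            (auto intro!: contour_integrable_continuous_linepath continuous_intros k)
      qed
      moreover have "(\<lambda>N. contour_integral (linepath (\<i> * of_real R) D) (\<lambda>z. k z * exp (z * of_real (ln (real (Suc N)))))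
          + contour_integral (linepath D (- (\<i> * of_real R))) (\<lambda>z. k z * exp (z * of_real (ln (real (Suc N)))))) \<longlonglongrightarrow> 0 + 0"
        using d by (intro tendsto_add linepath_decay k) (auto simp: linepath_def D_def)
      ultimately show ?thesis by simp
    qed
    have "\<forall>\<^sub>F N in sequentially. norm (I3 (Suc N)) < 1 / R"
      using I3 R unfolding tendsto_iff by (simp add: dist_norm)
    moreover have "\<forall>\<^sub>F N in sequentially. 2 * pi / real (Suc N) < 1 / R"
    proof -
      have "(\<lambda>N. 2 * pi / real (Suc N)) \<longlonglongrightarrow> 0" using LIMSEQ_Suc[OF lim_const_over_n[of "2 * pi"]] .
      then show ?thesis using R by (intro order_tendstoD(2)) auto
    qed
    ultimately show ?thesis
    proof eventually_elim
      case (elim N)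
      have "2 * pi * norm (g 0 - P (Suc N) 0) = norm (I1 (Suc N) + I3 (Suc N) - I2 (Suc N))"
        unfolding id[symmetric] by (simp add: norm_mult)
      also have "\<dots> \<le> norm (I1 (Suc N)) + norm (I3 (Suc N)) + norm (I2 (Suc N))"
        by (meson norm_triangle_ineq4 norm_triangle_ineq add_right_mono order_trans)
      also have "\<dots> \<le> 2 * pi / R + 1 / R + (2 * pi / R + 1 / R)"
        using b1[of "Suc N"] b2[of "Suc N"] elim by simp
      also have "\<dots> = (4 * pi + 2) / R" by (simp add: add_divide_distrib)
      also have "\<dots> < (8 * pi) / R"
        using R pi_gt3 by (intro divide_strict_right_mono) auto
      finally have "(2 * pi) * norm (g 0 - P (Suc N) 0) < (2 * pi) * (4 / R)" by simp
      then have "norm (g 0 - P (Suc N) 0) < 4 / R"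
        by (rule mult_left_less_imp_less) (use pi_gt3 in simp)
      then show ?case using R by simp
    qed
  qed
  have P0: "P N 0 = (\<Sum>n=1..N. a n / of_nat n)" for N
    unfolding P_def by (intro sum.cong) (auto simp: powr_minus divide_inverse)
  have "(\<lambda>N. P (Suc N) 0) \<longlonglongrightarrow> g 0"
    unfolding tendsto_iff dist_norm using main by (simp add: norm_minus_commute)
  then have "(\<lambda>N. P N 0) \<longlonglongrightarrow> g 0" by (rule LIMSEQ_imp_Suc)
  then show ?thesis unfolding P0 by (simp add: g_def)
qed

section \<open>The Moebius function, Dirichlet characters and Landau's theorem\<close>

lemma moebius_mu_mult:
  assumes "a > 0" "b > 0"
  shows "moebius_mu (a * b) = (if coprime a b then moebius_mu a * moebius_mu b else 0)"
proof (cases "coprime a b")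
  case True
  have "prime_factors (a * b) = prime_factors a \<union> prime_factors b"
    using assms by (intro prime_factors_product) auto
  moreover have "prime_factors a \<inter> prime_factors b = {}"
    using True by (auto simp: in_prime_factors_iff coprime_def)
  ultimately have "card (prime_factors (a * b)) = card (prime_factors a) + card (prime_factors b)"
    by (simp add: card_Un_disjoint)
  moreover have "squarefree (a * b) \<longleftrightarrow> squarefree a \<and> squarefree b"
    using squarefree_mult_coprime[OF True] squarefree_multD[of a b] by blast
  ultimately show ?thesis using True by (simp add: moebius_mu_def power_add)
next
  case False
  have "(gcd a b)\<^sup>2 dvd a * b" unfolding power2_eq_square by (intro mult_dvd_mono) auto
  then have "\<not> squarefree (a * b)" using False squarefreeD coprime_iff_gcd_eq_1 by (metis is_unit_gcd)
  then show ?thesis using False by (simp add: moebius_mu_def)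
qed

lemma moebius_mu_prime: "prime p \<Longrightarrow> moebius_mu p = -1"
  by (simp add: moebius_mu_def squarefree_prime prime_prime_factors)

lemma abs_moebius_mu_le: "\<bar>moebius_mu n\<bar> \<le> 1"
  by (simp add: moebius_mu_def power_abs)

text \<open>Fix a prime p dividing n. A divisor d prime to p cancels against \<open>p * d\<close> if
  this divides n, which it always does; all other divisors are multiples of the square of p, where
  \<mu> vanishes.\<close>

lemma sum_moebius_mu_divisors:
  assumes "n > 0"
  shows "(\<Sum>d | d dvd n. moebius_mu d) = (if n = 1 then 1 else 0)"
proof (cases "n = 1")
  case True
  then show ?thesis using moebius_mu_1 by simp
next
  case False
  then obtain p where p: "prime p" "p dvd n" using prime_factor_nat by blast
  obtain k where k: "n = p * k" using p by blast
  have p0: "p > 0" using p(1) prime_gt_0_nat by blast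
  have fin: "finite {d. d dvd n}" using assms by simp
  have pos: "d > 0" if "d dvd n" for d using that assms by (metis dvd_0_left gr0I less_irrefl)
  define A where "A = {d. d dvd n \<and> \<not> p dvd d}"
  have fins: "finite A" "finite {d. d dvd n \<and> p dvd d}"
    by (auto intro!: finite_subset[OF _ fin] simp: A_def)
  have split: "{d. d dvd n} = A \<union> {d. d dvd n \<and> p dvd d}" by (auto simp: A_def)
  have "(\<Sum>d | d dvd n. moebius_mu d) = (\<Sum>d\<in>A. moebius_mu d) + (\<Sum>d | d dvd n \<and> p dvd d. moebius_mu d)"
    unfolding split by (rule sum.union_disjoint[OF fins]) (auto simp: A_def)
  also have "(\<Sum>d | d dvd n \<and> p dvd d. moebius_mu d) = (\<Sum>d\<in>(\<lambda>d. p * d) ` A. moebius_mu d)"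
  proof (rule sum.mono_neutral_right)
    show "finite {d. d dvd n \<and> p dvd d}" by (rule fins)
    have "d dvd k" if "d \<in> A" for d
    proof -
      have "coprime d p" using that prime_imp_coprime[OF p(1), of d] by (simp add: A_def coprime_commute)
      then show ?thesis using that unfolding A_def k by (simp add: coprime_dvd_mult_right_iff)
    qed
    then show "(\<lambda>d. p * d) ` A \<subseteq> {d. d dvd n \<and> p dvd d}" by (auto simp: k)
    show "\<forall>d\<in>{d. d dvd n \<and> p dvd d} - (\<lambda>d. p * d) ` A. moebius_mu d = 0"
    proof
      fix d assume d: "d \<in> {d. d dvd n \<and> p dvd d} - (\<lambda>d. p * d) ` A"
      then obtain e where e: "d = p * e" by blast
      have "e dvd n" using d e by (metis DiffD1 dvd_mult_right mem_Collect_eq)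
      then have "p dvd e" using d e by (auto simp: A_def)
      then have "\<not> coprime p e" using p(1) by (metis coprime_absorb_left not_prime_unit)
      then show "moebius_mu d = 0" using moebius_mu_mult[OF p0 pos[OF \<open>e dvd n\<close>]] e by simp
    qed
  qed
  also have "\<dots> = (\<Sum>d\<in>A. moebius_mu (p * d))"
    using p0 by (subst sum.reindex) (auto simp: inj_on_def)
  also have "\<dots> = (\<Sum>d\<in>A. - moebius_mu d)"
  proof (rule sum.cong)
    fix d assume d: "d \<in> A"
    then have "coprime p d" using p(1) by (simp add: A_def prime_imp_coprime)
    then show "moebius_mu (p * d) = - moebius_mu d"
      using moebius_mu_mult[OF p0, of d] pos d moebius_mu_prime[OF p(1)] by (simp add: A_def)
  qed simp
  finally show ?thesis using False by (simp add: sum_negf)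
qed

section \<open>Dirichlet characters\<close>

locale dirichlet_char =
  fixes q :: nat and ch :: "nat \<Rightarrow> complex"
  assumes modulus_pos: "q > 0"
    and mult: "ch (a * b) = ch a * ch b"
    and periodic: "ch (n + q) = ch n"
    and norm_coprime: "coprime n q \<Longrightarrow> norm (ch n) = 1"
    and zero: "\<not> coprime n q \<Longrightarrow> ch n = 0"
begin

lemma one: "ch 1 = 1"
proof -
  have "ch 1 \<noteq> 0" using norm_coprime[of 1] by auto
  then show ?thesis using mult[of 1 1] by simp
qed

lemma norm_le: "norm (ch n) \<le> 1"
  using norm_coprime zero by (cases "coprime n q") auto

lemma mod_eq: "ch (n mod q) = ch n"
  using periodic_mod[of ch q] periodic by blast

text \<open>Complete multiplicativity pulls \<open>ch n\<close> out of the convolution and leaves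
  the divisor sum of \<mu>, the unit of convolution.\<close>

lemma moebius_inverse:
  assumes s: "Re s > 1" and A: "dirichlet_sums ch s A" and B: "dirichlet_sums (\<lambda>n. of_int (moebius_mu n) * ch n) s B"
  shows "B * A = 1"
proof -
  let ?f = "dirichlet_conv (\<lambda>n. of_int (moebius_mu n) * ch n) ch"
  have f: "?f n = (if n = 1 then 1 else 0)" if "n > 0" for n
  proof -
    have "of_int (moebius_mu d) * ch d * ch (n div d) = ch n * of_int (moebius_mu d)" if "d dvd n" for d
      using that mult[of d "n div d"] by (simp add: mult_ac)
    then have "?f n = (\<Sum>d | d dvd n. ch n * of_int (moebius_mu d))"
      unfolding dirichlet_conv_def by (intro sum.cong) auto
    also have "\<dots> = ch n * of_int (\<Sum>d | d dvd n. moebius_mu d)" by (simp add: sum_distrib_left)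
    finally show ?thesis using sum_moebius_mu_divisors[OF that] one by simp
  qed
  have "(\<lambda>n. ?f n * of_nat n powr (-s)) sums (B * A)"
    using dirichlet_sums_conv[OF B A] unfolding dirichlet_sums_def by blast
  moreover have "(\<lambda>n. ?f n * of_nat n powr (-s)) = (\<lambda>n. if n = 1 then 1 else 0)"
  proof
    fix n show "?f n * of_nat n powr (-s) = (if n = 1 then 1 else 0)"
      by (cases "n = 0") (use f[of n] in auto)
  qed
  ultimately have "(\<lambda>n. if n = 1 then 1 else 0) sums (B * A)" by simp
  moreover have "(\<lambda>n. if n = 1 then 1 else 0 :: complex) sums 1" using sums_single[of 1 "\<lambda>_. 1 :: complex"] by simp
  ultimately show ?thesis by (rule sums_unique2)
qed

lemma norm_moebius_le: "norm (of_int (moebius_mu n) * ch n) \<le> 1"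
proof -
  have "norm (of_int (moebius_mu n) :: complex) \<le> 1" using abs_moebius_mu_le[of n] by simp
  then show ?thesis unfolding norm_mult using norm_le[of n] by (intro mult_le_one) auto
qed

lemma L_nonzero:
  assumes s: "Re s > 1" and A: "dirichlet_sums ch s A"
  shows "A \<noteq> 0"
proof -
  obtain B where "dirichlet_sums (\<lambda>n. of_int (moebius_mu n) * ch n) s B"
    by (rule dirichlet_sums_bounded[OF norm_moebius_le s])
  then show ?thesis using moebius_inverse[OF s A] by auto
qed

text \<open>Multiplication by \<open>a\<close> permutes the residues, so the sum is invariant under
  multiplication by \<open>ch a\<close>.\<close>

lemma sum_period:
  assumes "coprime a q" "ch a \<noteq> 1"
  shows "(\<Sum>n<q. ch n) = 0"
proof -
  have inj: "inj_on (\<lambda>n. (a * n) mod q) {..<q}"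
  proof (rule inj_onI)
    fix x y assume xy: "x \<in> {..<q}" "y \<in> {..<q}" "(a * x) mod q = (a * y) mod q"
    then have "[a * x = a * y] (mod q)" by (simp add: cong_def)
    then have "[x = y] (mod q)" using assms(1) by (simp add: cong_mult_lcancel_nat)
    then show "x = y" using xy by (simp add: cong_def)
  qed
  have im: "(\<lambda>n. (a * n) mod q) ` {..<q} = {..<q}"
    by (rule card_subset_eq) (use modulus_pos card_image[OF inj] in auto)
  have "(\<Sum>n<q. ch n) = (\<Sum>n<q. ch ((a * n) mod q))"
    using sum.reindex[OF inj, of ch] im by (simp add: o_def)
  also have "\<dots> = ch a * (\<Sum>n<q. ch n)" unfolding mod_eq mult sum_distrib_left ..
  finally show ?thesis using assms(2) by simp
qed

end

lemma dirichlet_char_principal: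
  assumes "q > 0"
  shows "dirichlet_char q (\<lambda>n. if coprime n q then 1 else 0)"
proof
  have "coprime (n + q) q \<longleftrightarrow> coprime n q" for n
    using gcd_add1[of n q] by (simp only: coprime_iff_gcd_eq_1)
  then show "(if coprime (n + q) q then 1 else 0) = (if coprime n q then 1 else 0 :: complex)" for n by simp
qed (use assms in auto)

section \<open>Landau's theorem\<close>

lemma higher_deriv_exp_sum:
  fixes c l :: "nat \<Rightarrow> complex"
  assumes "finite A"
  shows "(deriv ^^ k) (\<lambda>s. \<Sum>n\<in>A. c n * exp (- s * l n)) = (\<lambda>s. \<Sum>n\<in>A. c n * (- l n) ^ k * exp (- s * l n))"
proof (induction k)
  case (Suc k)
  have "deriv (\<lambda>s. \<Sum>n\<in>A. c n * (- l n) ^ k * exp (- s * l n)) s = (\<Sum>n\<in>A. c n * (- l n) ^ Suc k * exp (- s * l n))" for s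
  proof (rule DERIV_imp_deriv)
    show "((\<lambda>s. \<Sum>n\<in>A. c n * (- l n) ^ k * exp (- s * l n)) has_field_derivative
        (\<Sum>n\<in>A. c n * (- l n) ^ Suc k * exp (- s * l n))) (at s)"
      by (rule derivative_eq_intros refl | simp add: mult_ac)+
  qed
  then show ?case using Suc by auto
qed simp

text \<open>Landau's argument: all Taylor coefficients at \<open>2\<close> of \<open>F\<close> minus a partial sum have the sign of
  \<open>(-1) ^ k\<close>, so that this difference is nonnegative on the real segment to the left of \<open>2\<close>.\<close>

lemma landau_partial_sum_le:
  fixes b :: "nat \<Rightarrow> real"
  assumes b: "\<And>n. n > 0 \<Longrightarrow> b n \<ge> 0" and F: "F holomorphic_on right_half_plane"
    and sums: "\<And>s. Re s > 1 \<Longrightarrow> dirichlet_sums (\<lambda>n. of_real (b n)) s (F s)"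
    and x: "0 < x" "x < 2"
  shows "(\<Sum>n=1..<N. b n * real n powr (-x)) \<le> Re (F (of_real x))"
proof -
  define P where "P N s = (\<Sum>n=1..<N. of_real (b n) * exp (- s * of_real (ln (real n))))" for N and s :: complex
  have powr_exp: "of_nat n powr (-s) = exp (- s * of_real (ln (real n)))" if "n > 0" for n and s :: complex
    using that Ln_of_real[of "real n"] by (simp add: powr_def)
  have P_eq: "P M s = (\<Sum>n<M. of_real (b n) * of_nat n powr (-s))" for M s
  proof -
    have "(\<Sum>n<M. of_real (b n) * of_nat n powr (-s)) = (\<Sum>n=1..<M. of_real (b n) * of_nat n powr (-s))"
      by (rule sum.mono_neutral_right) (auto simp: not_le)
    also have "\<dots> = P M s" unfolding P_def by (intro sum.cong refl) (use powr_exp in auto)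
    finally show ?thesis by simp
  qed
  have ulim: "uniform_limit (ball 2 (1/2)) P F sequentially"
  proof -
    have Re: "Re s \<ge> 3/2" if "s \<in> ball 2 (1/2)" for s
      using that complex_Re_le_cmod[of "2 - s"] by (simp add: dist_norm)
    have "uniform_limit (ball (2 :: complex) (1/2)) (\<lambda>M s. \<Sum>n<M. of_real (b n) * of_nat n powr (-s))
        (\<lambda>s. \<Sum>n. of_real (b n) * of_nat n powr (-s)) sequentially"
    proof (rule Weierstrass_m_test[where M = "\<lambda>n. norm (of_real (b n) * of_nat n powr (- (3/2)) :: complex)"])
      show "summable (\<lambda>n. norm (of_real (b n) * of_nat n powr (- (3/2)) :: complex))"
        using sums[of "3/2"] unfolding dirichlet_sums_def by simp
      fix n and s :: complex assume "s \<in> ball 2 (1/2)"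
      then have "real n powr (- Re s) \<le> real n powr (- (3/2))"
        using Re by (cases "n = 0") (auto intro!: powr_mono)
      then show "norm (of_real (b n) * of_nat n powr (-s)) \<le> norm (of_real (b n) * of_nat n powr (- (3/2)) :: complex)"
        by (simp add: norm_mult norm_nat_powr mult_left_mono)
    qed
    moreover have "(\<Sum>n. of_real (b n) * of_nat n powr (-s)) = F s" if "s \<in> ball 2 (1/2)" for s
      using sums[of s] Re[OF that] unfolding dirichlet_sums_def by (auto simp: sums_iff)
    ultimately show ?thesis unfolding P_eq by (subst uniform_limit_cong'[OF refl, symmetric]) auto
  qed
  define D where "D M s = P M s - P N s" for M s
  define R where "R s = F s - P N s" for s
  have PU: "P M holomorphic_on A" for M A unfolding P_def by (intro holomorphic_intros)
  \<comment> \<open>The disc of radius 2 about 2 reaches down to 0, so the Taylor series at 2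
    represents R at every real x in (0, 2), in particular left of 1, where convergence of the
    Dirichlet series is not assumed.\<close>
  have Rh: "R holomorphic_on ball 2 2"
  proof -
    have "ball 2 2 \<subseteq> right_half_plane"
    proof
      fix s :: complex assume "s \<in> ball 2 2"
      then show "s \<in> right_half_plane" using complex_Re_le_cmod[of "2 - s"] by (simp add: dist_norm)
    qed
    then show ?thesis unfolding R_def by (intro holomorphic_intros PU holomorphic_on_subset[OF F])
  qed
  have lim: "(\<lambda>M. (deriv ^^ k) (D M) 2) \<longlonglongrightarrow> (deriv ^^ k) R 2" for k
  proof (rule higher_deriv_complex_uniform_limit)
    show "uniform_limit (ball 2 (1/2)) D R sequentially"
      unfolding D_def R_def by (intro uniform_limit_intros ulim)
    show "\<forall>\<^sub>F M in sequentially. D M holomorphic_on ball 2 (1/2)"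
      unfolding D_def by (intro always_eventually allI holomorphic_intros PU)
  qed auto
  have term_nonneg: "Re ((deriv ^^ k) R 2 / fact k * (of_real x - 2) ^ k) \<ge> 0" for k
  proof (rule LIMSEQ_le_const)
    show "(\<lambda>M. Re ((deriv ^^ k) (D M) 2 / fact k * (of_real x - 2) ^ k)) \<longlonglongrightarrow> Re ((deriv ^^ k) R 2 / fact k * (of_real x - 2) ^ k)"
      by (intro tendsto_intros lim) auto
    have "0 \<le> Re ((deriv ^^ k) (D M) 2 / fact k * (of_real x - 2) ^ k)" if "M \<ge> N" for M
    proof -
      let ?A = "{1..<M} - {1..<N}"
      have "D M = (\<lambda>s. \<Sum>n\<in>?A. of_real (b n) * exp (- s * of_real (ln (real n))))"
        unfolding D_def P_def using that by (subst sum_diff) auto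
      then have "(deriv ^^ k) (D M) 2 = (\<Sum>n\<in>?A. of_real (b n) * (- of_real (ln (real n))) ^ k * exp (- 2 * of_real (ln (real n))))"
        using higher_deriv_exp_sum[of ?A k "\<lambda>n. of_real (b n)" "\<lambda>n. of_real (ln (real n))"] by simp
      also have "\<dots> = of_real (\<Sum>n\<in>?A. b n * (- ln (real n)) ^ k * exp (- 2 * ln (real n)))"
        by (simp flip: exp_of_real)
      finally have "(deriv ^^ k) (D M) 2 / fact k * (of_real x - 2) ^ k =
          of_real ((\<Sum>n\<in>?A. b n * (- ln (real n)) ^ k * exp (- 2 * ln (real n))) / fact k * (x - 2) ^ k)"
        by simp
      also have "(\<Sum>n\<in>?A. b n * (- ln (real n)) ^ k * exp (- 2 * ln (real n))) / fact k * (x - 2) ^ k =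
          (\<Sum>n\<in>?A. b n * (ln (real n) * (2 - x)) ^ k * exp (- 2 * ln (real n))) / fact k"
      proof -
        have e: "(- ln (real n)) ^ k * (x - 2) ^ k = (ln (real n) * (2 - x)) ^ k" for n
          by (simp add: power_mult_distrib[symmetric] algebra_simps)
        have "(\<Sum>n\<in>?A. b n * (- ln (real n)) ^ k * exp (- 2 * ln (real n))) * (x - 2) ^ k =
            (\<Sum>n\<in>?A. b n * (ln (real n) * (2 - x)) ^ k * exp (- 2 * ln (real n)))"
          unfolding sum_distrib_right e[symmetric] by (rule sum.cong[OF refl]) (simp only: mult_ac)
        from this[symmetric] show ?thesis by (simp only: times_divide_eq_left)
      qed
      also have "Re (of_real \<dots>) \<ge> 0"
        unfolding Re_complex_of_real using b x by (intro divide_nonneg_pos sum_nonneg mult_nonneg_nonneg) auto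
      finally show ?thesis .
    qed
    then show "\<exists>M0. \<forall>M\<ge>M0. 0 \<le> Re ((deriv ^^ k) (D M) 2 / fact k * (of_real x - 2) ^ k)" by blast
  qed
  have "norm (2 - of_real x :: complex) = \<bar>2 - x\<bar>"
    by (metis norm_of_real of_real_diff of_real_numeral)
  then have "of_real x \<in> ball (2 :: complex) 2" using x by (simp add: dist_norm)
  then have "(\<lambda>k. (deriv ^^ k) R 2 / fact k * (of_real x - 2) ^ k) sums R (of_real x)"
    by (rule holomorphic_power_series[OF Rh])
  then have "(\<lambda>k. Re ((deriv ^^ k) R 2 / fact k * (of_real x - 2) ^ k)) sums Re (R (of_real x))"
    by (rule sums_Re)
  then have "Re (R (of_real x)) \<ge> 0"
    by (rule sums_le[OF term_nonneg sums_zero])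
  moreover have "P N (of_real x) = of_real (\<Sum>n=1..<N. b n * real n powr (-x))"
    unfolding P_def of_real_sum
  proof (rule sum.cong[OF refl])
    fix n assume "n \<in> {1..<N}"
    then have "real n powr (-x) = exp (- x * ln (real n))" by (simp add: powr_def)
    then show "of_real (b n) * exp (- of_real x * of_real (ln (real n))) = complex_of_real (b n * real n powr (-x))"
      by (simp add: exp_of_real[symmetric])
  qed
  ultimately show ?thesis unfolding R_def by simp
qed

section \<open>Nonvanishing on the line of real part one\<close>

text \<open>This is Ramanujan's product formula for squares of divisor sums, with the denominator, a
  function of 2s, moved to the other side as the sum over m. A factorisation n = x y a b corresponds
  to (m, A, B) with m = gcd a b, A = y a / m and B = y b / m. The weights agree because \<alpha> has
  modulus 1 on numbers prime to q.\<close>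

lemma dirichlet_conv_twisted_square:
  fixes \<alpha> :: "nat \<Rightarrow> complex" and q :: nat
  defines "u \<equiv> \<lambda>n. if coprime n q then 1 else 0 :: complex"
  assumes \<alpha>: "\<And>a b. \<alpha> (a * b) = \<alpha> a * \<alpha> b" "\<And>n. \<lbrakk>coprime n q; n > 0\<rbrakk> \<Longrightarrow> norm (\<alpha> n) = 1"
      "\<And>n. \<not> coprime n q \<Longrightarrow> \<alpha> n = 0"
    and n: "n > 0"
  shows "dirichlet_conv u (dirichlet_conv u (dirichlet_conv \<alpha> (\<lambda>n. cnj (\<alpha> n)))) n =
    of_real (if coprime n q then \<Sum>m | m\<^sup>2 dvd n. (norm (\<Sum>d | d dvd n div m\<^sup>2. \<alpha> d))\<^sup>2 else 0)"
proof -
  have pos: "k > 0" if "k dvd n" for k using that n by (metis dvd_0_left gr0I less_irrefl)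
  define S where "S = (SIGMA x:{x. x dvd n}. SIGMA y:{y. y dvd n div x}. {a. a dvd n div x div y})"
  have S_iff: "(x, y, a) \<in> S \<longleftrightarrow> (\<exists>b. n = x * y * a * b)" for x y a
  proof
    assume "(x, y, a) \<in> S"
    then have "x dvd n" "y dvd n div x" "a dvd n div x div y" by (auto simp: S_def)
    then obtain b1 b2 b3 where b: "n = x * b1" "n div x = y * b2" "n div x div y = a * b3" by (meson dvdE)
    have "x > 0" using pos b(1) by simp
    then have "b1 = y * b2" using b(1,2) by simp
    then have "y > 0" using pos b(1) n by (auto intro!: Nat.gr0I)
    then have "b2 = a * b3" using b(2,3) by simp
    then show "\<exists>b. n = x * y * a * b" using b(1) \<open>b1 = y * b2\<close> by (auto simp: mult_ac)
  next
    assume "\<exists>b. n = x * y * a * b"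
    then obtain b where b: "n = x * y * a * b" by blast
    then have "x > 0" "y > 0" using n by (auto intro!: Nat.gr0I)
    then have "n div x = y * (a * b)" "n div x div y = a * b" using b by (simp_all add: mult.assoc)
    then show "(x, y, a) \<in> S" using b by (auto simp: S_def)
  qed
  define w where "w = (\<lambda>(x, y, a). u x * (u y * (\<alpha> a * cnj (\<alpha> (n div x div y div a)))))"
  have fin: "finite {k. k dvd m}" if "m dvd n" for m using pos[OF that] by simp
  have dvdiv: "k div y dvd k" if "y dvd k" for y k :: nat using that by (metis dvd_mult_div_cancel dvd_triv_right)
  have dv: "n div x dvd n" if "x dvd n" for x using dvdiv[OF that] .
  have lhs: "dirichlet_conv u (dirichlet_conv u (dirichlet_conv \<alpha> (\<lambda>n. cnj (\<alpha> n)))) n = sum w S"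
  proof -
    have "dirichlet_conv u (dirichlet_conv u (dirichlet_conv \<alpha> (\<lambda>n. cnj (\<alpha> n)))) n =
      (\<Sum>x | x dvd n. \<Sum>y | y dvd n div x. \<Sum>a | a dvd n div x div y. w (x, y, a))"
      unfolding dirichlet_conv_def w_def by (simp add: sum_distrib_left)
    also have "\<dots> = (\<Sum>x | x dvd n. \<Sum>(y, a)\<in>(SIGMA y:{y. y dvd n div x}. {a. a dvd n div x div y}). w (x, y, a))"
    proof (rule sum.cong[OF refl])
      fix x assume x: "x \<in> {x. x dvd n}"
      have "n div x div y dvd n" if "y dvd n div x" for y
        using dvd_trans[OF dvdiv[OF that] dv] x by simp
      then show "(\<Sum>y | y dvd n div x. \<Sum>a | a dvd n div x div y. w (x, y, a)) =
        (\<Sum>(y, a)\<in>(SIGMA y:{y. y dvd n div x}. {a. a dvd n div x div y}). w (x, y, a))"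
        using fin dv x by (intro sum.Sigma) auto
    qed
    also have "\<dots> = sum w S"
    proof -
      have "finite (SIGMA y:{y. y dvd n div x}. {a. a dvd n div x div y})" if x: "x dvd n" for x
      proof (rule finite_subset)
        show "(SIGMA y:{y. y dvd n div x}. {a. a dvd n div x div y}) \<subseteq> {k. k dvd n} \<times> {k. k dvd n}"
        proof (clarsimp)
          fix y a assume ya: "y dvd n div x" "a dvd n div x div y"
          then have "(x, y, a) \<in> S" using x by (simp add: S_def)
          then obtain b where "n = x * y * a * b" using S_iff by blast
          then show "y dvd n \<and> a dvd n" by simp
        qed
      qed (use fin in auto)
      then show ?thesis unfolding S_def using fin[of n] by (subst sum.Sigma) (auto intro!: sum.cong)
    qed
    finally show ?thesis .
  qed
  show ?thesis
  proof (cases "coprime n q")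
    case False
    have "w p = 0" if p: "p \<in> S" for p
    proof -
      obtain x y a where xya: "p = (x, y, a)" by (cases p)
      then obtain b where b: "n = x * y * a * b" using p S_iff by blast
      then have "x > 0" "y > 0" "a > 0" using n by (auto intro!: Nat.gr0I)
      then have "n div x div y div a = b" using b by (simp add: mult.assoc)
      moreover have "\<not> coprime x q \<or> \<not> coprime y q \<or> \<not> coprime a q \<or> \<not> coprime b q"
        using False b by auto
      ultimately show ?thesis unfolding xya w_def u_def using \<alpha>(3) by auto
    qed
    then show ?thesis unfolding lhs using False by simp
  next
    case True
    have cop: "coprime k q" if "k dvd n" for k using that True by (meson coprime_divisors dvd_refl)
    define S' where "S' = (SIGMA m:{m. m\<^sup>2 dvd n}. {A. A dvd n div m\<^sup>2} \<times> {B. B dvd n div m\<^sup>2})"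
    define v where "v = (\<lambda>(m::nat, A, B). \<alpha> A * cnj (\<alpha> B))"
    \<comment> \<open>The inverse of j: c = gcd A B recovers y, then a and b are m (A / c) and m (B
      / c), and x is the complementary factor of n.\<close>
    define i where "i = (\<lambda>(m, A, B). let c = gcd A B in
      (n div (c * (m * (A div c)) * (m * (B div c))), c, m * (A div c)))"
    define j where "j = (\<lambda>(x, y, a). let b = n div x div y div a; g = gcd a b in (g, y * (a div g), y * (b div g)))"
    have j1: "j p \<in> S' \<and> i (j p) = p \<and> v (j p) = w p" if p: "p \<in> S" for p
    proof -
      obtain x y a where xya: "p = (x, y, a)" by (cases p)
      then obtain b where b: "n = x * y * a * b" using p S_iff by blast
      then have gt: "x > 0" "y > 0" "a > 0" "b > 0" using n by (auto intro!: Nat.gr0I)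
      then have nb: "n div x div y div a = b" using b by (simp add: mult.assoc)
      define g where "g = gcd a b"
      have g0: "g > 0" using gt by (simp add: g_def)
      have "g dvd a" "g dvd b" by (simp_all add: g_def)
      then obtain a' b' where ab: "a = g * a'" "b = g * b'" by (meson dvdE)
      have co: "coprime a' b'"
      proof -
        have "g * gcd a' b' = gcd a b" unfolding ab by (rule gcd_mult_distrib_nat)
        then have "g * gcd a' b' = g * 1" by (simp only: g_def mult_1_right)
        then show ?thesis using g0 by (simp only: coprime_iff_gcd_eq_1 mult_cancel1) simp
      qed
      have jp: "j p = (g, y * a', y * b')"
      proof -
        have "a div g = a'" "b div g = b'" using ab g0 by simp_all
        then show ?thesis unfolding xya j_def using nb by (simp add: Let_def g_def[symmetric])
      qed
      have nn: "n = g\<^sup>2 * (x * y * a' * b')" using b ab by (simp add: power2_eq_square mult_ac)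
      then have nd: "n div g\<^sup>2 = x * y * a' * b'" using g0 by simp
      have "j p \<in> S'" unfolding jp S'_def using nn nd by simp
      moreover have "i (j p) = p"
      proof -
        have gc: "gcd (y * a') (y * b') = y" using co gcd_mult_distrib_nat[of y a' b'] by simp
        have "n = x * (y * (g * a') * (g * b'))" using b ab by (simp add: mult_ac)
        moreover have "y * (g * a') * (g * b') > 0" using gt ab by simp
        ultimately have "n div (y * (g * a') * (g * b')) = x" by simp
        then have "i (g, y * a', y * b') = (x, y, a)" unfolding i_def using gt ab gc by (simp add: Let_def)
        then show ?thesis unfolding jp using xya by simp
      qed
      moreover have "v (j p) = w p"
      proof -
        have "x dvd n" "y dvd n" "g dvd n" unfolding b using \<open>g dvd a\<close> by simp_all
        then have c: "coprime x q" "coprime y q" "coprime g q" using cop by blast+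
        have n1: "\<alpha> k * cnj (\<alpha> k) = 1" if "coprime k q" "k > 0" for k
          using \<alpha>(2)[OF that] by (simp add: complex_norm_square[symmetric])
        have "v (j p) = (\<alpha> y * cnj (\<alpha> y)) * (\<alpha> a' * cnj (\<alpha> b'))" unfolding jp v_def by (simp add: \<alpha>(1) mult_ac)
        moreover have "w p = (\<alpha> g * cnj (\<alpha> g)) * (\<alpha> a' * cnj (\<alpha> b'))"
          unfolding xya w_def using nb c unfolding u_def by (simp add: ab \<alpha>(1) mult_ac)
        ultimately show ?thesis using n1 c gt g0 by simp
      qed
      ultimately show ?thesis by blast
    qed
    have i1: "i p \<in> S \<and> j (i p) = p" if p: "p \<in> S'" for p
    proof -
      obtain m A B where mAB: "p = (m, A, B)" by (cases p)
      then have "m\<^sup>2 dvd n" and AB: "A dvd n div m\<^sup>2" "B dvd n div m\<^sup>2" using p by (auto simp: S'_def)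
      then obtain k where k: "n = m\<^sup>2 * k" by (meson dvdE)
      have m0: "m > 0" "k > 0" using n k by (auto intro!: Nat.gr0I)
      then have ABk: "A dvd k" "B dvd k" using AB k by simp_all
      define c where "c = gcd A B"
      have "A > 0" "B > 0" using ABk m0 by (auto intro!: Nat.gr0I)
      then have c0: "c > 0" by (simp add: c_def)
      have "c dvd A" "c dvd B" by (simp_all add: c_def)
      then obtain A' B' where A': "A = c * A'" "B = c * B'" by (meson dvdE)
      have co: "coprime A' B'"
      proof -
        have "c * gcd A' B' = gcd A B" unfolding A' by (rule gcd_mult_distrib_nat)
        then have "c * gcd A' B' = c * 1" by (simp only: c_def mult_1_right)
        then show ?thesis using c0 by (simp only: coprime_iff_gcd_eq_1 mult_cancel1) simp
      qed
      have "c dvd k" using ABk(1) A' by (metis dvd_mult_left)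
      then obtain l where l: "k = c * l" by blast
      then have "A' dvd l" "B' dvd l" using ABk A' c0 by simp_all
      then have "A' * B' dvd l" using co by (simp add: divides_mult)
      then obtain x where x: "l = A' * B' * x" by blast
      have A0: "A' > 0" "B' > 0" using A' \<open>A > 0\<close> \<open>B > 0\<close> by (auto intro!: Nat.gr0I)
      have nn: "n = x * (c * (m * A') * (m * B'))" using k l x by (simp add: power2_eq_square mult_ac)
      have pp: "c * (m * A') * (m * B') > 0" using c0 m0 A0 by simp
      have "n div (c * (m * A') * (m * B')) = x" using nn pp by simp
      moreover have "A div c = A'" "B div c = B'" using A' c0 by simp_all
      ultimately have ip: "i p = (x, c, m * A')" unfolding mAB i_def by (simp add: Let_def c_def[symmetric])
      have nn2: "n = x * c * (m * A') * (m * B')" using nn by (simp add: mult_ac)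
      then have "i p \<in> S" unfolding ip S_iff by blast
      moreover have "j (i p) = p"
      proof -
        have "x > 0" using nn n by (auto intro!: Nat.gr0I)
        then have "n div x div c div (m * A') = m * B'" using nn2 c0 m0 A0 by (simp add: mult.assoc)
        moreover have "gcd (m * A') (m * B') = m" using co gcd_mult_distrib_nat[of m A' B'] by simp
        ultimately have "j (x, c, m * A') = (m, A, B)" unfolding j_def using m0 A' by (simp add: Let_def)
        then show ?thesis unfolding ip using mAB by simp
      qed
      ultimately show ?thesis by blast
    qed
    have "sum w S = sum v S'"
      by (rule sum.reindex_bij_witness[of _ i j]) (use i1 j1 in auto)
    also have "\<dots> = (\<Sum>m | m\<^sup>2 dvd n. \<Sum>p\<in>{A. A dvd n div m\<^sup>2} \<times> {B. B dvd n div m\<^sup>2}. v (m, p))"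
    proof -
      have fm: "finite {m. m\<^sup>2 dvd n}"
        by (rule finite_subset[OF _ fin[of n]]) (auto intro: dvd_trans simp: power2_eq_square)
      have fAB: "finite ({A. A dvd n div m\<^sup>2} \<times> {B. B dvd n div m\<^sup>2})" if "m\<^sup>2 dvd n" for m
        by (intro finite_cartesian_product fin[OF dvdiv[OF that]])
      show ?thesis unfolding S'_def using fm fAB by (subst sum.Sigma) (auto intro!: sum.cong)
    qed
    also have "\<dots> = (\<Sum>m | m\<^sup>2 dvd n. of_real ((norm (\<Sum>d | d dvd n div m\<^sup>2. \<alpha> d))\<^sup>2))"
    proof (rule sum.cong[OF refl])
      fix m
      have "(\<Sum>p\<in>{A. A dvd n div m\<^sup>2} \<times> {B. B dvd n div m\<^sup>2}. v (m, p)) =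
        (\<Sum>A | A dvd n div m\<^sup>2. \<Sum>B | B dvd n div m\<^sup>2. \<alpha> A * cnj (\<alpha> B))"
        unfolding v_def sum.cartesian_product by (intro sum.cong) auto
      also have "\<dots> = (\<Sum>d | d dvd n div m\<^sup>2. \<alpha> d) * cnj (\<Sum>d | d dvd n div m\<^sup>2. \<alpha> d)"
        by (simp add: sum_product)
      finally show "(\<Sum>p\<in>{A. A dvd n div m\<^sup>2} \<times> {B. B dvd n div m\<^sup>2}. v (m, p)) =
        of_real ((norm (\<Sum>d | d dvd n div m\<^sup>2. \<alpha> d))\<^sup>2)"
        by (simp only: complex_norm_square)
    qed
    finally show ?thesis unfolding lhs using True by simp
  qed
qed

text \<open>Compare with the harmonic series through j q + 1 \<le> (q + 1) (j + 1).\<close>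

lemma harmonic_progression_unbounded:
  assumes "q > (0::nat)"
  shows "\<exists>M. (\<Sum>j<M. 1 / real (j * q + 1)) > C"
proof (rule ccontr)
  assume no: "\<not> ?thesis"
  have "summable (\<lambda>j. 1 / real (j * q + 1))"
    by (rule summableI_nonneg_bounded[of _ C]) (use no in \<open>auto simp: not_less\<close>)
  then have s: "summable (\<lambda>j. real (q + 1) * (1 / real (j * q + 1)))" by (rule summable_mult)
  have "summable (\<lambda>j. 1 / real (Suc j))"
  proof (rule summable_comparison_test'[OF s, of 0])
    fix j
    have "1 / real (Suc j) = real (q + 1) / real ((q + 1) * Suc j)" unfolding of_nat_mult by simp
    also have "\<dots> \<le> real (q + 1) / real (j * q + 1)"
    proof (rule frac_le)
      show "real (j * q + 1) \<le> real ((q + 1) * Suc j)" unfolding of_nat_le_iff by simp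
      show "0 < real (j * q + 1)" unfolding of_nat_0_less_iff by simp
    qed simp_all
    finally have "1 / real (Suc j) \<le> real (q + 1) * (1 / real (j * q + 1))" by simp
    then show "norm (1 / real (Suc j)) \<le> real (q + 1) * (1 / real (j * q + 1))" by simp
  qed
  then show False using not_summable_harmonic[where 'a = real] summable_Suc_iff[of "\<lambda>n. inverse (real n)"]
    by (simp add: inverse_eq_divide)
qed

text \<open>At s = 1/2 the square of k contributes at least 1 / k, because m = k alone adds 1 to its
  coefficient. Over k congruent to 1 modulo q these contributions exceed every bound, in particular
  the value at 1/2 that Landau's argument imposes.\<close>

lemma twisted_square_not_entire:
  fixes \<alpha> :: "nat \<Rightarrow> complex" and q :: nat
  defines "u \<equiv> \<lambda>n. if coprime n q then 1 else 0 :: complex"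
  assumes q: "q > 0"
    and \<alpha>: "\<And>a b. \<alpha> (a * b) = \<alpha> a * \<alpha> b" "\<And>n. \<lbrakk>coprime n q; n > 0\<rbrakk> \<Longrightarrow> norm (\<alpha> n) = 1"
      "\<And>n. \<not> coprime n q \<Longrightarrow> \<alpha> n = 0"
    and F: "F holomorphic_on right_half_plane"
    and sums: "\<And>s. Re s > 1 \<Longrightarrow>
      dirichlet_sums (dirichlet_conv u (dirichlet_conv u (dirichlet_conv \<alpha> (\<lambda>n. cnj (\<alpha> n))))) s (F s)"
  shows False
proof -
  define b where "b n = (if coprime n q then \<Sum>m | m\<^sup>2 dvd n. (norm (\<Sum>d | d dvd n div m\<^sup>2. \<alpha> d))\<^sup>2 else 0)" for n
  have eq: "dirichlet_conv u (dirichlet_conv u (dirichlet_conv \<alpha> (\<lambda>n. cnj (\<alpha> n)))) n = of_real (b n)" if "n > 0" for n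
    unfolding b_def u_def using dirichlet_conv_twisted_square[OF \<alpha> that] .
  have bn: "b n \<ge> 0" for n by (auto simp: b_def intro: sum_nonneg)
  have sums': "dirichlet_sums (\<lambda>n. of_real (b n)) s (F s)" if "Re s > 1" for s
  proof -
    have "(\<lambda>n. dirichlet_conv u (dirichlet_conv u (dirichlet_conv \<alpha> (\<lambda>n. cnj (\<alpha> n)))) n * of_nat n powr (-s)) =
      (\<lambda>n. of_real (b n) * of_nat n powr (-s))"
    proof
      fix n
      show "dirichlet_conv u (dirichlet_conv u (dirichlet_conv \<alpha> (\<lambda>n. cnj (\<alpha> n)))) n * of_nat n powr (-s) =
        of_real (b n) * of_nat n powr (-s)" by (cases "n = 0") (use eq[of n] in auto)
    qed
    then show ?thesis using sums[OF that] unfolding dirichlet_sums_def by metis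
  qed
  have \<alpha>1: "\<alpha> 1 = 1"
  proof -
    have "\<alpha> 1 \<noteq> 0" using \<alpha>(2)[of 1] by auto
    then show ?thesis using \<alpha>(1)[of 1 1] by simp
  qed
  have b1: "b (k\<^sup>2) \<ge> 1" if k: "coprime k q" "k > 0" for k
  proof -
    have fin: "finite {m. m\<^sup>2 dvd k\<^sup>2}" using k by simp
    have "(norm (\<Sum>d | d dvd k\<^sup>2 div k\<^sup>2. \<alpha> d))\<^sup>2 \<le> (\<Sum>m | m\<^sup>2 dvd k\<^sup>2. (norm (\<Sum>d | d dvd k\<^sup>2 div m\<^sup>2. \<alpha> d))\<^sup>2)"
      by (rule member_le_sum) (use fin in auto)
    moreover have "k\<^sup>2 div k\<^sup>2 = 1" using k by simp
    moreover have "{d::nat. d dvd 1} = {1}" by auto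
    ultimately show ?thesis unfolding b_def using k \<alpha>1 by simp
  qed
  obtain M where M: "(\<Sum>j<M. 1 / real (j * q + 1)) > Re (F (of_real (1/2)))"
    using harmonic_progression_unbounded[OF q] by blast
  define h where "h j = (j * q + 1)\<^sup>2" for j
  have inj: "inj_on h {..<M}" using q by (auto simp: inj_on_def h_def power2_eq_iff_nonneg)
  have "(\<Sum>j<M. 1 / real (j * q + 1)) \<le> (\<Sum>j<M. b (h j) * real (h j) powr (-(1/2)))"
  proof (rule sum_mono)
    fix j
    have cop: "coprime (j * q + 1) q"
      using gcd_add_mult[of q j 1] by (simp only: coprime_iff_gcd_eq_1 gcd.commute[of _ q]) simp
    have "1 \<le> b (h j)" unfolding h_def by (rule b1[OF cop]) simp
    moreover have "real (h j) powr (-(1/2)) = 1 / real (j * q + 1)"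
    proof -
      have "sqrt (real (h j)) = real (j * q + 1)"
        unfolding h_def of_nat_power by (simp only: real_sqrt_abs abs_of_nat)
      then have "real (h j) powr (1/2) = real (j * q + 1)"
        using powr_half_sqrt[of "real (h j)"] by (simp only: of_nat_0_le_iff)
      then show ?thesis by (simp only: powr_minus inverse_eq_divide)
    qed
    ultimately show "1 / real (j * q + 1) \<le> b (h j) * real (h j) powr (-(1/2))"
      using mult_right_mono[of 1 "b (h j)" "1 / real (j * q + 1)"] by simp
  qed
  also have "\<dots> = (\<Sum>n\<in>h ` {..<M}. b n * real n powr (-(1/2)))"
    by (subst sum.reindex[OF inj]) simp
  also have "\<dots> \<le> (\<Sum>n=1..<Suc (h M). b n * real n powr (-(1/2)))"
  proof (rule sum_mono2)
    show "h ` {..<M} \<subseteq> {1..<Suc (h M)}"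
    proof
      fix n assume "n \<in> h ` {..<M}"
      then obtain j where j: "j < M" "n = h j" by blast
      have "h j \<le> h M" unfolding h_def using j(1) by (intro power_mono) auto
      moreover have "1 \<le> h j" unfolding h_def by simp
      ultimately show "n \<in> {1..<Suc (h M)}" using j(2) by simp
    qed
  qed (use bn in auto)
  also have "\<dots> \<le> Re (F (of_real (1/2)))"
    by (rule landau_partial_sum_le[OF bn F sums']) auto
  finally show False using M by simp
qed

section \<open>Removing zeros, shifting and reflecting\<close>

lemma holomorphic_factor:
  assumes "f holomorphic_on right_half_plane" "f a = 0"
  obtains g where "g holomorphic_on right_half_plane" "\<And>s. s \<noteq> a \<Longrightarrow> g s = f s / (s - a)"
proof
  show "(\<lambda>s. if s = a then deriv f a else (f s - f a) / (s - a)) holomorphic_on right_half_plane"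
    using pole_lemma_open[OF assms(1)] by (simp add: open_halfspace_Re_gt)
qed (use assms(2) in simp)

lemma holomorphic_shift_imaginary:
  assumes "f holomorphic_on right_half_plane"
  shows "(\<lambda>s. f (s + \<i> * of_real t)) holomorphic_on right_half_plane"
proof -
  have "(f \<circ> (\<lambda>s. s + \<i> * of_real t)) holomorphic_on right_half_plane"
    by (intro holomorphic_on_compose holomorphic_intros holomorphic_on_subset[OF assms]) auto
  then show ?thesis by (simp add: o_def)
qed

lemma holomorphic_reflect:
  assumes "f holomorphic_on right_half_plane"
  shows "(\<lambda>s. cnj (f (cnj s))) holomorphic_on right_half_plane"
proof -
  have "cnj ` right_half_plane = right_half_plane" by (force simp: image_iff intro: exI[of _ "cnj _"])
  then have "cnj \<circ> f \<circ> cnj holomorphic_on right_half_plane"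
    using holomorphic_on_compose_cnj_cnj[of f right_half_plane] assms by (simp add: open_halfspace_Re_gt)
  then show ?thesis by (simp add: o_def)
qed

lemma dirichlet_sums_twist:
  assumes "dirichlet_sums f (s + \<i> * of_real t) A"
  shows "dirichlet_sums (\<lambda>n. f n * of_nat n powr (- \<i> * of_real t)) s A"
proof -
  have e: "f n * of_nat n powr (- \<i> * of_real t) * of_nat n powr (-s) = f n * of_nat n powr (-(s + \<i> * of_real t))" for n
    by (cases "n = 0") (simp_all add: powr_add[symmetric] add.commute)
  show ?thesis using assms unfolding dirichlet_sums_def e .
qed

lemma dirichlet_sums_cnj:
  assumes "dirichlet_sums f (cnj s) A"
  shows "dirichlet_sums (\<lambda>n. cnj (f n)) s (cnj A)"
proof -
  have e: "cnj (f n) * of_nat n powr (-s) = cnj (f n * of_nat n powr (- cnj s))" for n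
    by (simp add: cnj_powr)
  show ?thesis using assms unfolding dirichlet_sums_def e complex_mod_cnj sums_cnj .
qed

context dirichlet_char
begin

text \<open>The condition n > 0 matters for q = 1, where 0 is coprime to q although its power
  vanishes.\<close>

lemma twist:
  fixes t :: real
  defines "\<alpha> \<equiv> \<lambda>n. ch n * of_nat n powr (- \<i> * of_real t)"
  shows "\<alpha> (a * b) = \<alpha> a * \<alpha> b" "coprime n q \<Longrightarrow> n > 0 \<Longrightarrow> norm (\<alpha> n) = 1" "\<not> coprime n q \<Longrightarrow> \<alpha> n = 0"
  using mult norm_coprime zero unfolding \<alpha>_def
  by (simp_all add: nat_powr_mult powr_times_real norm_mult norm_nat_powr)

end

lemma principal_continuation:
  fixes q :: nat
  assumes q: "q > 0"
  obtains A where "A holomorphic_on right_half_plane" "A 1 \<noteq> 0"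
    "\<And>s. Re s > 1 \<Longrightarrow> dirichlet_sums (\<lambda>n. if coprime n q then 1 else 0) s (A s / (s - 1))"
proof -
  let ?u = "\<lambda>n. if coprime n q then 1 else 0 :: complex"
  interpret u: dirichlet_char q ?u by (rule dirichlet_char_principal[OF q])
  obtain H where H: "H holomorphic_on right_half_plane"
    "\<And>s. Re s > 1 \<Longrightarrow> dirichlet_sums ?u s ((\<Sum>n<q. ?u n) / of_nat q / (s - 1) + H s)"
    using dirichlet_periodic_continuation[of q ?u, OF q u.periodic] by blast
  define c where "c = (\<Sum>n<q. ?u n) / of_nat q"
  have "(\<Sum>n<q. ?u n) = of_nat (card {n\<in>{..<q}. coprime n q})"
    by (simp add: sum.If_cases Int_def)
  moreover have "card {n\<in>{..<q}. coprime n q} \<noteq> 0"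
  proof
    assume "card {n\<in>{..<q}. coprime n q} = 0"
    moreover have "finite {n\<in>{..<q}. coprime n q}" by simp
    ultimately have "{n\<in>{..<q}. coprime n q} = {}" by (simp only: card_0_eq)
    \<comment> \<open>Writing \<open>1 mod q\<close> covers q = 1, where the only residue is 0 and
      is coprime to q.\<close>
    moreover have "1 mod q < q \<and> coprime (1 mod q) q" using q by (cases "q = 1") auto
    ultimately show False by blast
  qed
  ultimately have c: "c \<noteq> 0" using q by (simp add: c_def)
  show ?thesis
  proof (rule that[of "\<lambda>s. c + (s - 1) * H s"])
    show "(\<lambda>s. c + (s - 1) * H s) holomorphic_on right_half_plane" using H(1) by (intro holomorphic_intros)
    fix s :: complex assume s: "Re s > 1"
    then have "s \<noteq> 1" by auto
    then have "c / (s - 1) + H s = (c + (s - 1) * H s) / (s - 1)" by (simp add: field_simps)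
    then show "dirichlet_sums ?u s ((c + (s - 1) * H s) / (s - 1))" using H(2)[OF s] by (simp add: c_def)
  qed (use c in simp)
qed

context dirichlet_char
begin

lemma twisted_square_sums:
  fixes t :: real
  defines "\<alpha> \<equiv> \<lambda>n. ch n * of_nat n powr (- \<i> * of_real t)"
  assumes "dirichlet_sums (\<lambda>n. if coprime n q then 1 else 0) s U1" "dirichlet_sums (\<lambda>n. if coprime n q then 1 else 0) s U2"
    and L: "\<And>s. Re s > 1 \<Longrightarrow> dirichlet_sums ch s (L s)" and s: "Re s > 1"
  shows "dirichlet_sums (dirichlet_conv (\<lambda>n. if coprime n q then 1 else 0)
    (dirichlet_conv (\<lambda>n. if coprime n q then 1 else 0) (dirichlet_conv \<alpha> (\<lambda>n. cnj (\<alpha> n))))) s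
    (U1 * (U2 * (L (s + \<i> * of_real t) * cnj (L (cnj s + \<i> * of_real t)))))"
proof -
  have "dirichlet_sums \<alpha> s (L (s + \<i> * of_real t))" if "Re s > 1" for s
    unfolding \<alpha>_def using that by (intro dirichlet_sums_twist L) simp
  then show ?thesis using assms(2,3) s by (intro dirichlet_sums_conv dirichlet_sums_cnj) auto
qed

text \<open>\<open>U1\<close> and \<open>U2\<close> both represent the principal L-function. They
  are separate parameters so that they can be given different closed forms, each with a zero of its
  own to cancel.\<close>

lemma twisted_square_contradiction:
  assumes F: "F holomorphic_on right_half_plane"
    and sums: "\<And>s. Re s > 1 \<Longrightarrow> dirichlet_sums (\<lambda>n. if coprime n q then 1 else 0) s (U1 s)"
      "\<And>s. Re s > 1 \<Longrightarrow> dirichlet_sums (\<lambda>n. if coprime n q then 1 else 0) s (U2 s)"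
      "\<And>s. Re s > 1 \<Longrightarrow> dirichlet_sums ch s (L s)"
    and val: "\<And>s. Re s > 1 \<Longrightarrow> F s = U1 s * (U2 s * (L (s + \<i> * of_real t) * cnj (L (cnj s + \<i> * of_real t))))"
  shows False
proof (rule twisted_square_not_entire[OF modulus_pos twist(1) twist(2) twist(3) F])
  fix s :: complex assume s: "Re s > 1"
  show "dirichlet_sums (dirichlet_conv (\<lambda>n. if coprime n q then 1 else 0)
    (dirichlet_conv (\<lambda>n. if coprime n q then 1 else 0)
      (dirichlet_conv (\<lambda>n. ch n * of_nat n powr (- \<i> * of_real t)) (\<lambda>n. cnj (ch n * of_nat n powr (- \<i> * of_real t)))))) s (F s)"
    unfolding val[OF s] by (rule twisted_square_sums[OF sums(1)[OF s] sums(2)[OF s] sums(3) s])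
qed

text \<open>A zero of H at 1 + it makes both H(s + it) and its reflection vanish at s = 1, and these
  two zeros absorb the double pole of the two principal factors.\<close>

lemma nonprincipal_nonvanishing:
  assumes H: "H holomorphic_on right_half_plane" "\<And>s. Re s > 1 \<Longrightarrow> dirichlet_sums ch s (H s)"
  shows "H (1 + \<i> * of_real t) \<noteq> 0"
proof
  assume H0: "H (1 + \<i> * of_real t) = 0"
  obtain A where A: "A holomorphic_on right_half_plane"
    "\<And>s. Re s > 1 \<Longrightarrow> dirichlet_sums (\<lambda>n. if coprime n q then 1 else 0) s (A s / (s - 1))"
    using principal_continuation[OF modulus_pos] by metis
  define f where "f s = H (s + \<i> * of_real t)" for s
  have f: "f holomorphic_on right_half_plane" "f 1 = 0"
    unfolding f_def using holomorphic_shift_imaginary[OF H(1)] H0 by simp_all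
  obtain B1 where B1: "B1 holomorphic_on right_half_plane" "\<And>s. s \<noteq> 1 \<Longrightarrow> B1 s = f s / (s - 1)"
    using holomorphic_factor[OF f] by metis
  have "cnj (f (cnj 1)) = 0" using f(2) by simp
  then obtain B2 where B2: "B2 holomorphic_on right_half_plane" "\<And>s. s \<noteq> 1 \<Longrightarrow> B2 s = cnj (f (cnj s)) / (s - 1)"
    using holomorphic_factor[OF holomorphic_reflect[OF f(1)]] by metis
  show False
  proof (rule twisted_square_contradiction[where F = "\<lambda>s. A s * A s * (B1 s * B2 s)" and L = H and t = t])
    show "(\<lambda>s. A s * A s * (B1 s * B2 s)) holomorphic_on right_half_plane"
      by (intro holomorphic_intros A B1 B2)
    fix s :: complex assume "Re s > 1"
    then have "s \<noteq> 1" by auto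
    then show "A s * A s * (B1 s * B2 s) =
      A s / (s - 1) * (A s / (s - 1) * (H (s + \<i> * of_real t) * cnj (H (cnj s + \<i> * of_real t))))"
      using B1(2) B2(2) by (simp add: f_def)
  qed (use A(2) H(2) in auto)
qed

end

text \<open>Here the twisted factors bring poles of their own, at 1 - it and 1 + it. These are
  absorbed by the zeros of A2 and A at the same points, the double pole at 1 by the zeros of the
  shifted functions; hence the four quotients.\<close>

lemma principal_nonvanishing:
  assumes q: "q > 0" and A: "A holomorphic_on right_half_plane"
    "\<And>s. Re s > 1 \<Longrightarrow> dirichlet_sums (\<lambda>n. if coprime n q then 1 else 0) s (A s / (s - 1))"
  shows "A (1 + \<i> * of_real t) \<noteq> 0"
proof
  assume A0: "A (1 + \<i> * of_real t) = 0"
  interpret dirichlet_char q "\<lambda>n. if coprime n q then 1 else 0" by (rule dirichlet_char_principal[OF q])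
  define A2 where "A2 s = cnj (A (cnj s))" for s
  have A2h: "A2 holomorphic_on right_half_plane" "A2 (1 - \<i> * of_real t) = 0"
    unfolding A2_def using holomorphic_reflect[OF A(1)] A0 by simp_all
  have A2: "dirichlet_sums (\<lambda>n. if coprime n q then 1 else 0) s (A2 s / (s - 1))" if s: "Re s > 1" for s
  proof -
    have "dirichlet_sums (\<lambda>n. cnj (if coprime n q then 1 else 0)) s (cnj (A (cnj s) / (cnj s - 1)))"
      by (rule dirichlet_sums_cnj[OF A(2)]) (use s in simp)
    moreover have "(\<lambda>n. cnj (if coprime n q then 1 else 0)) = (\<lambda>n. if coprime n q then 1 else 0)" by auto
    ultimately show ?thesis by (simp add: A2_def)
  qed
  define f where "f s = A (s + \<i> * of_real t)" for s
  have f: "f holomorphic_on right_half_plane" "f 1 = 0"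
    unfolding f_def using holomorphic_shift_imaginary[OF A(1)] A0 by simp_all
  obtain Q1 where Q1: "Q1 holomorphic_on right_half_plane"
    "\<And>s. s \<noteq> 1 + \<i> * of_real t \<Longrightarrow> Q1 s = A s / (s - (1 + \<i> * of_real t))"
    using holomorphic_factor[OF A(1) A0] by metis
  obtain Q2 where Q2: "Q2 holomorphic_on right_half_plane"
    "\<And>s. s \<noteq> 1 - \<i> * of_real t \<Longrightarrow> Q2 s = A2 s / (s - (1 - \<i> * of_real t))"
    using holomorphic_factor[OF A2h] by metis
  obtain Q3 where Q3: "Q3 holomorphic_on right_half_plane" "\<And>s. s \<noteq> 1 \<Longrightarrow> Q3 s = f s / (s - 1)"
    using holomorphic_factor[OF f] by metis
  have "cnj (f (cnj 1)) = 0" using f(2) by simp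
  then obtain Q4 where Q4: "Q4 holomorphic_on right_half_plane" "\<And>s. s \<noteq> 1 \<Longrightarrow> Q4 s = cnj (f (cnj s)) / (s - 1)"
    using holomorphic_factor[OF holomorphic_reflect[OF f(1)]] by metis
  show False
  proof (rule twisted_square_contradiction[where F = "\<lambda>s. Q1 s * Q2 s * (Q3 s * Q4 s)" and L = "\<lambda>s. A s / (s - 1)" and t = t])
    show "(\<lambda>s. Q1 s * Q2 s * (Q3 s * Q4 s)) holomorphic_on right_half_plane"
      by (intro holomorphic_intros Q1 Q2 Q3 Q4)
    fix s :: complex assume s: "Re s > 1"
    then have ne: "s \<noteq> 1" "s \<noteq> 1 + \<i> * of_real t" "s \<noteq> 1 - \<i> * of_real t" by auto
    have "cnj (A (cnj s + \<i> * of_real t) / (cnj s + \<i> * of_real t - 1)) = cnj (f (cnj s)) / (s - (1 + \<i> * of_real t))"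
      by (simp add: f_def algebra_simps)
    moreover have "A (s + \<i> * of_real t) / (s + \<i> * of_real t - 1) = f s / (s - (1 - \<i> * of_real t))"
      by (simp add: f_def algebra_simps)
    ultimately show "Q1 s * Q2 s * (Q3 s * Q4 s) =
      A s / (s - 1) * (A2 s / (s - 1) * (A (s + \<i> * of_real t) / (s + \<i> * of_real t - 1) *
        cnj (A (cnj s + \<i> * of_real t) / (cnj s + \<i> * of_real t - 1))))"
      using Q1(2) Q2(2) Q3(2) Q4(2) ne by (simp add: mult_ac)
  qed (use A(2) A2 in auto)
qed

section \<open>Convergence of the Moebius series of a character\<close>

context dirichlet_char
begin

text \<open>Writing L = G / E, with E equal to 1 or to s - 1, treats both kinds of character at
  once: 1 / L becomes E / G, which is holomorphic wherever G does not vanish, including at the pole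
  of L.\<close>

lemma moebius_tauberian:
  assumes G: "G holomorphic_on right_half_plane" "E holomorphic_on UNIV"
    and nz: "\<And>s. Re s \<ge> 1 \<Longrightarrow> G s \<noteq> 0" "\<And>s. Re s > 1 \<Longrightarrow> E s \<noteq> 0"
    and L: "\<And>s. Re s > 1 \<Longrightarrow> dirichlet_sums ch s (G s / E s)"
  shows "convergent (\<lambda>N. \<Sum>n=1..N. of_int (moebius_mu n) * ch n / of_nat n)"
proof -
  define \<Omega> where "\<Omega> = right_half_plane \<inter> G -` (- {0})"
  have o: "open \<Omega>" unfolding \<Omega>_def
    by (intro continuous_open_preimage holomorphic_on_imp_continuous_on G open_halfspace_Re_gt) auto
  have sub: "\<Omega> \<subseteq> right_half_plane" by (auto simp: \<Omega>_def)
  have "(\<lambda>N. \<Sum>n=1..N. of_int (moebius_mu n) * ch n / of_nat n) \<longlonglongrightarrow> E 1 / G 1"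
  proof (rule newman_tauberian[OF norm_moebius_le o])
    show "s \<in> \<Omega>" if "Re s \<ge> 1" for s using that nz(1) by (auto simp: \<Omega>_def)
    show "(\<lambda>s. E s / G s) holomorphic_on \<Omega>"
      by (intro holomorphic_intros holomorphic_on_subset[OF G(1) sub] holomorphic_on_subset[OF G(2)]) (auto simp: \<Omega>_def)
    fix s :: complex assume s: "Re s > 1"
    obtain B where B: "dirichlet_sums (\<lambda>n. of_int (moebius_mu n) * ch n) s B"
      by (rule dirichlet_sums_bounded[OF norm_moebius_le s])
    have "B * (G s / E s) = 1" by (rule moebius_inverse[OF s L[OF s] B])
    then have "B = E s / G s" using nz(1)[of s] nz(2)[of s] s by (simp add: field_simps)
    then show "(\<lambda>n. of_int (moebius_mu n) * ch n * of_nat n powr (-s)) sums (E s / G s)"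
      using B unfolding dirichlet_sums_def by simp
  qed
  then show ?thesis by (auto simp: convergent_def)
qed

lemma moebius_series_convergent:
  "convergent (\<lambda>N. \<Sum>n=1..N. of_int (moebius_mu n) * ch n / of_nat n)"
proof (cases "\<exists>a. coprime a q \<and> ch a \<noteq> 1")
  case True
  then have "(\<Sum>n<q. ch n) = 0" using sum_period by blast
  then obtain H where H: "H holomorphic_on right_half_plane" "\<And>s. Re s > 1 \<Longrightarrow> dirichlet_sums ch s (H s)"
    using dirichlet_periodic_continuation[of q ch, OF modulus_pos periodic] by auto
  show ?thesis
  proof (rule moebius_tauberian[OF H(1), of "\<lambda>_. 1"])
    fix s :: complex assume "Re s \<ge> 1"
    show "H s \<noteq> 0"
    proof (cases "Re s = 1")
      case True
      then have "s = 1 + \<i> * of_real (Im s)" by (simp add: complex_eq_iff)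
      then show ?thesis using nonprincipal_nonvanishing[OF H] by metis
    next
      case False
      then show ?thesis using \<open>Re s \<ge> 1\<close> L_nonzero[OF _ H(2), of s] by simp
    qed
  qed (use H(2) in auto)
next
  case False
  then have ch: "ch = (\<lambda>n. if coprime n q then 1 else 0)" using zero by auto
  obtain A where A: "A holomorphic_on right_half_plane"
    "\<And>s. Re s > 1 \<Longrightarrow> dirichlet_sums (\<lambda>n. if coprime n q then 1 else 0) s (A s / (s - 1))"
    using principal_continuation[OF modulus_pos] by metis
  show ?thesis
  proof (rule moebius_tauberian[OF A(1), of "\<lambda>s. s - 1"])
    show "(\<lambda>s. s - 1) holomorphic_on UNIV" by (intro holomorphic_intros)
    fix s :: complex assume "Re s \<ge> 1"
    show "A s \<noteq> 0"
    proof (cases "Re s = 1")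
      case True
      then have "s = 1 + \<i> * of_real (Im s)" by (simp add: complex_eq_iff)
      then show ?thesis using principal_nonvanishing[OF modulus_pos A] by metis
    next
      case False
      then have "A s / (s - 1) \<noteq> 0" using \<open>Re s \<ge> 1\<close> L_nonzero[of s "A s / (s - 1)"] A(2)[of s] ch by simp
      then show ?thesis by auto
    qed
  qed (use A(2) ch in auto)
qed

end

section \<open>The Moebius function against periodic sequences\<close>

lemma cesaro_null:
  fixes e :: "nat \<Rightarrow> 'b::real_normed_vector"
  assumes "e \<longlonglongrightarrow> 0"
  shows "(\<lambda>N. (1 / real N) *\<^sub>R (\<Sum>n<N. e n)) \<longlonglongrightarrow> 0"
  unfolding tendsto_iff
proof (intro allI impI)
  fix r :: real assume r: "r > 0"
  obtain n0 where n0: "\<And>n. n \<ge> n0 \<Longrightarrow> norm (e n) < r / 2"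
    using LIMSEQ_D[OF assms, of "r / 2"] r by auto
  define C where "C = (\<Sum>n<n0. norm (e n))"
  have bound: "norm (\<Sum>n<N. e n) \<le> C + real N * (r / 2)" if N: "N \<ge> n0" for N
  proof -
    have "norm (\<Sum>n<N. e n) \<le> (\<Sum>n<N. norm (e n))" by (rule norm_sum)
    also have "\<dots> = C + (\<Sum>n=n0..<N. norm (e n))"
      unfolding C_def using N by (metis atLeast0LessThan le0 sum.atLeastLessThan_concat)
    also have "(\<Sum>n=n0..<N. norm (e n)) \<le> (\<Sum>n=n0..<N. r / 2)"
      by (intro sum_mono) (use n0 in \<open>auto intro: less_imp_le\<close>)
    also have "(\<Sum>n=n0..<N. r / 2) \<le> real N * (r / 2)"
      using r by (simp add: mult_right_mono)
    finally show ?thesis by simp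
  qed
  have "(\<lambda>N. C / real N) \<longlonglongrightarrow> 0" by (rule lim_const_over_n)
  then have "\<forall>\<^sub>F N in sequentially. C / real N < r / 2" using r by (intro order_tendstoD(2)) auto
  moreover have "\<forall>\<^sub>F N in sequentially. N \<ge> max n0 1" by (rule eventually_ge_at_top)
  ultimately show "\<forall>\<^sub>F N in sequentially. dist ((1 / real N) *\<^sub>R (\<Sum>n<N. e n)) 0 < r"
  proof eventually_elim
    case (elim N)
    then have "N \<ge> n0" "N > 0" by auto
    have "norm ((1 / real N) *\<^sub>R (\<Sum>n<N. e n)) = norm (\<Sum>n<N. e n) / real N" by simp
    also have "\<dots> \<le> (C + real N * (r / 2)) / real N"
      using bound[OF \<open>N \<ge> n0\<close>] by (intro divide_right_mono) auto
    also have "\<dots> = C / real N + r / 2" using \<open>N > 0\<close> by (simp add: add_divide_distrib)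
    also have "\<dots> < r" using elim(1) by linarith
    finally show ?case by simp
  qed
qed

text \<open>Summation by parts writes the mean as \<open>S N\<close> minus the Cesaro mean of S, and
  both have the same limit.\<close>

lemma kronecker_mean:
  fixes a :: "nat \<Rightarrow> complex"
  assumes "convergent (\<lambda>N. \<Sum>n=1..N. a n / of_nat n)"
  shows "(\<lambda>N. (\<Sum>n=1..N. a n) / of_nat N) \<longlonglongrightarrow> 0"
proof -
  define S where "S N = (\<Sum>n=1..N. a n / of_nat n)" for N
  obtain l where l: "S \<longlonglongrightarrow> l" using assms unfolding S_def convergent_def by blast
  have abel: "(\<Sum>n=1..N. a n) = of_nat N * S N - (\<Sum>n<N. S n)" for N
  proof (induction N)
    case (Suc N)
    have "a (Suc N) = of_nat (Suc N) * (S (Suc N) - S N)" by (simp add: S_def del: of_nat_Suc)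
    then show ?case using Suc by (simp add: algebra_simps)
  qed (simp add: S_def)
  have "(\<lambda>n. S n - l) \<longlonglongrightarrow> 0" using l by (simp add: LIM_zero)
  from tendsto_diff[OF this cesaro_null[OF this]]
  have "(\<lambda>N. (S N - l) - (1 / real N) *\<^sub>R (\<Sum>n<N. S n - l)) \<longlonglongrightarrow> 0" by simp
  moreover have "\<forall>\<^sub>F N in sequentially. (S N - l) - (1 / real N) *\<^sub>R (\<Sum>n<N. S n - l) = (\<Sum>n=1..N. a n) / of_nat N"
    using eventually_gt_at_top[of 0]
  proof eventually_elim
    case (elim N)
    then show ?case unfolding abel by (simp add: scaleR_conv_of_real sum_subtractf field_simps)
  qed
  ultimately show ?thesis by (rule Lim_transform_eventually)
qed

section \<open>Sequences orthogonal to the Moebius function\<close>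

definition moebius_null :: "(nat \<Rightarrow> complex) \<Rightarrow> bool"
  where "moebius_null f \<longleftrightarrow> (\<lambda>N. (\<Sum>n=1..N. of_int (moebius_mu n) * f n) / of_nat N) \<longlonglongrightarrow> 0"

lemma moebius_null_char: "dirichlet_char q ch \<Longrightarrow> moebius_null ch"
  unfolding moebius_null_def by (intro kronecker_mean dirichlet_char.moebius_series_convergent)

lemma moebius_null_cmult: "moebius_null f \<Longrightarrow> moebius_null (\<lambda>n. c * f n)"
proof -
  assume "moebius_null f"
  then have "(\<lambda>N. c * ((\<Sum>n=1..N. of_int (moebius_mu n) * f n) / of_nat N)) \<longlonglongrightarrow> c * 0"
    unfolding moebius_null_def by (intro tendsto_intros)
  moreover have "(\<Sum>n=1..N. of_int (moebius_mu n) * (c * f n)) = c * (\<Sum>n=1..N. of_int (moebius_mu n) * f n)" for N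
    unfolding sum_distrib_left by (intro sum.cong) (auto simp: mult_ac)
  ultimately show ?thesis unfolding moebius_null_def by simp
qed

lemma moebius_null_sum:
  assumes "\<And>j. j \<in> J \<Longrightarrow> moebius_null (f j)"
  shows "moebius_null (\<lambda>n. \<Sum>j\<in>J. f j n)"
proof -
  have "(\<lambda>N. \<Sum>j\<in>J. (\<Sum>n=1..N. of_int (moebius_mu n) * f j n) / of_nat N) \<longlonglongrightarrow> (\<Sum>j\<in>J. 0)"
    using assms unfolding moebius_null_def by (intro tendsto_sum)
  moreover have "(\<Sum>j\<in>J. (\<Sum>n=1..N. of_int (moebius_mu n) * f j n) / of_nat N) =
      (\<Sum>n=1..N. of_int (moebius_mu n) * (\<Sum>j\<in>J. f j n)) / of_nat N" for N
    unfolding sum_divide_distrib[symmetric] sum_distrib_left by (subst sum.swap) simp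
  ultimately show ?thesis unfolding moebius_null_def by simp
qed

definition eigenfunction :: "nat \<Rightarrow> (nat \<Rightarrow> complex) \<Rightarrow> bool"
  where "eigenfunction g f \<longleftrightarrow> (\<exists>c. \<forall>n. f (g * n) = c * f n)"

lemma sum_roots_of_unity_powers:
  assumes "k < (m::nat)"
  shows "(\<Sum>j<m. cis (2 * pi * real j / real m) ^ k) = (if k = 0 then of_nat m else 0)"
proof (cases "k = 0")
  case False
  define z where "z = cis (2 * pi * real k / real m)"
  have m: "m > 0" using assms by simp
  have e: "cis (2 * pi * real j / real m) ^ k = z ^ j" for j
    unfolding z_def by (simp add: Complex.DeMoivre mult_ac)
  have "z ^ m = 1" unfolding z_def using m by (simp add: Complex.DeMoivre cis_multiple_2pi)
  moreover have "z \<noteq> 1"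
  proof
    assume "z = 1"
    then have "cos (2 * pi * real k / real m) = 1" unfolding z_def by (metis Re_complex_of_real cis.sel(1) of_real_1)
    then obtain x :: int where x: "2 * pi * real k / real m = of_int x * 2 * pi" using cos_one_2pi_int by blast
    then have "(2 * pi) * (real k / real m) = (2 * pi) * of_int x" by simp
    then have "real k / real m = of_int x" by (simp only: mult_cancel_left) simp
    then have "real k = of_int x * real m" using m by (simp add: field_simps)
    then have "int k = x * int m" by (metis of_int_eq_iff of_int_mult of_int_of_nat_eq)
    then have "int m dvd int k" by simp
    then have "m dvd k" by simp
    then show False using assms False by (auto dest: dvd_imp_le)
  qed
  ultimately show ?thesis unfolding e using False by (simp add: geometric_sum)
qed simp

text \<open>The operators \<open>f \<mapsto> (\<lambda>n. f (g * n))\<close> for \<open>g\<close> coprime to \<open>q\<close> commute and have finite order, so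
  they are simultaneously diagonalisable; their common eigenfunctions are multiples of characters.\<close>

lemma moebius_null_by_eigenfunctions:
  fixes q :: nat
  defines "V \<equiv> {f :: nat \<Rightarrow> complex. (\<forall>n. f (n + q) = f n) \<and> (\<forall>n. \<not> coprime n q \<longrightarrow> f n = 0)}"
  assumes "q > 0" "\<forall>g\<in>set gs. coprime g q" "f \<in> V"
    and "\<And>f. \<lbrakk>f \<in> V; \<forall>g\<in>set gs. eigenfunction g f\<rbrakk> \<Longrightarrow> moebius_null f"
  shows "moebius_null f"
  using assms(3-)
proof (induction gs arbitrary: f)
  case (Cons g gs)
  note q = \<open>q > 0\<close>
  show ?case
  proof (rule Cons.IH)
    fix f assume f: "f \<in> V" "\<forall>g\<in>set gs. eigenfunction g f"
    define m where "m = totient q"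
    have m: "m > 0" using q by (simp add: m_def)
    have per: "f (n mod q) = f n" for n using f(1) periodic_mod[of f q] unfolding V_def by blast
    have congf: "f a = f b" if "[a = b] (mod q)" for a b using per[of a] per[of b] that by (simp add: cong_def)
    have ord: "f (g ^ m * n) = f n" for n
    proof (rule congf)
      have "[g ^ m = 1] (mod q)" unfolding m_def using Cons.prems(1) by (intro euler_theorem) auto
      then show "[g ^ m * n = n] (mod q)" using cong_scalar_right[of "g ^ m" 1 q n] by simp
    qed
    define w where "w j = cis (- (2 * pi * real j / real m))" for j
    have wm: "w j ^ m = 1" for j
    proof -
      have "cis (2 * pi * real j / real m) ^ m = 1" using m by (simp add: Complex.DeMoivre cis_multiple_2pi)
      moreover have "w j = cnj (cis (2 * pi * real j / real m))" by (simp add: w_def cis_cnj)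
      ultimately show ?thesis by (simp only: complex_cnj_power[symmetric] complex_cnj_one)
    qed
    have w0: "w j \<noteq> 0" for j by (simp add: w_def)
    \<comment> \<open>The projection onto the eigenspace of g whose eigenvalue is the inverse of
      \<open>w j\<close>; averaging over k < m suffices because the m-th power of g is 1 modulo
      q.\<close>
    define P where "P j n = (1 / of_nat m) * (\<Sum>k<m. w j ^ k * f (g ^ k * n))" for j n
    have "moebius_null (P j)" for j
    proof (rule Cons.prems(3))
      show "P j \<in> V"
        unfolding V_def
      proof (intro CollectI conjI allI impI)
        fix n
        have "f (g ^ k * (n + q)) = f (g ^ k * n)" for k
          by (rule congf) (simp add: cong_def distrib_left)
        then show "P j (n + q) = P j n" by (simp add: P_def)
        assume "\<not> coprime n q"
        then have "\<not> coprime (g ^ k * n) q" for k by simp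
        then have "f (g ^ k * n) = 0" for k using f(1) unfolding V_def by blast
        then show "P j n = 0" by (simp add: P_def)
      qed
      have "eigenfunction h (P j)" if h: "h \<in> set gs" for h
      proof -
        obtain c where c: "\<And>n. f (h * n) = c * f n" using f(2) h unfolding eigenfunction_def by blast
        have e: "f (g ^ k * (h * n)) = c * f (g ^ k * n)" for k n
          using c[of "g ^ k * n"] by (simp add: mult_ac)
        have "P j (h * n) = c * P j n" for n
          unfolding P_def e sum_distrib_left by (rule sum.cong[OF refl]) (simp add: mult_ac)
        then show ?thesis unfolding eigenfunction_def by blast
      qed
      moreover have "eigenfunction g (P j)"
      proof -
        have "w j * P j (g * n) = P j n" for n
        proof -
          have "(\<Sum>k<m. w j ^ Suc k * f (g ^ Suc k * n)) + w j ^ 0 * f (g ^ 0 * n) = (\<Sum>k<Suc m. w j ^ k * f (g ^ k * n))"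
            unfolding sum.lessThan_Suc_shift by simp
          also have "\<dots> = (\<Sum>k<m. w j ^ k * f (g ^ k * n)) + w j ^ m * f (g ^ m * n)" by simp
          finally have "(\<Sum>k<m. w j ^ Suc k * f (g ^ Suc k * n)) = (\<Sum>k<m. w j ^ k * f (g ^ k * n))"
            using ord[of n] wm by simp
          moreover have "w j * (\<Sum>k<m. w j ^ k * f (g ^ k * (g * n))) = (\<Sum>k<m. w j ^ Suc k * f (g ^ Suc k * n))"
            unfolding sum_distrib_left by (intro sum.cong) (auto simp: mult_ac)
          ultimately show ?thesis unfolding P_def by (simp add: mult.left_commute)
        qed
        then have "P j (g * n) = inverse (w j) * P j n" for n
          using w0 by (metis left_inverse mult.assoc mult_1)
        then show ?thesis unfolding eigenfunction_def by blast
      qed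
      ultimately show "\<forall>g\<in>set (g # gs). eigenfunction g (P j)" by simp
    qed
    then have "moebius_null (\<lambda>n. \<Sum>j<m. P j n)" by (intro moebius_null_sum)
    moreover have "(\<Sum>j<m. P j n) = f n" for n
    proof -
      \<comment> \<open>Orthogonality of the roots of unity leaves only k = 0, so the projections
        add up to f.\<close>
      have s: "(\<Sum>j<m. w j ^ k) = (if k = 0 then of_nat m else 0)" if "k < m" for k
      proof -
        have "(\<Sum>j<m. w j ^ k) = cnj (\<Sum>j<m. cis (2 * pi * real j / real m) ^ k)"
          unfolding w_def by (simp add: cis_cnj)
        then show ?thesis unfolding sum_roots_of_unity_powers[OF that] by simp
      qed
      have "(\<Sum>j<m. P j n) = (1 / of_nat m) * (\<Sum>k<m. (\<Sum>j<m. w j ^ k) * f (g ^ k * n))"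
        unfolding P_def sum_distrib_left[symmetric] sum_distrib_right by (subst sum.swap) simp
      also have "(\<Sum>k<m. (\<Sum>j<m. w j ^ k) * f (g ^ k * n)) = (\<Sum>k<m. if k = 0 then of_nat m * f n else 0)"
        by (intro sum.cong) (auto simp: s)
      also have "\<dots> = of_nat m * f n" using m by (simp add: sum.delta)
      finally show ?thesis using m by simp
    qed
    ultimately show "moebius_null f" by simp
  qed (use Cons.prems in auto)
qed simp

text \<open>A common eigenfunction satisfies f(ab) f(1) = f(a) f(b). If f(1) = 0, taking a = b shows
  that f vanishes; otherwise f / f(1) is a character, of modulus 1 at the units by Euler's
  theorem.\<close>

lemma moebius_null_coprime:
  fixes f :: "nat \<Rightarrow> complex"
  assumes q: "q > 0" and per: "\<And>n. f (n + q) = f n" and zero: "\<And>n. \<not> coprime n q \<Longrightarrow> f n = 0"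
  shows "moebius_null f"
proof (rule moebius_null_by_eigenfunctions[of q "filter (\<lambda>g. coprime g q) [0..<q]"])
  fix f :: "nat \<Rightarrow> complex"
  assume f: "f \<in> {f. (\<forall>n. f (n + q) = f n) \<and> (\<forall>n. \<not> coprime n q \<longrightarrow> f n = 0)}"
    and eig: "\<forall>g\<in>set (filter (\<lambda>g. coprime g q) [0..<q]). eigenfunction g f"
  have z: "f n = 0" if "\<not> coprime n q" for n using f that by blast
  have per: "f (n + q) = f n" for n using f by blast
  have pm: "f (n mod q) = f n" for n using periodic_mod[of f q, OF per] .
  have ex: "f (a * b) * f 1 = f a * f b" for a b
  proof (cases "coprime a q")
    case True
    have "coprime (a mod q) q" using True by (metis coprime_mod_left_iff q neq0_conv)
    then have "eigenfunction (a mod q) f" using eig q by simp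
    then obtain c where c: "\<And>n. f ((a mod q) * n) = c * f n" unfolding eigenfunction_def by blast
    have fa: "f (a * n) = c * f n" for n
      using c[of n] pm[of "(a mod q) * n"] pm[of "a * n"] by (simp add: mod_mult_left_eq)
    show ?thesis using fa[of b] fa[of 1] by simp
  next
    case False
    then show ?thesis using z[of a] z[of "a * b"] by simp
  qed
  show "moebius_null f"
  proof (cases "f 1 = 0")
    case True
    have "f n = 0" for n
    proof -
      have "f n * f n = 0" using ex[of n n] True by simp
      then show ?thesis by simp
    qed
    then show ?thesis by (simp add: moebius_null_def)
  next
    case False
    define ch where "ch n = f n / f 1" for n
    have mult: "ch (a * b) = ch a * ch b" for a b
      using ex[of a b] False by (simp add: ch_def field_simps)
    have ch1: "ch 1 = 1" using False by (simp add: ch_def)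
    have chp: "ch (a ^ k) = ch a ^ k" for a k by (induction k) (use ch1 mult in auto)
    have "dirichlet_char q ch"
    proof
      fix n assume n: "coprime n q"
      have "[n ^ totient q = 1] (mod q)" using n by (rule euler_theorem)
      then have "f (n ^ totient q) = f 1" using pm by (metis cong_def)
      then have "ch n ^ totient q = 1" using chp[of n "totient q"] False by (simp add: ch_def)
      then have "norm (ch n) ^ totient q = 1" by (metis norm_one norm_power)
      then show "norm (ch n) = 1" 
        using power_eq_imp_eq_base[of "norm (ch n)" "totient q" 1] q by simp
    qed (use q mult per z in \<open>auto simp: ch_def\<close>)
    then have "moebius_null (\<lambda>n. f 1 * ch n)" by (intro moebius_null_cmult moebius_null_char)
    then show ?thesis using False by (simp add: ch_def)
  qed
qed (use assms in auto)

text \<open>With g = gcd a q, the n congruent to a modulo q are the products g k with k congruent to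
  a' modulo q', and \<mu>(g k) is \<mu>(g) \<mu>(k) or 0 according to whether k is coprime to g. The
  surviving k are coprime to q, the case already settled, and the range shrinks to N div g.\<close>

lemma moebius_null_residue:
  fixes q a :: nat
  assumes q: "q > 0" and a: "a < q"
  shows "moebius_null (\<lambda>n. if n mod q = a then 1 else 0)"
proof -
  define g where "g = gcd a q"
  have g: "g > 0" "g dvd a" "g dvd q" using q by (auto simp: g_def)
  obtain a' q' where aq: "a = g * a'" "q = g * q'" using g by (meson dvdE)
  have q': "q' > 0" using q aq by (cases "q' = 0") auto
  have co: "coprime a' q'"
  proof -
    have "g * gcd a' q' = gcd a q" unfolding aq by (rule gcd_mult_distrib_nat)
    then have "g * gcd a' q' = g * 1" by (simp only: g_def mult_1_right)
    then show ?thesis using g by (simp only: coprime_iff_gcd_eq_1 mult_cancel1) simp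
  qed
  define f where "f k = (if k mod q' = a' \<and> coprime k g then 1 else 0 :: complex)" for k
  have "moebius_null f"
  proof (rule moebius_null_coprime[OF q])
    fix k
    have "(k + q) mod q' = k mod q'" unfolding aq by simp
    moreover have "coprime (k + q) g \<longleftrightarrow> coprime k g"
    proof -
      have "gcd (k + q) g = gcd k g" unfolding aq(2) by (metis add.commute gcd.commute gcd_add_mult mult.commute)
      then show ?thesis by (simp only: coprime_iff_gcd_eq_1)
    qed
    ultimately show "f (k + q) = f k" by (simp add: f_def)
    assume nc: "\<not> coprime k q"
    show "f k = 0"
    proof (rule ccontr)
      assume "f k \<noteq> 0"
      then have k: "k mod q' = a'" "coprime k g" by (auto simp: f_def split: if_splits)
      have "coprime k q'" using co k(1) q' by (metis coprime_mod_left_iff neq0_conv)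
      then show False using nc k(2) unfolding aq by simp
    qed
  qed
  then have lim: "(\<lambda>N. (\<Sum>n=1..N. of_int (moebius_mu n) * f n) / of_nat N) \<longlonglongrightarrow> 0"
    by (simp add: moebius_null_def)
  have eq: "(\<Sum>n=1..N. of_int (moebius_mu n) * (if n mod q = a then 1 else 0)) =
      of_int (moebius_mu g) * (\<Sum>k=1..N div g. of_int (moebius_mu k) * f k)" for N
  proof -
    have "(\<Sum>n=1..N. of_int (moebius_mu n) * (if n mod q = a then 1 else 0 :: complex)) =
        (\<Sum>n\<in>(\<lambda>k. g * k) ` {1..N div g}. of_int (moebius_mu n) * (if n mod q = a then 1 else 0))"
    proof (rule sum.mono_neutral_right)
      show "(\<lambda>k. g * k) ` {1..N div g} \<subseteq> {1..N}"
        using g by (auto simp: less_eq_div_iff_mult_less_eq mult.commute)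
      show "\<forall>n\<in>{1..N} - (\<lambda>k. g * k) ` {1..N div g}. of_int (moebius_mu n) * (if n mod q = a then 1 else 0 :: complex) = 0"
      proof
        fix n assume n: "n \<in> {1..N} - (\<lambda>k. g * k) ` {1..N div g}"
        have "n mod q \<noteq> a"
        proof
          assume "n mod q = a"
          then have "g dvd n" using g by (metis dvd_mod_iff)
          then obtain k where k: "n = g * k" by blast
          have "k \<in> {1..N div g}" using n k g by (auto simp: less_eq_div_iff_mult_less_eq mult.commute)
          then show False using n k by blast
        qed
        then show "of_int (moebius_mu n) * (if n mod q = a then 1 else 0 :: complex) = 0" by simp
      qed
    qed simp
    also have "\<dots> = (\<Sum>k=1..N div g. of_int (moebius_mu (g * k)) * (if (g * k) mod q = a then 1 else 0))"
      using g by (subst sum.reindex) (auto simp: inj_on_def)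
    also have "\<dots> = (\<Sum>k=1..N div g. of_int (moebius_mu g) * (of_int (moebius_mu k) * f k))"
    proof (rule sum.cong[OF refl])
      fix k assume k: "k \<in> {1..N div g}"
      have "(g * k) mod q = a \<longleftrightarrow> k mod q' = a'" unfolding aq using g by simp
      then show "of_int (moebius_mu (g * k)) * (if (g * k) mod q = a then 1 else 0) =
          of_int (moebius_mu g) * (of_int (moebius_mu k) * f k)"
        using moebius_mu_mult[OF g(1), of k] k by (auto simp: f_def coprime_commute)
    qed
    finally show ?thesis by (simp add: sum_distrib_left)
  qed
  have "(\<lambda>N. of_int (moebius_mu g) * ((\<Sum>k=1..N div g. of_int (moebius_mu k) * f k) / of_nat (N div g))) \<longlonglongrightarrow> of_int (moebius_mu g) * 0"
    using g by (intro tendsto_intros filterlim_compose[OF lim] filterlim_at_top_div_const_nat)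
  then have lim2: "(\<lambda>N. norm (of_int (moebius_mu g) * ((\<Sum>k=1..N div g. of_int (moebius_mu k) * f k) / of_nat (N div g)))) \<longlonglongrightarrow> 0"
    by (simp add: tendsto_norm_zero)
  show ?thesis
    unfolding moebius_null_def eq
  proof (rule Lim_null_comparison[OF _ lim2], rule always_eventually, rule allI)
    fix N
    let ?A = "of_int (moebius_mu g) * (\<Sum>k=1..N div g. of_int (moebius_mu k) * f k)"
    show "norm (?A / of_nat N) \<le> norm (of_int (moebius_mu g) * ((\<Sum>k=1..N div g. of_int (moebius_mu k) * f k) / of_nat (N div g)))"
    proof (cases "N div g = 0")
      case False
      then have "N > 0" by (cases "N = 0") auto
      then have "norm ?A / real N \<le> norm ?A / real (N div g)"
        using False by (intro divide_left_mono) (auto simp: div_le_dividend)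
      then show ?thesis by (simp add: norm_divide norm_mult)
    qed simp
  qed
qed

lemma moebius_null_periodic:
  fixes f :: "nat \<Rightarrow> complex"
  assumes q: "q > 0" and per: "\<And>n. f (n + q) = f n"
  shows "moebius_null f"
proof -
  have "moebius_null (\<lambda>n. \<Sum>a<q. f a * (if n mod q = a then 1 else 0))"
    using moebius_null_residue[OF q] by (intro moebius_null_sum moebius_null_cmult) auto
  moreover have "(\<Sum>a<q. f a * (if n mod q = a then 1 else 0)) = f n" for n
  proof -
    have "(\<Sum>a<q. f a * (if n mod q = a then 1 else 0)) = (\<Sum>a<q. if n mod q = a then f a else 0)"
      by (intro sum.cong) auto
    also have "\<dots> = f (n mod q)" using q by (simp add: sum.delta')
    also have "\<dots> = f n" using periodic_mod[of f q, OF per] .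
    finally show ?thesis .
  qed
  ultimately show ?thesis by simp
qed

lemma moebius_null_approx:
  fixes f :: "nat \<Rightarrow> complex"
  assumes "\<And>e. e > 0 \<Longrightarrow> \<exists>g N0. moebius_null g \<and> (\<forall>n\<ge>N0. norm (f n - g n) < e)"
  shows "moebius_null f"
  unfolding moebius_null_def tendsto_iff
proof (intro allI impI)
  fix e :: real assume e: "e > 0"
  obtain g N0 where g: "moebius_null g" "\<And>n. n \<ge> N0 \<Longrightarrow> norm (f n - g n) < e / 3" using assms[of "e / 3"] e by auto
  \<comment> \<open>The total error below N0, where nothing is assumed about g; divided by N it
    tends to 0.\<close>
  define C where "C = (\<Sum>n<N0. norm (f n - g n))"
  have C0: "C \<ge> 0" unfolding C_def by (intro sum_nonneg) auto
  have bound: "norm (\<Sum>n=1..N. of_int (moebius_mu n) * (f n - g n)) \<le> C + real N * (e / 3)" for N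
  proof -
    have 1: "norm (of_int (moebius_mu n) * (f n - g n)) \<le> (if n < N0 then norm (f n - g n) else 0) + e / 3" for n
    proof -
      have "norm (of_int (moebius_mu n) :: complex) \<le> 1" using abs_moebius_mu_le[of n] by simp
      then have "norm (of_int (moebius_mu n) * (f n - g n)) \<le> 1 * norm (f n - g n)"
        unfolding norm_mult by (intro mult_right_mono) auto
      moreover have "norm (f n - g n) \<le> (if n < N0 then norm (f n - g n) else 0) + e / 3"
        using g(2)[of n] e by auto
      ultimately show ?thesis by simp
    qed
    have "norm (\<Sum>n=1..N. of_int (moebius_mu n) * (f n - g n)) \<le>
        (\<Sum>n=1..N. (if n < N0 then norm (f n - g n) else 0) + e / 3)"
      by (rule order_trans[OF norm_sum]) (intro sum_mono 1)
    also have "\<dots> = (\<Sum>n\<in>{1..N} \<inter> {n. n < N0}. norm (f n - g n)) + real N * (e / 3)"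
      by (simp add: sum.distrib sum.inter_restrict)
    also have "(\<Sum>n\<in>{1..N} \<inter> {n. n < N0}. norm (f n - g n)) \<le> C"
      unfolding C_def by (intro sum_mono2) auto
    finally show ?thesis by simp
  qed
  have "(\<lambda>N. C / real N) \<longlonglongrightarrow> 0" by (rule lim_const_over_n)
  then have "\<forall>\<^sub>F N in sequentially. C / real N < e / 3" using e by (intro order_tendstoD(2)) auto
  moreover have "\<forall>\<^sub>F N in sequentially. dist ((\<Sum>n=1..N. of_int (moebius_mu n) * g n) / of_nat N) 0 < e / 3"
    using g(1) e unfolding moebius_null_def by (intro tendstoD) auto
  moreover have "\<forall>\<^sub>F N in sequentially. N > 0" by (rule eventually_gt_at_top)
  ultimately show "\<forall>\<^sub>F N in sequentially. dist ((\<Sum>n=1..N. of_int (moebius_mu n) * f n) / of_nat N) 0 < e"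
  proof eventually_elim
    case (elim N)
    let ?D = "(\<Sum>n=1..N. of_int (moebius_mu n) * (f n - g n)) / of_nat N :: complex"
    let ?G = "(\<Sum>n=1..N. of_int (moebius_mu n) * g n) / of_nat N :: complex"
    have eq: "(\<Sum>n=1..N. of_int (moebius_mu n) * f n) / of_nat N = ?D + ?G"
      by (simp add: add_divide_distrib[symmetric] sum.distrib[symmetric] algebra_simps)
    have "norm ?D \<le> C / real N + e / 3"
    proof -
      have "norm ?D \<le> (C + real N * (e / 3)) / real N"
        unfolding norm_divide norm_of_nat using bound by (intro divide_right_mono) auto
      then show ?thesis using elim by (simp add: add_divide_distrib)
    qed
    moreover have "norm ?G < e / 3" using elim(2) by (simp only: dist_norm diff_0_right)
    ultimately have "norm (?D + ?G) < e"
      using elim(1) norm_triangle_ineq[of ?D ?G] by linarith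
    then show ?case unfolding dist_norm diff_0_right eq .
  qed
qed

theorem theorem6p2:
  fixes X :: "'a topology"
    and m :: "'a \<Rightarrow> 'a \<Rightarrow> 'a \<Rightarrow> 'a"
    and T :: "'a \<Rightarrow> 'a"
    and \<phi> :: "'a \<Rightarrow> complex"
    and x :: 'a
  assumes "compact_metrizable_median_algebra X m"
    and "median_rank (topspace X) m < \<infinity>"
    and "homeomorphic_median_automorphism X m T"
    and "continuous_map X euclidean \<phi>"
    and "x \<in> topspace X"
  shows "(\<lambda>N. (1 / of_nat N) * (\<Sum>n=1..N. of_int (moebius_mu n) * \<phi> ((T ^^ n) x)))
           \<longlonglongrightarrow> 0"
proof -
  interpret compact_metrizable_median_algebra X m by fact
  have "moebius_null (\<lambda>n. \<phi> ((T ^^ n) x))"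
  proof (rule moebius_null_approx)
    fix e :: real assume "e > 0"
    then obtain q N :: nat and \<psi> :: "nat \<Rightarrow> complex"
      where "q > 0" "\<And>n. \<psi> (n + q) = \<psi> n" "\<And>n. n \<ge> N \<Longrightarrow> norm (\<phi> ((T ^^ n) x) - \<psi> n) < e"
      using orbit_approx_periodic[OF assms(2-5)] by metis
    then show "\<exists>g N0. moebius_null g \<and> (\<forall>n\<ge>N0. norm (\<phi> ((T ^^ n) x) - g n) < e)"
      using moebius_null_periodic by blast
  qed
  then show ?thesis by (simp add: moebius_null_def)
qed

end
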